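(* Let $M$ be a graded $R$-module and $X:=(X_1,\ldots,X_n)$. For any integer $j$, $$\mathrm{Supp}_G(\mathrm{Tor}^R_j(M,S))\subset \bigcup_{k\geq 0}\bigl(\mathrm{Supp}_G(H^{k}_B(M))+\mathscr{E}^X_{j+k}\bigr).$$
   Context: $G$ is a finitely generated abelian group, $S$ is a commutative ring, and $R=S[X_1,\ldots,X_n]$ is $G$-graded with $\deg(X_i)=\gamma_i\in G$ and $\deg(s)=0$ for $s\in S$. $B\subseteq (X_1,\ldots,X_n)$ is a finitely generated graded $R$-ideal. $S$ is viewed as the graded $R$-module $R/(X_1,\ldots,X_n)$. $H^i_B(M)$ denotes the $i$-th cohomology of the Čech complex of $M$ on a finite set of homogeneous generators of $B$. $\mathrm{Supp}_G(M):=\{\gamma\in G: M_\gamma\neq 0\}$. Set $\mathscr{E}_0^X:=\{0\}$ and, for $i>0$, $\mathscr{E}_i^X:=\{\gamma_{j_1}+\cdots+\gamma_{j_i} : 1\le j_1<\cdots<j_i\le n\}$ (empty for $i>n$). For subsets $A,A'$ of $G$, $A+A'=\{a+a'\}$ (empty if one of them is empty). *)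

theory Defs
  imports
    "HOL-Algebra.Algebra"
    "HOL-Computational_Algebra.Group_Closure"
    "HOL-Library.Set_Algebras"
begin

section \<open>Graded rings and graded modules\<close>

text \<open>
  The grading group is a type \<open>'g\<close> of class \<open>ab_group_add\<close>. Graded rings and modules carry
  their homogeneous components as an additional record field. The fields \<open>mult\<close> and \<open>one\<close>
  that HOL-Algebra modules inherit from rings play no role for modules.
\<close>

record ('a, 'g) gr_ring = "'a ring" +
  rcomp :: "'g \<Rightarrow> 'a set"

record ('a, 'b, 'g) gr_module = "('a, 'b) module" +
  hcomp :: "'g \<Rightarrow> 'b set"

definition direct_sum_decomposition ::
    "('b, 'x) ring_scheme \<Rightarrow> ('g \<Rightarrow> 'b set) \<Rightarrow> bool" where
  "direct_sum_decomposition M C \<longleftrightarrow>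
     (\<forall>\<gamma>. subgroup (C \<gamma>) (add_monoid M)) \<and>
     (\<forall>x\<in>carrier M. \<exists>!c. (\<forall>\<gamma>. c \<gamma> \<in> C \<gamma>) \<and> finite {\<gamma>. c \<gamma> \<noteq> \<zero>\<^bsub>M\<^esub>} \<and>
        x = (\<Oplus>\<^bsub>M\<^esub>\<gamma>\<in>{\<gamma>. c \<gamma> \<noteq> \<zero>\<^bsub>M\<^esub>}. c \<gamma>))"

definition graded_module ::
    "('a, 'g::ab_group_add) gr_ring \<Rightarrow> ('a, 'b, 'g) gr_module \<Rightarrow> bool" where
  "graded_module R M \<longleftrightarrow>
     module R M \<and> direct_sum_decomposition M (hcomp M) \<and>
     (\<forall>\<gamma> \<delta>. \<forall>r\<in>rcomp R \<gamma>. \<forall>x\<in>hcomp M \<delta>. r \<odot>\<^bsub>M\<^esub> x \<in> hcomp M (\<gamma> + \<delta>))"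

definition gr_supp :: "('a, 'b, 'g) gr_module \<Rightarrow> 'g set" where
  "gr_supp M = {\<gamma>. hcomp M \<gamma> \<noteq> {\<zero>\<^bsub>M\<^esub>}}"

definition graded_hom ::
    "('a, 'g) gr_ring \<Rightarrow> ('a, 'b, 'g) gr_module \<Rightarrow> ('a, 'c, 'g) gr_module \<Rightarrow> ('b \<Rightarrow> 'c) \<Rightarrow> bool"
  where
  "graded_hom R M N h \<longleftrightarrow>
     h \<in> carrier M \<rightarrow> carrier N \<and>
     (\<forall>x\<in>carrier M. \<forall>y\<in>carrier M. h (x \<oplus>\<^bsub>M\<^esub> y) = h x \<oplus>\<^bsub>N\<^esub> h y) \<and>
     (\<forall>r\<in>carrier R. \<forall>x\<in>carrier M. h (r \<odot>\<^bsub>M\<^esub> x) = r \<odot>\<^bsub>N\<^esub> h x) \<and>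
     (\<forall>\<gamma>. h ` hcomp M \<gamma> \<subseteq> hcomp N \<gamma>)"

text \<open>The graded subquotient \<open>Z/N\<close> of \<open>M\<close>, for graded submodules \<open>N \<subseteq> Z\<close> of \<open>M\<close>.\<close>

definition gr_subquot ::
    "('a, 'b, 'g) gr_module \<Rightarrow> 'b set \<Rightarrow> 'b set \<Rightarrow> ('a, 'b set, 'g) gr_module" where
  "gr_subquot M Z N =
     \<lparr>carrier = (\<lambda>z. N +>\<^bsub>M\<^esub> z) ` Z, monoid.mult = undefined, monoid.one = undefined,
      ring.zero = N, ring.add = set_add M,
      module.smult = (\<lambda>r C. \<Union>x\<in>C. N +>\<^bsub>M\<^esub> (r \<odot>\<^bsub>M\<^esub> x)),
      hcomp = (\<lambda>\<gamma>. (\<lambda>z. N +>\<^bsub>M\<^esub> z) ` (Z \<inter> hcomp M \<gamma>))\<rparr>"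

text \<open>Homology at \<open>M\<close> of \<open>L \<rightarrow> M \<rightarrow> N\<close> with maps \<open>f\<close> and \<open>g\<close>.\<close>

definition gr_homology ::
    "('a, 'l, 'g) gr_module \<Rightarrow> ('a, 'b, 'g) gr_module \<Rightarrow> ('a, 'c, 'g) gr_module \<Rightarrow>
     ('l \<Rightarrow> 'b) \<Rightarrow> ('b \<Rightarrow> 'c) \<Rightarrow> ('a, 'b set, 'g) gr_module" where
  "gr_homology L M N f g = gr_subquot M (a_kernel M N g) (f ` carrier L)"

definition gr_regular_module :: "('a, 'g) gr_ring \<Rightarrow> ('a, 'a, 'g) gr_module" where
  "gr_regular_module R =
     \<lparr>carrier = carrier R, monoid.mult = monoid.mult R, monoid.one = monoid.one R, ring.zero = ring.zero R, ring.add = ring.add R,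
      module.smult = monoid.mult R, hcomp = rcomp R\<rparr>"

section \<open>The graded polynomial ring\<close>

text \<open>
  Polynomials in the variables \<open>X\<^sub>i\<close>, \<open>i < n\<close>, are the indexed polynomials of HOL-Algebra, i.e.
  coefficient functions on monomials, a monomial being the multiset of its variables. That
  theory does not define the product of two polynomials; it is the convolution below.
\<close>

definition mpoly_mult ::
    "('s, 'x) ring_scheme \<Rightarrow> ('c multiset \<Rightarrow> 's) \<Rightarrow> ('c multiset \<Rightarrow> 's) \<Rightarrow> 'c multiset \<Rightarrow> 's" where
  "mpoly_mult S P Q = (\<lambda>m. \<Oplus>\<^bsub>S\<^esub>k\<in>{k. k \<subseteq># m}. P k \<otimes>\<^bsub>S\<^esub> Q (m - k))"

definition gr_mpoly_ring ::
    "('s, 'x) ring_scheme \<Rightarrow> nat \<Rightarrow> (nat \<Rightarrow> 'g::ab_group_add) \<Rightarrow> (nat multiset \<Rightarrow> 's, 'g) gr_ring" where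
  "gr_mpoly_ring S n \<gamma> =
     \<lparr>carrier = ring.indexed_pset S {..<n} (carrier S),
      monoid.mult = mpoly_mult S, monoid.one = ring.indexed_const S \<one>\<^bsub>S\<^esub>,
      ring.zero = ring.indexed_const S \<zero>\<^bsub>S\<^esub>, ring.add = ring.indexed_padd S,
      rcomp = (\<lambda>g. {P \<in> ring.indexed_pset S {..<n} (carrier S).
                      \<forall>m. P m \<noteq> \<zero>\<^bsub>S\<^esub> \<longrightarrow> (\<Sum>i\<in>#m. \<gamma> i) = g})\<rparr>"

definition var_ideal ::
    "('s, 'x) ring_scheme \<Rightarrow> nat \<Rightarrow> (nat \<Rightarrow> 'g::ab_group_add) \<Rightarrow> (nat multiset \<Rightarrow> 's) set" where
  "var_ideal S n \<gamma> = Idl\<^bsub>gr_mpoly_ring S n \<gamma>\<^esub> (ring.indexed_var S ` {..<n})"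

text \<open>\<open>S\<close> as the graded module \<open>R/(X\<^sub>1, \<dots>, X\<^sub>n)\<close> over \<open>R = S[X\<^sub>1, \<dots>, X\<^sub>n]\<close>.\<close>

definition coeff_module ::
    "('s, 'x) ring_scheme \<Rightarrow> nat \<Rightarrow> (nat \<Rightarrow> 'g::ab_group_add) \<Rightarrow>
     (nat multiset \<Rightarrow> 's, (nat multiset \<Rightarrow> 's) set, 'g) gr_module" where
  "coeff_module S n \<gamma> =
     gr_subquot (gr_regular_module (gr_mpoly_ring S n \<gamma>))
       (carrier (gr_mpoly_ring S n \<gamma>)) (var_ideal S n \<gamma>)"

text \<open>\<open>\<E>\<^sub>i\<close>: a sequence \<open>j\<^sub>1 < \<dots> < j\<^sub>i\<close> is given by the set of its entries. For \<open>i = 0\<close> this is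
  \<open>{0}\<close>; for \<open>i > n\<close> and for \<open>i < 0\<close> it is empty.\<close>

definition var_degree_sums :: "nat \<Rightarrow> (nat \<Rightarrow> 'g::ab_group_add) \<Rightarrow> int \<Rightarrow> 'g set" where
  "var_degree_sums n \<gamma> i = {(\<Sum>j\<in>J. \<gamma> j) | J. J \<subseteq> {..<n} \<and> int (card J) = i}"

section \<open>Graded tensor products and Tor\<close>

definition tensor_relators ::
    "('a, 'g) gr_ring \<Rightarrow> ('a, 'b, 'g) gr_module \<Rightarrow> ('a, 'c, 'g) gr_module \<Rightarrow> ('b \<times> 'c \<Rightarrow>\<^sub>0 int) set"
  where
  "tensor_relators R M N =
     {frag_of (x \<oplus>\<^bsub>M\<^esub> x', y) - frag_of (x, y) - frag_of (x', y) | x x' y.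
        x \<in> carrier M \<and> x' \<in> carrier M \<and> y \<in> carrier N} \<union>
     {frag_of (x, y \<oplus>\<^bsub>N\<^esub> y') - frag_of (x, y) - frag_of (x, y') | x y y'.
        x \<in> carrier M \<and> y \<in> carrier N \<and> y' \<in> carrier N} \<union>
     {frag_of (r \<odot>\<^bsub>M\<^esub> x, y) - frag_of (x, r \<odot>\<^bsub>N\<^esub> y) | r x y.
        r \<in> carrier R \<and> x \<in> carrier M \<and> y \<in> carrier N}"

definition tensor_kernel ::
    "('a, 'g) gr_ring \<Rightarrow> ('a, 'b, 'g) gr_module \<Rightarrow> ('a, 'c, 'g) gr_module \<Rightarrow> ('b \<times> 'c \<Rightarrow>\<^sub>0 int) set"
  where
  "tensor_kernel R M N =
     generate (free_Abelian_group (carrier M \<times> carrier N)) (tensor_relators R M N)"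

text \<open>The component of degree \<open>\<gamma>\<close> is generated by the \<open>x \<otimes> y\<close> with \<open>x\<close>, \<open>y\<close> homogeneous and
  \<open>deg x + deg y = \<gamma>\<close>.\<close>

definition gr_tensor ::
    "('a, 'g::ab_group_add) gr_ring \<Rightarrow> ('a, 'b, 'g) gr_module \<Rightarrow> ('a, 'c, 'g) gr_module \<Rightarrow>
     ('a, ('b \<times> 'c \<Rightarrow>\<^sub>0 int) set, 'g) gr_module" where
  "gr_tensor R M N =
     (let A = free_Abelian_group (carrier M \<times> carrier N); K = tensor_kernel R M N in
     \<lparr>carrier = rcosets\<^bsub>A\<^esub> K, monoid.mult = undefined, monoid.one = undefined,
      ring.zero = K, ring.add = set_mult A,
      module.smult = (\<lambda>r C. \<Union>p\<in>C. K #>\<^bsub>A\<^esub> frag_extend (\<lambda>(x, y). frag_of (r \<odot>\<^bsub>M\<^esub> x, y)) p),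
      hcomp = (\<lambda>\<gamma>. (\<lambda>p. K #>\<^bsub>A\<^esub> p) `
        generate A {frag_of (x, y) | x y \<alpha> \<beta>. x \<in> hcomp M \<alpha> \<and> y \<in> hcomp N \<beta> \<and> \<alpha> + \<beta> = \<gamma>})\<rparr>)"

text \<open>The map \<open>h \<otimes> id\<close> into \<open>M \<otimes> N\<close>, where \<open>h\<close> is a homomorphism into \<open>M\<close>.\<close>

definition tensor_map ::
    "('a, 'g) gr_ring \<Rightarrow> ('a, 'b, 'g) gr_module \<Rightarrow> ('a, 'c, 'g) gr_module \<Rightarrow> ('d \<Rightarrow> 'b) \<Rightarrow>
     ('d \<times> 'c \<Rightarrow>\<^sub>0 int) set \<Rightarrow> ('b \<times> 'c \<Rightarrow>\<^sub>0 int) set" where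
  "tensor_map R M N h C =
     (\<Union>p\<in>C. tensor_kernel R M N #>\<^bsub>free_Abelian_group (carrier M \<times> carrier N)\<^esub>
        frag_extend (\<lambda>(x, y). frag_of (h x, y)) p)"

definition homogeneous_basis ::
    "('a, 'g) gr_ring \<Rightarrow> ('a, 'b, 'g) gr_module \<Rightarrow> 'b set \<Rightarrow> bool" where
  "homogeneous_basis R F E \<longleftrightarrow>
     E \<subseteq> carrier F \<and> (\<forall>e\<in>E. \<exists>\<gamma>. e \<in> hcomp F \<gamma>) \<and>
     (\<forall>x\<in>carrier F. \<exists>!a. a \<in> E \<rightarrow> carrier R \<and> (\<forall>e. e \<notin> E \<longrightarrow> a e = \<zero>\<^bsub>R\<^esub>) \<and>
        finite {e. a e \<noteq> \<zero>\<^bsub>R\<^esub>} \<and>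
        x = (\<Oplus>\<^bsub>F\<^esub>e\<in>{e. a e \<noteq> \<zero>\<^bsub>R\<^esub>}. a e \<odot>\<^bsub>F\<^esub> e))"

text \<open>
  \<open>\<cdots> \<rightarrow> F\<^sub>1 \<rightarrow> F\<^sub>0 \<rightarrow> M \<rightarrow> 0\<close> with differentials \<open>d i : F i \<rightarrow> F (i - 1)\<close> and augmentation \<open>\<epsilon>\<close>;
  the complex is extended by zero modules in negative degrees.
\<close>

definition graded_free_resolution ::
    "('a, 'g::ab_group_add) gr_ring \<Rightarrow> ('a, 'b, 'g) gr_module \<Rightarrow>
     (int \<Rightarrow> ('a, 'f, 'g) gr_module) \<Rightarrow> (int \<Rightarrow> 'f \<Rightarrow> 'f) \<Rightarrow> ('f \<Rightarrow> 'b) \<Rightarrow> bool" where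
  "graded_free_resolution R M F d \<epsilon> \<longleftrightarrow>
     (\<forall>i. graded_module R (F i) \<and> (\<exists>E. homogeneous_basis R (F i) E)) \<and>
     (\<forall>i<0. carrier (F i) = {\<zero>\<^bsub>F i\<^esub>}) \<and>
     (\<forall>i. graded_hom R (F i) (F (i - 1)) (d i)) \<and>
     graded_hom R (F 0) M \<epsilon> \<and>
     \<epsilon> ` carrier (F 0) = carrier M \<and>
     a_kernel (F 0) M \<epsilon> = d 1 ` carrier (F 1) \<and>
     (\<forall>i>0. a_kernel (F i) (F (i - 1)) (d i) = d (i + 1) ` carrier (F (i + 1)))"

text \<open>
  \<open>Tor\<^sub>i(M, N) = H\<^sub>i(F \<otimes> N)\<close> for a graded free resolution \<open>F\<close> of \<open>M\<close>. Up to graded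
  isomorphism it does not depend on \<open>F\<close>, which is therefore kept as an argument; statements
  about \<open>Tor\<close> quantify over all graded free resolutions of \<open>M\<close>.
\<close>

definition gr_Tor ::
    "('a, 'g::ab_group_add) gr_ring \<Rightarrow> (int \<Rightarrow> ('a, 'f, 'g) gr_module) \<Rightarrow> (int \<Rightarrow> 'f \<Rightarrow> 'f) \<Rightarrow>
     ('a, 'c, 'g) gr_module \<Rightarrow> int \<Rightarrow> ('a, ('f \<times> 'c \<Rightarrow>\<^sub>0 int) set set, 'g) gr_module" where
  "gr_Tor R F d N i =
     gr_homology (gr_tensor R (F (i + 1)) N) (gr_tensor R (F i) N) (gr_tensor R (F (i - 1)) N)
       (tensor_map R (F i) N (d (i + 1))) (tensor_map R (F (i - 1)) N (d i))"

section \<open>Localization and \v{C}ech cohomology\<close>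

text \<open>The pair \<open>(x, k)\<close> stands for the fraction \<open>x / f\<^sup>k\<close>.\<close>

definition frac_rel ::
    "('a, 'g) gr_ring \<Rightarrow> ('a, 'b, 'g) gr_module \<Rightarrow> 'a \<Rightarrow> (('b \<times> nat) \<times> ('b \<times> nat)) set" where
  "frac_rel R M f =
     {((x, k), (y, l)) | x k y l. x \<in> carrier M \<and> y \<in> carrier M \<and>
        (\<exists>t::nat. (f [^]\<^bsub>R\<^esub> (t + l)) \<odot>\<^bsub>M\<^esub> x = (f [^]\<^bsub>R\<^esub> (t + k)) \<odot>\<^bsub>M\<^esub> y)}"

text \<open>The localization \<open>M\<^sub>f\<close> at a homogeneous \<open>f\<close> of degree \<open>\<delta>\<close>; here \<open>x / f\<^sup>k\<close> has degree
  \<open>deg x - k \<delta>\<close>.\<close>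

definition gr_localization ::
    "('a, 'g::ab_group_add) gr_ring \<Rightarrow> ('a, 'b, 'g) gr_module \<Rightarrow> 'a \<Rightarrow> 'g \<Rightarrow>
     ('a, ('b \<times> nat) set, 'g) gr_module" where
  "gr_localization R M f \<delta> =
     \<lparr>carrier = (carrier M \<times> UNIV) // frac_rel R M f, monoid.mult = undefined, monoid.one = undefined,
      ring.zero = frac_rel R M f `` {(\<zero>\<^bsub>M\<^esub>, 0)},
      ring.add = (\<lambda>C D. \<Union>(x, k)\<in>C. \<Union>(y, l)\<in>D. frac_rel R M f ``
        {((f [^]\<^bsub>R\<^esub> l) \<odot>\<^bsub>M\<^esub> x \<oplus>\<^bsub>M\<^esub> (f [^]\<^bsub>R\<^esub> k) \<odot>\<^bsub>M\<^esub> y, k + l)}),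
      module.smult = (\<lambda>r C. \<Union>(x, k)\<in>C. frac_rel R M f `` {(r \<odot>\<^bsub>M\<^esub> x, k)}),
      hcomp = (\<lambda>\<gamma>. {frac_rel R M f `` {(x, k)} | x k. x \<in> hcomp M (\<gamma> + (\<Sum>i<k. \<delta>))})\<rparr>"

text \<open>
  \<open>M\<close> localized at \<open>f\<^sub>I = \<Prod>\<^bsub>i \<in> I\<^esub> f\<^sub>i\<close>, where \<open>f\<^sub>i\<close> is homogeneous of degree \<open>\<delta>\<^sub>i\<close>. For
  \<open>I = {}\<close> this is the localization at \<open>1\<close>, i.e. \<open>M\<close> itself up to isomorphism.
\<close>

definition cech_loc ::
    "('a, 'g::ab_group_add) gr_ring \<Rightarrow> ('a, 'b, 'g) gr_module \<Rightarrow> (nat \<Rightarrow> 'a) \<Rightarrow> (nat \<Rightarrow> 'g) \<Rightarrow>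
     nat set \<Rightarrow> ('a, ('b \<times> nat) set, 'g) gr_module" where
  "cech_loc R M f \<delta> I = gr_localization R M (\<Otimes>\<^bsub>R\<^esub>i\<in>I. f i) (\<Sum>i\<in>I. \<delta> i)"

text \<open>The localization map from the \<open>J - {j}\<close> part to the \<open>J\<close> part:
  \<open>x / (f\<^sub>I)\<^sup>k = (f\<^sub>j)\<^sup>k x / (f\<^sub>J)\<^sup>k\<close> for \<open>I = J - {j}\<close>.\<close>

definition cech_restrict ::
    "('a, 'g) gr_ring \<Rightarrow> ('a, 'b, 'g) gr_module \<Rightarrow> (nat \<Rightarrow> 'a) \<Rightarrow> nat set \<Rightarrow> nat \<Rightarrow>
     ('b \<times> nat) set \<Rightarrow> ('b \<times> nat) set" where
  "cech_restrict R M f J j C =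
     (\<Union>(x, k)\<in>C. frac_rel R M (\<Otimes>\<^bsub>R\<^esub>i\<in>J. f i) `` {((f j [^]\<^bsub>R\<^esub> k) \<odot>\<^bsub>M\<^esub> x, k)})"

text \<open>
  The \v{C}ech complex on \<open>f\<^sub>0, \<dots>, f\<^bsub>r-1\<^esub>\<close>, with \<open>M\<close> in cohomological degree \<open>0\<close>: the indices
  in degree \<open>p\<close> are the \<open>p\<close>-element subsets of \<open>{0, \<dots>, r-1}\<close>. There are none for negative \<open>p\<close>,
  and the module is then zero.
\<close>

definition cech_index :: "nat \<Rightarrow> int \<Rightarrow> nat set set" where
  "cech_index r p = {I. I \<subseteq> {..<r} \<and> int (card I) = p}"

definition cech_module ::
    "('a, 'g::ab_group_add) gr_ring \<Rightarrow> ('a, 'b, 'g) gr_module \<Rightarrow> (nat \<Rightarrow> 'a) \<Rightarrow> (nat \<Rightarrow> 'g) \<Rightarrow> nat \<Rightarrow>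
     int \<Rightarrow> ('a, nat set \<Rightarrow> ('b \<times> nat) set, 'g) gr_module" where
  "cech_module R M f \<delta> r p =
     \<lparr>carrier = (\<Pi>\<^sub>E I\<in>cech_index r p. carrier (cech_loc R M f \<delta> I)),
      monoid.mult = undefined, monoid.one = undefined,
      ring.zero = (\<lambda>I\<in>cech_index r p. \<zero>\<^bsub>cech_loc R M f \<delta> I\<^esub>),
      ring.add = (\<lambda>c c'. \<lambda>I\<in>cech_index r p. c I \<oplus>\<^bsub>cech_loc R M f \<delta> I\<^esub> c' I),
      module.smult = (\<lambda>a c. \<lambda>I\<in>cech_index r p. a \<odot>\<^bsub>cech_loc R M f \<delta> I\<^esub> c I),
      hcomp = (\<lambda>\<gamma>. \<Pi>\<^sub>E I\<in>cech_index r p. hcomp (cech_loc R M f \<delta> I) \<gamma>)\<rparr>"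

definition cech_diff ::
    "('a, 'g::ab_group_add) gr_ring \<Rightarrow> ('a, 'b, 'g) gr_module \<Rightarrow> (nat \<Rightarrow> 'a) \<Rightarrow> (nat \<Rightarrow> 'g) \<Rightarrow> nat \<Rightarrow>
     int \<Rightarrow> (nat set \<Rightarrow> ('b \<times> nat) set) \<Rightarrow> nat set \<Rightarrow> ('b \<times> nat) set" where
  "cech_diff R M f \<delta> r p c =
     (\<lambda>J\<in>cech_index r (p + 1). \<Oplus>\<^bsub>cech_loc R M f \<delta> J\<^esub>j\<in>J.
        (if even (card {i\<in>J. i < j}) then cech_restrict R M f J j (c (J - {j}))
         else \<ominus>\<^bsub>cech_loc R M f \<delta> J\<^esub> cech_restrict R M f J j (c (J - {j}))))"

definition cech_cohomology ::
    "('a, 'g::ab_group_add) gr_ring \<Rightarrow> ('a, 'b, 'g) gr_module \<Rightarrow> (nat \<Rightarrow> 'a) \<Rightarrow> (nat \<Rightarrow> 'g) \<Rightarrow> nat \<Rightarrow>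
     int \<Rightarrow> ('a, (nat set \<Rightarrow> ('b \<times> nat) set) set, 'g) gr_module" where
  "cech_cohomology R M f \<delta> r p =
     gr_homology (cech_module R M f \<delta> r (p - 1)) (cech_module R M f \<delta> r p)
       (cech_module R M f \<delta> r (p + 1))
       (cech_diff R M f \<delta> r (p - 1)) (cech_diff R M f \<delta> r p)"

end

theory Submission
  imports Defs
begin

text \<open>
  Fix a degree \<open>g\<close> and write \<open>C\<^sup>k\<close> for the modules of the Cech complex of \<open>M\<close>. The statement is proved
  in the following form (\<open>Tor_vanishes\<close>): if the \<open>k\<close>-th Cech cohomology is zero in all degrees
  \<open>g - (\<Sum>i\<in>J. \<gamma> i)\<close> with \<open>card J = j + k\<close>, for every \<open>k\<close>, then the \<open>j\<close>-th Tor module is zero in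
  degree \<open>g\<close>. The sums over \<open>J\<close> enter because a Koszul chain of homological degree \<open>p\<close> and
  degree \<open>g\<close> has its coefficients in the degrees \<open>g - (\<Sum>i\<in>J. \<gamma> i)\<close> with \<open>card J = p\<close>.

  Two families of modules have an exact Koszul complex. The modules \<open>C\<^sup>k\<close> with \<open>k > 0\<close> are products of
  localizations at elements of the ideal of the variables; as this ideal annihilates Koszul
  homology, theirs is zero (\<open>koszul_exact_if_ideal_contains_unit\<close>). For a free module over the
  polynomial ring, division by the variables shows exactness in positive homological degrees
  (\<open>koszul_exact_if_division\<close>).

  Instead of comparing spectral sequences of double complexes, the proof passes from one module to
  the next by a dimension shift (\<open>koszul_vanishes_step\<close>). For a complex \<open>L'' \<rightarrow> L \<rightarrow> L'\<close> that is exact at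
  \<open>L\<close> in the relevant degrees, and such that the Koszul complex of \<open>L'\<close> is exact in homological degree
  \<open>p\<close>, the vanishing of the \<open>(p + 1)\<close>-st Koszul homology of the cokernel of \<open>L \<rightarrow> L'\<close> implies that of
  the \<open>p\<close>-th Koszul homology of the cokernel of \<open>L'' \<rightarrow> L\<close>. The shift first runs down the Cech complex
  from zero at \<open>k = r + 1\<close> to \<open>C\<^sup>0 \<cong> M\<close>, with \<open>p = j + k\<close>; exactness at \<open>C\<^sup>k\<close> is the hypothesis
  on the cohomology. This gives the vanishing of the \<open>j\<close>-th Koszul homology of \<open>M\<close> in degree \<open>g\<close>. It
  then runs up the given resolution \<open>F\<close> from the cokernel \<open>M\<close> of \<open>F\<^sub>1 \<rightarrow> F\<^sub>0\<close> to the cokernel of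
  \<open>F\<^bsub>j+1\<^esub> \<rightarrow> F\<^sub>j\<close>, with \<open>p = j - i\<close> at \<open>F\<^sub>i\<close>. At \<open>p = 0\<close> the outcome is that every element of
  \<open>F\<^sub>j\<close> of degree \<open>g\<close> that is a cycle modulo the variables is a boundary modulo the variables
  (\<open>tor_cycle_is_boundary\<close>), and \<open>F \<otimes> S\<close> is \<open>F\<close> modulo the variables.
\<close>

section \<open>Signed sums and linear maps\<close>

text \<open>
  Adding one index \<open>a\<close> at a time pairs the terms \<open>t a j\<close> and \<open>t j a\<close>. This also works where \<open>2 = 0\<close>
  and cancelling the sum against its own negative would prove nothing. Both the square of the
  Koszul differential and that of the Cech differential are sums of this kind.
\<close>

lemma (in abelian_group) finsum_antisymmetric:
  assumes "finite A"
    and "\<And>j k. j \<in> A \<Longrightarrow> k \<in> A \<Longrightarrow> j \<noteq> k \<Longrightarrow> t j k \<in> carrier G"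
    and "\<And>j k. j \<in> A \<Longrightarrow> k \<in> A \<Longrightarrow> j \<noteq> k \<Longrightarrow> t j k = \<ominus>\<^bsub>G\<^esub> t k j"
  shows "(\<Oplus>\<^bsub>G\<^esub>j\<in>A. \<Oplus>\<^bsub>G\<^esub>k\<in>A - {j}. t j k) = \<zero>\<^bsub>G\<^esub>"
  using assms
proof (induction A rule: finite_induct)
  case empty
  show ?case by simp
next
  case (insert a A)
  have cl: "t j k \<in> carrier G" if "j \<in> insert a A" "k \<in> insert a A" "j \<noteq> k" for j k
    using insert.prems(1) that by blast
  have cl': "(\<Oplus>\<^bsub>G\<^esub>k\<in>A - {j}. t j k) \<in> carrier G" if "j \<in> A" for j
    using that by (intro finsum_closed) (auto intro!: cl)
  have row: "(\<Oplus>\<^bsub>G\<^esub>k\<in>insert a A - {j}. t j k) = t j a \<oplus>\<^bsub>G\<^esub> (\<Oplus>\<^bsub>G\<^esub>k\<in>A - {j}. t j k)"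
    if "j \<in> A" for j
  proof -
    have "insert a A - {j} = insert a (A - {j})"
      using that insert.hyps by auto
    then show ?thesis
      using that insert.hyps by (simp only:) (intro finsum_insert, auto intro!: cl)
  qed
  have "insert a A - {a} = A"
    using insert.hyps by auto
  moreover have "(\<Oplus>\<^bsub>G\<^esub>j\<in>A. \<Oplus>\<^bsub>G\<^esub>k\<in>insert a A - {j}. t j k)
      = (\<Oplus>\<^bsub>G\<^esub>j\<in>A. t j a \<oplus>\<^bsub>G\<^esub> (\<Oplus>\<^bsub>G\<^esub>k\<in>A - {j}. t j k))"
    using row cl cl' insert.hyps by (intro finsum_cong') (auto intro!: a_closed)
  moreover have "\<dots> = (\<Oplus>\<^bsub>G\<^esub>j\<in>A. t j a) \<oplus>\<^bsub>G\<^esub> (\<Oplus>\<^bsub>G\<^esub>j\<in>A. \<Oplus>\<^bsub>G\<^esub>k\<in>A - {j}. t j k)"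
    using cl cl' insert.hyps by (intro finsum_addf) auto
  moreover have "(\<Oplus>\<^bsub>G\<^esub>j\<in>A. \<Oplus>\<^bsub>G\<^esub>k\<in>A - {j}. t j k) = \<zero>\<^bsub>G\<^esub>"
    by (rule insert.IH) (blast intro: cl insert.prems(2))+
  moreover have "(\<Oplus>\<^bsub>G\<^esub>j\<in>A. t j a) \<in> carrier G"
    using cl insert.hyps by (intro finsum_closed) auto
  ultimately have "(\<Oplus>\<^bsub>G\<^esub>j\<in>insert a A. \<Oplus>\<^bsub>G\<^esub>k\<in>insert a A - {j}. t j k)
      = (\<Oplus>\<^bsub>G\<^esub>k\<in>A. t a k) \<oplus>\<^bsub>G\<^esub> (\<Oplus>\<^bsub>G\<^esub>j\<in>A. t j a)"
    using insert.hyps cl row cl' by (subst finsum_insert) (auto intro!: finsum_closed a_closed)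
  also have "\<dots> = (\<Oplus>\<^bsub>G\<^esub>j\<in>A. t a j \<oplus>\<^bsub>G\<^esub> t j a)"
    using cl insert.hyps by (intro finsum_addf[symmetric]) auto
  also have "\<dots> = (\<Oplus>\<^bsub>G\<^esub>j\<in>A. \<zero>\<^bsub>G\<^esub>)"
  proof (intro finsum_cong')
    fix j assume "j \<in> A"
    moreover from this have "t a j = \<ominus>\<^bsub>G\<^esub> t j a" and "j \<noteq> a"
      using insert.prems(2)[of a j] insert.hyps by blast+
    ultimately show "t a j \<oplus>\<^bsub>G\<^esub> t j a = \<zero>\<^bsub>G\<^esub>"
      using cl[of j a] by (simp add: l_neg)
  qed auto
  finally show ?case by (simp add: finsum_zero)
qed

lemma (in abelian_group) eq_if_add_diff_eq:
  assumes "b \<oplus>\<^bsub>G\<^esub> (a \<oplus>\<^bsub>G\<^esub> \<ominus>\<^bsub>G\<^esub> c) = a" "b \<in> carrier G" "a \<in> carrier G" "c \<in> carrier G"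
  shows "b = c"
proof -
  have "a \<oplus>\<^bsub>G\<^esub> (b \<oplus>\<^bsub>G\<^esub> \<ominus>\<^bsub>G\<^esub> c) = a \<oplus>\<^bsub>G\<^esub> \<zero>\<^bsub>G\<^esub>"
    using assms by (simp add: a_lcomm)
  then have "b \<oplus>\<^bsub>G\<^esub> \<ominus>\<^bsub>G\<^esub> c = \<zero>\<^bsub>G\<^esub>"
    using assms(2-4) by (simp only: add.l_cancel a_closed a_inv_closed zero_closed)
  then show ?thesis
    using assms(2,4) minus_equality[of b "\<ominus>\<^bsub>G\<^esub> c"] by simp
qed

definition R_linear :: "('a, 'x) ring_scheme \<Rightarrow> ('a, 'b, 'y) module_scheme \<Rightarrow>
    ('a, 'c, 'z) module_scheme \<Rightarrow> ('b \<Rightarrow> 'c) \<Rightarrow> bool" where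
  "R_linear R M N h \<longleftrightarrow> h \<in> carrier M \<rightarrow> carrier N \<and>
     (\<forall>x\<in>carrier M. \<forall>y\<in>carrier M. h (x \<oplus>\<^bsub>M\<^esub> y) = h x \<oplus>\<^bsub>N\<^esub> h y) \<and>
     (\<forall>r\<in>carrier R. \<forall>x\<in>carrier M. h (r \<odot>\<^bsub>M\<^esub> x) = r \<odot>\<^bsub>N\<^esub> h x)"

text \<open>
  Projections onto homogeneous components and division by a variable are additive, but not
  linear over the ring.
\<close>

definition additive :: "('b, 'y) ring_scheme \<Rightarrow> ('c, 'z) ring_scheme \<Rightarrow> ('b \<Rightarrow> 'c) \<Rightarrow> bool" where
  "additive M N h \<longleftrightarrow> h \<in> carrier M \<rightarrow> carrier N \<and>
     (\<forall>x\<in>carrier M. \<forall>y\<in>carrier M. h (x \<oplus>\<^bsub>M\<^esub> y) = h x \<oplus>\<^bsub>N\<^esub> h y)"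

lemma R_linear_additive: "R_linear R M N h \<Longrightarrow> additive M N h"
  by (simp add: R_linear_def additive_def)

lemma additive_closed: "additive M N h \<Longrightarrow> x \<in> carrier M \<Longrightarrow> h x \<in> carrier N"
  by (auto simp: additive_def)

lemma additive_add:
  "additive M N h \<Longrightarrow> x \<in> carrier M \<Longrightarrow> y \<in> carrier M \<Longrightarrow> h (x \<oplus>\<^bsub>M\<^esub> y) = h x \<oplus>\<^bsub>N\<^esub> h y"
  by (auto simp: additive_def)

lemma additive_zero:
  assumes "abelian_group M" "abelian_group N" "additive M N h"
  shows "h \<zero>\<^bsub>M\<^esub> = \<zero>\<^bsub>N\<^esub>"
proof -
  interpret M: abelian_group M by fact
  interpret N: abelian_group N by fact
  have "h \<zero>\<^bsub>M\<^esub> \<oplus>\<^bsub>N\<^esub> h \<zero>\<^bsub>M\<^esub> = h \<zero>\<^bsub>M\<^esub>"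
    using additive_add[OF assms(3) M.zero_closed M.zero_closed] by simp
  then show ?thesis
    using additive_closed[OF assms(3) M.zero_closed] N.add.r_cancel_one' by metis
qed

lemma additive_minus:
  assumes "abelian_group M" "abelian_group N" "additive M N h" "x \<in> carrier M"
  shows "h (\<ominus>\<^bsub>M\<^esub> x) = \<ominus>\<^bsub>N\<^esub> h x"
proof -
  interpret M: abelian_group M by fact
  interpret N: abelian_group N by fact
  have "h (\<ominus>\<^bsub>M\<^esub> x) \<oplus>\<^bsub>N\<^esub> h x = \<zero>\<^bsub>N\<^esub>"
    using additive_add[OF assms(3), of "\<ominus>\<^bsub>M\<^esub> x" x] additive_zero[OF assms(1-3)] assms(4)
    by (simp add: M.l_neg)
  then show ?thesis
    using assms additive_closed[OF assms(3)] by (simp add: N.minus_equality)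
qed

lemma additive_diff:
  assumes "abelian_group M" "abelian_group N" "additive M N h" "x \<in> carrier M" "y \<in> carrier M"
  shows "h (x \<ominus>\<^bsub>M\<^esub> y) = h x \<ominus>\<^bsub>N\<^esub> h y"
proof -
  interpret M: abelian_group M by fact
  show ?thesis
    using assms by (simp add: a_minus_def additive_add additive_minus)
qed

lemma additive_finsum:
  assumes "abelian_group M" "abelian_group N" "additive M N h" "finite A" "f \<in> A \<rightarrow> carrier M"
  shows "h (\<Oplus>\<^bsub>M\<^esub>i\<in>A. f i) = (\<Oplus>\<^bsub>N\<^esub>i\<in>A. h (f i))"
proof -
  interpret M: abelian_group M by fact
  interpret N: abelian_group N by fact
  show ?thesis
    using assms(4,5)
  proof (induction A rule: finite_induct)
    case empty
    then show ?case
      using additive_zero assms by simp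
  next
    case (insert a A)
    then show ?case
      using additive_add[OF assms(3)] additive_closed[OF assms(3)] by (simp add: Pi_def)
  qed
qed

lemma R_linear_smult:
  "R_linear R M N h \<Longrightarrow> r \<in> carrier R \<Longrightarrow> x \<in> carrier M \<Longrightarrow> h (r \<odot>\<^bsub>M\<^esub> x) = r \<odot>\<^bsub>N\<^esub> h x"
  by (simp add: R_linear_def)

lemma R_linear_comp: "R_linear R M N h \<Longrightarrow> R_linear R N P k \<Longrightarrow> R_linear R M P (\<lambda>x. k (h x))"
  by (auto simp: R_linear_def Pi_iff)

lemma R_linear_cong:
  assumes "module R M" and h: "R_linear R M N h" and eq: "\<And>x. x \<in> carrier M \<Longrightarrow> h' x = h x"
  shows "R_linear R M N h'"
proof -
  interpret module R M by fact
  show ?thesis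
    using h unfolding R_linear_def by (simp add: eq Pi_iff)
qed

lemma R_linear_scaled_finsum:
  assumes "module R M" "module R N" and h: "\<And>j. j \<in> A \<Longrightarrow> R_linear R M N (h j)"
    and r: "\<And>j. j \<in> A \<Longrightarrow> r j \<in> carrier R" and fin: "finite A"
  shows "R_linear R M N (\<lambda>x. \<Oplus>\<^bsub>N\<^esub>j\<in>A. r j \<odot>\<^bsub>N\<^esub> h j x)"
  unfolding R_linear_def
proof (intro conjI ballI funcsetI)
  interpret M: module R M by fact
  interpret N: module R N by fact
  fix x assume x: "x \<in> carrier M"
  have cl: "h j x \<in> carrier N" if "j \<in> A" "x \<in> carrier M" for j x
    using additive_closed[OF R_linear_additive[OF h]] that by blast
  show "(\<Oplus>\<^bsub>N\<^esub>j\<in>A. r j \<odot>\<^bsub>N\<^esub> h j x) \<in> carrier N"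
    using cl x r by (intro N.M.finsum_closed) auto
  show "(\<Oplus>\<^bsub>N\<^esub>j\<in>A. r j \<odot>\<^bsub>N\<^esub> h j (a \<odot>\<^bsub>M\<^esub> x)) = a \<odot>\<^bsub>N\<^esub> (\<Oplus>\<^bsub>N\<^esub>j\<in>A. r j \<odot>\<^bsub>N\<^esub> h j x)"
    if a: "a \<in> carrier R" for a
  proof -
    have "r j \<odot>\<^bsub>N\<^esub> h j (a \<odot>\<^bsub>M\<^esub> x) = a \<odot>\<^bsub>N\<^esub> (r j \<odot>\<^bsub>N\<^esub> h j x)" if j: "j \<in> A" for j
      using R_linear_smult[OF h[OF j] a x] cl[OF j x] r[OF j] a
      by (simp add: N.smult_assoc1[symmetric] M.R.m_comm)
    then have "(\<Oplus>\<^bsub>N\<^esub>j\<in>A. r j \<odot>\<^bsub>N\<^esub> h j (a \<odot>\<^bsub>M\<^esub> x)) = (\<Oplus>\<^bsub>N\<^esub>j\<in>A. a \<odot>\<^bsub>N\<^esub> (r j \<odot>\<^bsub>N\<^esub> h j x))"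
      using cl x r a by (intro N.M.finsum_cong') auto
    then show ?thesis
      using cl x r a fin by (subst N.finsum_smult_ldistr) auto
  qed
  fix y assume y: "y \<in> carrier M"
  have "r j \<odot>\<^bsub>N\<^esub> h j (x \<oplus>\<^bsub>M\<^esub> y) = r j \<odot>\<^bsub>N\<^esub> h j x \<oplus>\<^bsub>N\<^esub> r j \<odot>\<^bsub>N\<^esub> h j y" if j: "j \<in> A" for j
    using additive_add[OF R_linear_additive[OF h[OF j]] x y] cl[OF j] x y r[OF j]
    by (simp add: N.smult_r_distr)
  then have "(\<Oplus>\<^bsub>N\<^esub>j\<in>A. r j \<odot>\<^bsub>N\<^esub> h j (x \<oplus>\<^bsub>M\<^esub> y))
      = (\<Oplus>\<^bsub>N\<^esub>j\<in>A. r j \<odot>\<^bsub>N\<^esub> h j x \<oplus>\<^bsub>N\<^esub> r j \<odot>\<^bsub>N\<^esub> h j y)"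
    using cl x y r by (intro N.M.finsum_cong') auto
  also have "\<dots> = (\<Oplus>\<^bsub>N\<^esub>j\<in>A. r j \<odot>\<^bsub>N\<^esub> h j x) \<oplus>\<^bsub>N\<^esub> (\<Oplus>\<^bsub>N\<^esub>j\<in>A. r j \<odot>\<^bsub>N\<^esub> h j y)"
    using cl x y r by (intro N.M.finsum_addf) auto
  finally show "(\<Oplus>\<^bsub>N\<^esub>j\<in>A. r j \<odot>\<^bsub>N\<^esub> h j (x \<oplus>\<^bsub>M\<^esub> y))
      = (\<Oplus>\<^bsub>N\<^esub>j\<in>A. r j \<odot>\<^bsub>N\<^esub> h j x) \<oplus>\<^bsub>N\<^esub> (\<Oplus>\<^bsub>N\<^esub>j\<in>A. r j \<odot>\<^bsub>N\<^esub> h j y)" .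
qed

section \<open>The Koszul complex of a module\<close>

text \<open>
  Signs are taken to be scalars of the ring, so that every linear map commutes with them.
\<close>

definition ksign :: "('a, 'x) ring_scheme \<Rightarrow> nat \<Rightarrow> nat set \<Rightarrow> 'a" where
  "ksign R j J = (if even (card {i\<in>J. i < j}) then \<one>\<^bsub>R\<^esub> else \<ominus>\<^bsub>R\<^esub> \<one>\<^bsub>R\<^esub>)"

text \<open>
  A chain assigns to a set \<open>J\<close> of indices the coefficient of the basis element \<open>e\<^sub>J\<close> of the exterior
  algebra. All homological degrees are treated together, and chains may be nonzero on arbitrary
  sets \<open>J\<close>; the value at \<open>J\<close> collects what the usual differential sends to \<open>e\<^sub>J\<close>.
\<close>

definition kdiff :: "('a, 'x) ring_scheme \<Rightarrow> ('a, 'b, 'y) module_scheme \<Rightarrow> (nat \<Rightarrow> 'a) \<Rightarrow> nat \<Rightarrow>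
    (nat set \<Rightarrow> 'b) \<Rightarrow> nat set \<Rightarrow> 'b" where
  "kdiff R M v n c J =
     (\<Oplus>\<^bsub>M\<^esub>j\<in>{..<n} - J. (ksign R j J \<otimes>\<^bsub>R\<^esub> v j) \<odot>\<^bsub>M\<^esub> c (insert j J))"

text \<open>
  Left multiplication by \<open>e\<^sub>i\<close>.
\<close>

definition kwedge :: "('a, 'x) ring_scheme \<Rightarrow> ('a, 'b, 'y) module_scheme \<Rightarrow> nat \<Rightarrow>
    (nat set \<Rightarrow> 'b) \<Rightarrow> nat set \<Rightarrow> 'b" where
  "kwedge R M i c J = (if i \<in> J then ksign R i J \<odot>\<^bsub>M\<^esub> c (J - {i}) else \<zero>\<^bsub>M\<^esub>)"

context cring
begin

lemma ksign_closed [simp]: "ksign R j J \<in> carrier R"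
  by (simp add: ksign_def)

lemma ksign_square [simp]: "ksign R j J \<otimes> ksign R j J = \<one>"
  by (simp add: ksign_def l_minus r_minus)

lemma ksign_insert_ge [simp]: "j \<le> k \<Longrightarrow> ksign R j (insert k J) = ksign R j J"
proof -
  assume "j \<le> k"
  then have "{i \<in> insert k J. i < j} = {i \<in> J. i < j}" by auto
  then show ?thesis by (simp add: ksign_def)
qed

lemma ksign_insert_less: "k < j \<Longrightarrow> k \<notin> J \<Longrightarrow> ksign R j (insert k J) = \<ominus> ksign R j J"
proof -
  assume *: "k < j" "k \<notin> J"
  then have "{i \<in> insert k J. i < j} = insert k {i \<in> J. i < j}" by auto
  moreover have "finite {i \<in> J. i < j}"
    by (rule finite_subset[of _ "{..<j}"]) auto
  ultimately show ?thesis
    using * by (simp add: ksign_def)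
qed

lemma ksign_swap:
  assumes "j \<noteq> k" "j \<notin> J" "k \<notin> J"
  shows "ksign R j J \<otimes> ksign R k (insert j J) = \<ominus> (ksign R k J \<otimes> ksign R j (insert k J))"
  using assms by (cases j k rule: linorder_cases)
    (auto simp: ksign_insert_less l_minus r_minus m_comm)

lemma ksign_swap_delete:
  assumes "i \<in> J" "j \<notin> J"
  shows "ksign R j J \<otimes> ksign R i (insert j J) = \<ominus> (ksign R i J \<otimes> ksign R j (J - {i}))"
proof (cases "i < j")
  case True
  then have "ksign R j J = \<ominus> ksign R j (J - {i})"
    using ksign_insert_less[of i j "J - {i}"] assms by (simp add: insert_absorb)
  then show ?thesis
    using True by (simp add: l_minus r_minus m_comm)
next
  case False
  then have "j < i"
    using assms by (metis linorder_neqE_nat)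
  moreover from this have "ksign R j J = ksign R j (J - {i})"
    using ksign_insert_ge[of j i "J - {i}"] assms by (simp add: insert_absorb)
  ultimately show ?thesis
    using assms by (simp add: ksign_insert_less l_minus r_minus m_comm)
qed

lemma ksign_delete_self [simp]: "ksign R i (J - {i}) = ksign R i J"
proof -
  have "{k \<in> J - {i}. k < i} = {k \<in> J. k < i}" by auto
  then show ?thesis by (simp add: ksign_def)
qed

end

locale koszul = module R M for R (structure) and M (structure) +
  fixes v :: "nat \<Rightarrow> 'a" and n :: nat
  assumes v_closed [simp]: "j < n \<Longrightarrow> v j \<in> carrier R"
begin

abbreviation d where "d \<equiv> kdiff R M v n"

lemma kdiff_closed: "(\<And>J. c J \<in> carrier M) \<Longrightarrow> d c J \<in> carrier M"
  unfolding kdiff_def by (intro M.finsum_closed) auto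

lemma kdiff_additive:
  assumes "\<And>J. c J \<in> carrier M" "\<And>J. c' J \<in> carrier M"
  shows "d (\<lambda>J. c J \<oplus>\<^bsub>M\<^esub> c' J) J = d c J \<oplus>\<^bsub>M\<^esub> d c' J"
proof -
  have "d (\<lambda>J. c J \<oplus>\<^bsub>M\<^esub> c' J) J = (\<Oplus>\<^bsub>M\<^esub>j\<in>{..<n} - J. (ksign R j J \<otimes> v j) \<odot>\<^bsub>M\<^esub> c (insert j J) \<oplus>\<^bsub>M\<^esub>
      (ksign R j J \<otimes> v j) \<odot>\<^bsub>M\<^esub> c' (insert j J))"
    unfolding kdiff_def using assms by (intro M.finsum_cong') (auto simp: smult_r_distr)
  also have "\<dots> = d c J \<oplus>\<^bsub>M\<^esub> d c' J"
    unfolding kdiff_def using assms by (intro M.finsum_addf) auto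
  finally show ?thesis .
qed

lemma kdiff_smult:
  assumes "\<And>J. c J \<in> carrier M" "r \<in> carrier R"
  shows "d (\<lambda>J. r \<odot>\<^bsub>M\<^esub> c J) J = r \<odot>\<^bsub>M\<^esub> d c J"
proof -
  have "d (\<lambda>J. r \<odot>\<^bsub>M\<^esub> c J) J
      = (\<Oplus>\<^bsub>M\<^esub>j\<in>{..<n} - J. r \<odot>\<^bsub>M\<^esub> ((ksign R j J \<otimes> v j) \<odot>\<^bsub>M\<^esub> c (insert j J)))"
    unfolding kdiff_def using assms
    by (intro M.finsum_cong') (auto simp: smult_assoc1[symmetric] R.m_ac)
  also have "\<dots> = r \<odot>\<^bsub>M\<^esub> d c J"
    unfolding kdiff_def using assms by (intro finsum_smult_ldistr[symmetric]) auto
  finally show ?thesis .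
qed

lemma kdiff_zero: "d (\<lambda>J. \<zero>\<^bsub>M\<^esub>) J = \<zero>\<^bsub>M\<^esub>"
  unfolding kdiff_def by (intro M.add.finprod_one_eqI) auto

lemma kdiff_diff:
  assumes "\<And>J. c J \<in> carrier M" "\<And>J. c' J \<in> carrier M"
  shows "d (\<lambda>J. c J \<ominus>\<^bsub>M\<^esub> c' J) J = d c J \<ominus>\<^bsub>M\<^esub> d c' J"
proof -
  have eq: "c J \<ominus>\<^bsub>M\<^esub> c' J = c J \<oplus>\<^bsub>M\<^esub> (\<ominus>\<^bsub>R\<^esub> \<one>\<^bsub>R\<^esub>) \<odot>\<^bsub>M\<^esub> c' J" for J
    using assms by (simp add: a_minus_def smult_l_minus)
  have "d (\<lambda>J. c J \<ominus>\<^bsub>M\<^esub> c' J) J = d c J \<oplus>\<^bsub>M\<^esub> (\<ominus>\<^bsub>R\<^esub> \<one>\<^bsub>R\<^esub>) \<odot>\<^bsub>M\<^esub> d c' J"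
    unfolding eq using assms by (simp add: kdiff_additive kdiff_smult)
  then show ?thesis
    using assms by (simp add: a_minus_def smult_l_minus kdiff_closed)
qed

lemma kdiff_kdiff:
  assumes c: "\<And>J. c J \<in> carrier M"
  shows "d (d c) J = \<zero>\<^bsub>M\<^esub>"
proof -
  let ?t = "\<lambda>j k. (ksign R j J \<otimes> v j \<otimes> (ksign R k (insert j J) \<otimes> v k))
      \<odot>\<^bsub>M\<^esub> c (insert k (insert j J))"
  have "d (d c) J = (\<Oplus>\<^bsub>M\<^esub>j\<in>{..<n} - J. \<Oplus>\<^bsub>M\<^esub>k\<in>({..<n} - J) - {j}. ?t j k)"
    unfolding kdiff_def[of R M v n "d c"]
  proof (intro M.finsum_cong')
    fix j assume j: "j \<in> {..<n} - J"
    have "(ksign R j J \<otimes> v j) \<odot>\<^bsub>M\<^esub> d c (insert j J) = (\<Oplus>\<^bsub>M\<^esub>k\<in>{..<n} - insert j J.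
        (ksign R j J \<otimes> v j) \<odot>\<^bsub>M\<^esub> ((ksign R k (insert j J) \<otimes> v k) \<odot>\<^bsub>M\<^esub> c (insert k (insert j J))))"
      unfolding kdiff_def using c j by (intro finsum_smult_ldistr) auto
    also have "\<dots> = (\<Oplus>\<^bsub>M\<^esub>k\<in>({..<n} - J) - {j}. ?t j k)"
      using c j by (intro M.finsum_cong') (auto simp: smult_assoc1)
    finally show "(ksign R j J \<otimes> v j) \<odot>\<^bsub>M\<^esub> d c (insert j J)
        = (\<Oplus>\<^bsub>M\<^esub>k\<in>({..<n} - J) - {j}. ?t j k)" .
  qed (use c in \<open>auto intro!: M.finsum_closed\<close>)
  also have "\<dots> = \<zero>\<^bsub>M\<^esub>"
  proof (rule M.finsum_antisymmetric)
    fix j k assume jk: "j \<in> {..<n} - J" "k \<in> {..<n} - J" "j \<noteq> k"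
    have "ksign R j J \<otimes> v j \<otimes> (ksign R k (insert j J) \<otimes> v k)
        = (ksign R j J \<otimes> ksign R k (insert j J)) \<otimes> (v j \<otimes> v k)"
      using jk by (simp add: R.m_ac)
    also have "\<dots> = \<ominus> (ksign R k J \<otimes> v k \<otimes> (ksign R j (insert k J) \<otimes> v j))"
      using jk ksign_swap[of j k J] by (simp add: R.l_minus R.r_minus R.m_ac)
    finally show "?t j k = \<ominus>\<^bsub>M\<^esub> ?t k j"
      using jk c by (simp add: insert_commute smult_l_minus)
  qed (use c in auto)
  finally show ?thesis .
qed

lemma kwedge_closed: "(\<And>J. c J \<in> carrier M) \<Longrightarrow> kwedge R M i c J \<in> carrier M"
  by (simp add: kwedge_def)

text \<open>
  Multiplication by \<open>e\<^sub>i\<close> is a homotopy between zero and multiplication by \<open>v i\<close>. Its two cases,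
  components without and with \<open>e\<^sub>i\<close>, are this lemma and the next.
\<close>

lemma kdiff_kwedge_notin:
  assumes c: "\<And>J. c J \<in> carrier M" and i: "i < n" "i \<notin> J"
  shows "d (kwedge R M i c) J = v i \<odot>\<^bsub>M\<^esub> c J"
proof -
  have "d (kwedge R M i c) J = (\<Oplus>\<^bsub>M\<^esub>j\<in>{..<n} - J. if i = j then v i \<odot>\<^bsub>M\<^esub> c J else \<zero>\<^bsub>M\<^esub>)"
    unfolding kdiff_def
  proof (intro M.finsum_cong')
    fix j assume j: "j \<in> {..<n} - J"
    have "ksign R i J \<otimes> v i \<otimes> ksign R i J = (ksign R i J \<otimes> ksign R i J) \<otimes> v i"
      using i by (simp only: R.m_ac v_closed R.ksign_closed R.m_closed)
    then have "ksign R i J \<otimes> v i \<otimes> ksign R i J = v i"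
      using i by simp
    then show "(ksign R j J \<otimes> v j) \<odot>\<^bsub>M\<^esub> kwedge R M i c (insert j J)
        = (if i = j then v i \<odot>\<^bsub>M\<^esub> c J else \<zero>\<^bsub>M\<^esub>)"
      using j i c by (auto simp: kwedge_def smult_assoc1[symmetric])
  qed (use c i in auto)
  also have "\<dots> = v i \<odot>\<^bsub>M\<^esub> c J"
    using M.finsum_singleton[of i "{..<n} - J" "\<lambda>j. v i \<odot>\<^bsub>M\<^esub> c J"] i c by simp
  finally show ?thesis .
qed

lemma kdiff_kwedge_in:
  assumes c: "\<And>J. c J \<in> carrier M" and i: "i < n" "i \<in> J"
  shows "d (kwedge R M i c) J \<oplus>\<^bsub>M\<^esub> ksign R i J \<odot>\<^bsub>M\<^esub> d c (J - {i}) = v i \<odot>\<^bsub>M\<^esub> c J"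
proof -
  let ?J = "J - {i}"
  have J: "insert i ?J = J" using i by auto
  let ?s = "\<lambda>j. (ksign R i J \<otimes> (ksign R j ?J \<otimes> v j)) \<odot>\<^bsub>M\<^esub> c (insert j ?J)"
  have "ksign R i J \<odot>\<^bsub>M\<^esub> d c ?J = (\<Oplus>\<^bsub>M\<^esub>j\<in>{..<n} - ?J. ?s j)"
  proof -
    have "ksign R i J \<odot>\<^bsub>M\<^esub> d c ?J
        = (\<Oplus>\<^bsub>M\<^esub>j\<in>{..<n} - ?J. ksign R i J \<odot>\<^bsub>M\<^esub> ((ksign R j ?J \<otimes> v j) \<odot>\<^bsub>M\<^esub> c (insert j ?J)))"
      unfolding kdiff_def using c by (intro finsum_smult_ldistr) auto
    also have "\<dots> = (\<Oplus>\<^bsub>M\<^esub>j\<in>{..<n} - ?J. ?s j)"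
      using c by (intro M.finsum_cong') (auto simp: smult_assoc1)
    finally show ?thesis .
  qed
  also have "{..<n} - ?J = insert i ({..<n} - J)"
    using i by auto
  also have "(\<Oplus>\<^bsub>M\<^esub>j\<in>insert i ({..<n} - J). ?s j) = ?s i \<oplus>\<^bsub>M\<^esub> (\<Oplus>\<^bsub>M\<^esub>j\<in>{..<n} - J. ?s j)"
    using c i by (intro M.finsum_insert) auto
  also have "?s i = v i \<odot>\<^bsub>M\<^esub> c J"
  proof -
    have "ksign R i J \<otimes> (ksign R i ?J \<otimes> v i) = v i"
      using i by (simp add: R.m_assoc[symmetric])
    then show ?thesis using J by simp
  qed
  finally have E: "ksign R i J \<odot>\<^bsub>M\<^esub> d c ?J = v i \<odot>\<^bsub>M\<^esub> c J \<oplus>\<^bsub>M\<^esub> (\<Oplus>\<^bsub>M\<^esub>j\<in>{..<n} - J. ?s j)" .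
  have "d (kwedge R M i c) J = (\<Oplus>\<^bsub>M\<^esub>j\<in>{..<n} - J. \<ominus>\<^bsub>M\<^esub> ?s j)"
    unfolding kdiff_def
  proof (intro M.finsum_cong')
    fix j assume j: "j \<in> {..<n} - J"
    then have ji: "j \<noteq> i" using i by auto
    have eq: "insert j J - {i} = insert j ?J" using ji by auto
    have "ksign R j J \<otimes> v j \<otimes> ksign R i (insert j J)
        = (ksign R j J \<otimes> ksign R i (insert j J)) \<otimes> v j"
      using j by (simp add: R.m_ac)
    also have "ksign R j J \<otimes> ksign R i (insert j J) = \<ominus> (ksign R i J \<otimes> ksign R j ?J)"
      using i j by (intro ksign_swap_delete) auto
    finally have "ksign R j J \<otimes> v j \<otimes> ksign R i (insert j J)
        = \<ominus> (ksign R i J \<otimes> (ksign R j ?J \<otimes> v j))"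
      using j by (simp add: R.l_minus R.m_assoc)
    then show "(ksign R j J \<otimes> v j) \<odot>\<^bsub>M\<^esub> kwedge R M i c (insert j J) = \<ominus>\<^bsub>M\<^esub> ?s j"
      using j i c eq by (simp add: kwedge_def smult_assoc1[symmetric] smult_l_minus)
  qed (use c i in auto)
  also have "\<dots> = \<ominus>\<^bsub>M\<^esub> (\<Oplus>\<^bsub>M\<^esub>j\<in>{..<n} - J. ?s j)"
  proof -
    have "additive M M (\<lambda>x. \<ominus>\<^bsub>M\<^esub> x)"
      by (auto simp: additive_def M.minus_add)
    then show ?thesis
      using c by (intro additive_finsum[symmetric] M.abelian_group_axioms) auto
  qed
  finally have D: "d (kwedge R M i c) J = \<ominus>\<^bsub>M\<^esub> (\<Oplus>\<^bsub>M\<^esub>j\<in>{..<n} - J. ?s j)" .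
  have "(\<Oplus>\<^bsub>M\<^esub>j\<in>{..<n} - J. ?s j) \<in> carrier M" and "v i \<odot>\<^bsub>M\<^esub> c J \<in> carrier M"
    using c i by (auto intro!: M.finsum_closed)
  then show ?thesis
    unfolding E D by (simp add: M.a_lcomm M.l_neg)
qed

text \<open>
  The scalars that turn a given cycle into a boundary form an ideal, which contains the variables
  by the homotopy above.
\<close>

lemma var_ideal_annihilates_cycles:
  assumes u: "u \<in> Idl\<^bsub>R\<^esub> (v ` {..<n})"
    and c: "\<And>J. c J \<in> carrier M" and cycle: "\<And>J. d c J = \<zero>\<^bsub>M\<^esub>"
  shows "\<exists>b. (\<forall>J. b J \<in> carrier M) \<and> (\<forall>J. d b J = u \<odot>\<^bsub>M\<^esub> c J)"
proof -
  define W where "W = {u \<in> carrier R. \<exists>b. (\<forall>J. b J \<in> carrier M) \<and> (\<forall>J. d b J = u \<odot>\<^bsub>M\<^esub> c J)}"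
  have WI: "u \<in> W" if "u \<in> carrier R" "\<And>J. b J \<in> carrier M" "\<And>J. d b J = u \<odot>\<^bsub>M\<^esub> c J" for u b
    using that unfolding W_def by blast
  have mult: "a \<otimes> w \<in> W" if "a \<in> carrier R" "w \<in> W" for a w
  proof -
    obtain b where "w \<in> carrier R" and b: "\<And>J. b J \<in> carrier M" "\<And>J. d b J = w \<odot>\<^bsub>M\<^esub> c J"
      using \<open>w \<in> W\<close> unfolding W_def by blast
    then show ?thesis
      using that c by (intro WI[of _ "\<lambda>J. a \<odot>\<^bsub>M\<^esub> b J"]) (auto simp: kdiff_smult smult_assoc1)
  qed
  have "ideal W R"
  proof (rule idealI[OF R.ring_axioms])
    show "subgroup W (add_monoid R)"
    proof (rule R.add.subgroupI)
      show "W \<subseteq> carrier R" by (auto simp: W_def)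
      have "\<zero> \<in> W"
        using c by (intro WI[of _ "\<lambda>J. \<zero>\<^bsub>M\<^esub>"]) (auto simp: kdiff_zero)
      then show "W \<noteq> {}" by auto
    next
      fix a assume "a \<in> W"
      moreover from this have "a \<in> carrier R" by (auto simp: W_def)
      ultimately show "\<ominus> a \<in> W"
        using mult[of "\<ominus> \<one>" a] by (simp add: R.l_minus)
    next
      fix a a' assume "a \<in> W" "a' \<in> W"
      then obtain b b' where "a \<in> carrier R" "a' \<in> carrier R"
        and b: "\<And>J. b J \<in> carrier M" "\<And>J. d b J = a \<odot>\<^bsub>M\<^esub> c J"
        and b': "\<And>J. b' J \<in> carrier M" "\<And>J. d b' J = a' \<odot>\<^bsub>M\<^esub> c J"
        unfolding W_def by blast
      then show "a \<oplus> a' \<in> W"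
        using c by (intro WI[of _ "\<lambda>J. b J \<oplus>\<^bsub>M\<^esub> b' J"]) (auto simp: kdiff_additive smult_l_distr)
    qed
  next
    fix a x assume "a \<in> W" "x \<in> carrier R"
    moreover from this have "a \<in> carrier R" by (auto simp: W_def)
    ultimately show "x \<otimes> a \<in> W" "a \<otimes> x \<in> W"
      using mult[of x a] R.m_comm[of a x] by auto
  qed
  moreover have "v i \<in> W" if i: "i < n" for i
  proof (rule WI)
    fix J
    have d0: "ksign R i J \<odot>\<^bsub>M\<^esub> d c (J - {i}) = \<zero>\<^bsub>M\<^esub>"
      by (simp add: cycle)
    have "d (kwedge R M i c) J \<in> carrier M"
      using c by (simp add: kdiff_closed kwedge_closed)
    then show "d (kwedge R M i c) J = v i \<odot>\<^bsub>M\<^esub> c J"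
      using kdiff_kwedge_in[of c i J] kdiff_kwedge_notin[of c i J] c i unfolding d0
      by (cases "i \<in> J") simp_all
  qed (use i c in \<open>simp_all add: kwedge_closed\<close>)
  ultimately have "Idl\<^bsub>R\<^esub> (v ` {..<n}) \<subseteq> W"
    by (intro R.genideal_minimal) auto
  then show ?thesis
    using u unfolding W_def by blast
qed

text \<open>
  If \<open>u\<close> acts bijectively, every cycle is \<open>u\<close> times a cycle, and hence a boundary.
\<close>

lemma koszul_exact_if_ideal_contains_unit:
  assumes u: "u \<in> Idl\<^bsub>R\<^esub> (v ` {..<n})"
    and inj: "\<And>x. x \<in> carrier M \<Longrightarrow> u \<odot>\<^bsub>M\<^esub> x = \<zero>\<^bsub>M\<^esub> \<Longrightarrow> x = \<zero>\<^bsub>M\<^esub>"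
    and surj: "\<And>x. x \<in> carrier M \<Longrightarrow> \<exists>y\<in>carrier M. u \<odot>\<^bsub>M\<^esub> y = x"
    and c: "\<And>J. c J \<in> carrier M" and cycle: "\<And>J. d c J = \<zero>\<^bsub>M\<^esub>"
  shows "\<exists>b. (\<forall>J. b J \<in> carrier M) \<and> (\<forall>J. d b J = c J)"
proof -
  have "v ` {..<n} \<subseteq> carrier R"
    by auto
  then have uR: "u \<in> carrier R"
    using u ideal.Icarr[OF R.genideal_ideal] by blast
  have "\<forall>J. \<exists>y. y \<in> carrier M \<and> u \<odot>\<^bsub>M\<^esub> y = c J"
    using surj c by blast
  then obtain c' where c': "\<And>J. c' J \<in> carrier M" "\<And>J. u \<odot>\<^bsub>M\<^esub> c' J = c J"
    by metis
  have "d c' J = \<zero>\<^bsub>M\<^esub>" for J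
  proof (rule inj)
    show "u \<odot>\<^bsub>M\<^esub> d c' J = \<zero>\<^bsub>M\<^esub>"
      using kdiff_smult[of c' u J] c' uR cycle by simp
  qed (use c' in \<open>simp add: kdiff_closed\<close>)
  from var_ideal_annihilates_cycles[OF u c'(1) this] show ?thesis
    using c'(2) by simp
qed

text \<open>
  The map \<open>q\<close> divides by \<open>v i\<close> and commutes with the other variables. For a cycle \<open>c\<close>, the
  homotopy formula for \<open>q c\<close> and the image under \<open>q\<close> of the equation \<open>d c = 0\<close> differ only in the
  term of index \<open>i\<close>.
\<close>

lemma kdiff_kwedge_division:
  assumes q: "additive M M q" and qi: "\<And>x. x \<in> carrier M \<Longrightarrow> q (v i \<odot>\<^bsub>M\<^esub> x) = x"
    and qj: "\<And>j x. j < n \<Longrightarrow> j \<noteq> i \<Longrightarrow> x \<in> carrier M \<Longrightarrow> q (v j \<odot>\<^bsub>M\<^esub> x) = v j \<odot>\<^bsub>M\<^esub> q x"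
    and c: "\<And>J. c J \<in> carrier M" and cycle: "\<And>J. d c J = \<zero>\<^bsub>M\<^esub>"
    and i: "i < n" "i \<in> J"
  shows "d (kwedge R M i (\<lambda>J. q (c J))) J = c J"
proof -
  let ?J = "J - {i}" and ?s = "ksign R i J" and ?y = "\<lambda>J. q (c J)"
  let ?T = "\<Oplus>\<^bsub>M\<^esub>j\<in>{..<n} - J. (ksign R j ?J \<otimes> v j) \<odot>\<^bsub>M\<^esub> ?y (insert j ?J)"
  have J: "insert i ?J = J" and ind: "{..<n} - ?J = insert i ({..<n} - J)"
    using i by auto
  have y: "?y J \<in> carrier M" for J
    using additive_closed[OF q c] .
  have T: "?T \<in> carrier M"
    using y by (intro M.finsum_closed) auto
  have sign: "q (ksign R j K \<odot>\<^bsub>M\<^esub> x) = ksign R j K \<odot>\<^bsub>M\<^esub> q x" if "x \<in> carrier M" for j K x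
    using that additive_minus[OF M.abelian_group_axioms M.abelian_group_axioms q, of x]
      additive_closed[OF q] by (simp add: ksign_def smult_l_minus)
  have "d ?y ?J = (?s \<otimes> v i) \<odot>\<^bsub>M\<^esub> ?y J \<oplus>\<^bsub>M\<^esub> ?T"
  proof -
    have "d ?y ?J = (ksign R i ?J \<otimes> v i) \<odot>\<^bsub>M\<^esub> ?y (insert i ?J) \<oplus>\<^bsub>M\<^esub> ?T"
      unfolding kdiff_def ind using y i by (intro M.finsum_insert) auto
    then show ?thesis
      using J by simp
  qed
  moreover have "\<zero>\<^bsub>M\<^esub> = ?s \<odot>\<^bsub>M\<^esub> c J \<oplus>\<^bsub>M\<^esub> ?T"
  proof -
    have "\<zero>\<^bsub>M\<^esub> = q (d c ?J)"
      using additive_zero[OF M.abelian_group_axioms M.abelian_group_axioms q] cycle by simp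
    also have "\<dots> = (\<Oplus>\<^bsub>M\<^esub>j\<in>insert i ({..<n} - J). q ((ksign R j ?J \<otimes> v j) \<odot>\<^bsub>M\<^esub> c (insert j ?J)))"
      unfolding kdiff_def ind using c i
      by (intro additive_finsum[OF M.abelian_group_axioms M.abelian_group_axioms q]) auto
    also have "\<dots> = q ((ksign R i ?J \<otimes> v i) \<odot>\<^bsub>M\<^esub> c (insert i ?J))
        \<oplus>\<^bsub>M\<^esub> (\<Oplus>\<^bsub>M\<^esub>j\<in>{..<n} - J. q ((ksign R j ?J \<otimes> v j) \<odot>\<^bsub>M\<^esub> c (insert j ?J)))"
      using c i by (intro M.finsum_insert) (auto intro!: additive_closed[OF q])
    also have "q ((ksign R i ?J \<otimes> v i) \<odot>\<^bsub>M\<^esub> c (insert i ?J)) = ?s \<odot>\<^bsub>M\<^esub> c J"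
      using J i c by (simp add: smult_assoc1 sign qi)
    also have "(\<Oplus>\<^bsub>M\<^esub>j\<in>{..<n} - J. q ((ksign R j ?J \<otimes> v j) \<odot>\<^bsub>M\<^esub> c (insert j ?J))) = ?T"
    proof (intro M.finsum_cong')
      fix j assume j: "j \<in> {..<n} - J"
      then have "j \<noteq> i" using i by auto
      then show "q ((ksign R j ?J \<otimes> v j) \<odot>\<^bsub>M\<^esub> c (insert j ?J))
          = (ksign R j ?J \<otimes> v j) \<odot>\<^bsub>M\<^esub> ?y (insert j ?J)"
        using j c y by (simp add: smult_assoc1 sign qj)
    qed (use y in auto)
    finally show ?thesis .
  qed
  then have "?T = \<ominus>\<^bsub>M\<^esub> (?s \<odot>\<^bsub>M\<^esub> c J)"
    using T c M.minus_equality[of ?T "?s \<odot>\<^bsub>M\<^esub> c J"] by (simp add: M.a_comm)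
  ultimately have "?s \<odot>\<^bsub>M\<^esub> d ?y ?J = ?s \<odot>\<^bsub>M\<^esub> ((?s \<otimes> v i) \<odot>\<^bsub>M\<^esub> ?y J) \<oplus>\<^bsub>M\<^esub> \<ominus>\<^bsub>M\<^esub> (?s \<odot>\<^bsub>M\<^esub> (?s \<odot>\<^bsub>M\<^esub> c J))"
    using c y i by (simp add: smult_r_distr smult_r_minus)
  also have "\<dots> = v i \<odot>\<^bsub>M\<^esub> ?y J \<oplus>\<^bsub>M\<^esub> \<ominus>\<^bsub>M\<^esub> c J"
    using c y i by (simp add: smult_assoc1[symmetric] R.m_assoc[symmetric])
  finally have "d (kwedge R M i ?y) J \<oplus>\<^bsub>M\<^esub> (v i \<odot>\<^bsub>M\<^esub> ?y J \<oplus>\<^bsub>M\<^esub> \<ominus>\<^bsub>M\<^esub> c J) = v i \<odot>\<^bsub>M\<^esub> ?y J"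
    using kdiff_kwedge_in[where c = "\<lambda>J. q (c J)", OF y i] by simp
  moreover have "d (kwedge R M i ?y) J \<in> carrier M" "v i \<odot>\<^bsub>M\<^esub> ?y J \<in> carrier M"
    using y i by (auto intro!: kdiff_closed kwedge_closed)
  ultimately show ?thesis
    using c[of J] by (rule M.eq_if_add_diff_eq)
qed

text \<open>
  Subtracting the boundaries of \<open>kdiff_kwedge_division\<close> for \<open>i = 0, 1, \<dots>\<close> makes the cycle vanish on
  all sets that meet \<open>{..<i}\<close>, without disturbing what was already achieved: away from \<open>i\<close> the
  correction is a multiple of a value that is zero there.
\<close>

lemma koszul_exact_if_division:
  assumes q: "\<And>i. i < n \<Longrightarrow> additive M M (q i)"
    and qi: "\<And>i x. i < n \<Longrightarrow> x \<in> carrier M \<Longrightarrow> q i (v i \<odot>\<^bsub>M\<^esub> x) = x"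
    and qj: "\<And>i j x. i < n \<Longrightarrow> j < n \<Longrightarrow> j \<noteq> i \<Longrightarrow> x \<in> carrier M \<Longrightarrow>
      q i (v j \<odot>\<^bsub>M\<^esub> x) = v j \<odot>\<^bsub>M\<^esub> q i x"
    and c: "\<And>J. c J \<in> carrier M" and cycle: "\<And>J. d c J = \<zero>\<^bsub>M\<^esub>"
    and pos: "\<And>J. J \<inter> {..<n} = {} \<Longrightarrow> c J = \<zero>\<^bsub>M\<^esub>"
  shows "\<exists>b. (\<forall>J. b J \<in> carrier M) \<and> (\<forall>J. d b J = c J)"
proof -
  have "\<exists>b. (\<forall>J. b J \<in> carrier M) \<and> (\<forall>J. d b J = c J)"
    if "i \<le> n" "\<And>J. c J \<in> carrier M" "\<And>J. d c J = \<zero>\<^bsub>M\<^esub>"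
      "\<And>J. J \<inter> {..<n} = {} \<Longrightarrow> c J = \<zero>\<^bsub>M\<^esub>" "\<And>J. J \<inter> {..<i} \<noteq> {} \<Longrightarrow> c J = \<zero>\<^bsub>M\<^esub>" for i c
    using that
  proof (induction i arbitrary: c rule: inc_induct)
    case base
    then have "c J = \<zero>\<^bsub>M\<^esub>" for J
      by (cases "J \<inter> {..<n} = {}") auto
    then have "\<forall>J. d (\<lambda>J. \<zero>\<^bsub>M\<^esub>) J = c J"
      by (simp add: kdiff_zero)
    then show ?case
      by (intro exI[of _ "\<lambda>J. \<zero>\<^bsub>M\<^esub>"]) auto
  next
    case (step i)
    note c = step.prems(1) and cycle = step.prems(2)
    let ?b = "kwedge R M i (\<lambda>J. q i (c J))"
    let ?c = "\<lambda>J. c J \<ominus>\<^bsub>M\<^esub> d ?b J"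
    have y: "q i (c J) \<in> carrier M" for J
      using additive_closed[OF q[OF step.hyps(2)] c] .
    have b: "?b J \<in> carrier M" "d ?b J \<in> carrier M" for J
      using y by (auto intro!: kwedge_closed kdiff_closed)
    have b_in: "?c J = \<zero>\<^bsub>M\<^esub>" if "i \<in> J" for J
      using kdiff_kwedge_division[of "q i" i c J] q qi qj c cycle step.hyps that
      by (simp add: M.r_neg a_minus_def)
    have b_notin: "?c J = \<zero>\<^bsub>M\<^esub>" if "i \<notin> J" "c J = \<zero>\<^bsub>M\<^esub>" for J
    proof -
      have "d ?b J = v i \<odot>\<^bsub>M\<^esub> q i (c J)"
        using kdiff_kwedge_notin[where c = "\<lambda>J. q i (c J)", OF y] that step.hyps by simp
      also have "\<dots> = \<zero>\<^bsub>M\<^esub>"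
        using additive_zero[OF M.abelian_group_axioms M.abelian_group_axioms q[OF step.hyps(2)]]
          that step.hyps by simp
      finally show ?thesis
        using that by (simp add: a_minus_def)
    qed
    have "\<exists>b. (\<forall>J. b J \<in> carrier M) \<and> (\<forall>J. d b J = ?c J)"
    proof (rule step.IH)
      show "?c J \<in> carrier M" for J
        using b c by simp
      show "d ?c J = \<zero>\<^bsub>M\<^esub>" for J
        using kdiff_diff[OF c b(2)] cycle kdiff_kdiff[OF b(1)] by (simp add: a_minus_def)
      show "?c J = \<zero>\<^bsub>M\<^esub>" if "J \<inter> {..<n} = {}" for J
        using that step.hyps step.prems(3) by (intro b_notin) auto
      show "?c J = \<zero>\<^bsub>M\<^esub>" if "J \<inter> {..<Suc i} \<noteq> {}" for J
      proof (cases "i \<in> J")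
        case False
        then have "J \<inter> {..<i} \<noteq> {}"
          using that less_Suc_eq by auto
        then show ?thesis
          using False step.prems(4) by (intro b_notin)
      qed (rule b_in)
    qed
    then obtain b' where b': "\<And>J. b' J \<in> carrier M" "\<And>J. d b' J = ?c J"
      by blast
    have "d (\<lambda>J. ?b J \<oplus>\<^bsub>M\<^esub> b' J) J = c J" for J
      using kdiff_additive[OF b(1) b'(1)] b'(2) b c
      by (simp add: a_minus_def M.a_lcomm M.r_neg)
    then show ?case
      using b b' by (intro exI[of _ "\<lambda>J. ?b J \<oplus>\<^bsub>M\<^esub> b' J"]) auto
  qed
  from this[of 0 c] show ?thesis
    using c cycle pos by simp
qed

end

lemma kdiff_natural:
  assumes "koszul R M v n" "module R N" and h: "R_linear R M N h" and c: "\<And>J. c J \<in> carrier M"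
  shows "h (kdiff R M v n c J) = kdiff R N v n (\<lambda>J. h (c J)) J"
proof -
  interpret M: koszul R M v n by fact
  interpret N: module R N by fact
  have cl: "h x \<in> carrier N" if "x \<in> carrier M" for x
    using additive_closed[OF R_linear_additive[OF h] that] .
  show ?thesis
    unfolding kdiff_def using c cl
    by (subst additive_finsum[OF M.M.abelian_group_axioms N.M.abelian_group_axioms R_linear_additive[OF h]])
      (auto intro!: N.M.finsum_cong' simp: R_linear_smult[OF h])
qed

section \<open>Homogeneous components as projections\<close>

text \<open>
  Gradings are used only through the projections onto the components. In contrast to the
  decomposition into finite sums, these pass to localizations and products without effort.
\<close>

definition gr_projection :: "('a, 'b, 'g) gr_module \<Rightarrow> ('g \<Rightarrow> 'b \<Rightarrow> 'b) \<Rightarrow> bool" where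
  "gr_projection M \<pi> \<longleftrightarrow> (\<forall>e. additive M M (\<pi> e) \<and> hcomp M e \<subseteq> carrier M \<and>
     (\<forall>x\<in>carrier M. \<pi> e x \<in> hcomp M e) \<and> (\<forall>x\<in>hcomp M e. \<pi> e x = x))"

definition gr_comp :: "('a, 'b, 'g) gr_module \<Rightarrow> 'g \<Rightarrow> 'b \<Rightarrow> 'b" where
  "gr_comp M e x = (THE c. (\<forall>\<gamma>. c \<gamma> \<in> hcomp M \<gamma>) \<and> finite {\<gamma>. c \<gamma> \<noteq> \<zero>\<^bsub>M\<^esub>} \<and>
     x = (\<Oplus>\<^bsub>M\<^esub>\<gamma>\<in>{\<gamma>. c \<gamma> \<noteq> \<zero>\<^bsub>M\<^esub>}. c \<gamma>)) e"

locale gr_group = abelian_group M for M :: "('a, 'b, 'g::ab_group_add) gr_module" (structure) +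
  assumes decomposition: "direct_sum_decomposition M (hcomp M)"
begin

lemma hcomp_subgroup: "subgroup (hcomp M e) (add_monoid M)"
  using decomposition by (simp add: direct_sum_decomposition_def)

lemma hcomp_closed: "x \<in> hcomp M e \<Longrightarrow> x \<in> carrier M"
  using subgroup.mem_carrier[OF hcomp_subgroup] by simp

lemma hcomp_zero: "\<zero>\<^bsub>M\<^esub> \<in> hcomp M e"
  using subgroup.one_closed[OF hcomp_subgroup] by simp

lemma hcomp_add: "x \<in> hcomp M e \<Longrightarrow> y \<in> hcomp M e \<Longrightarrow> x \<oplus>\<^bsub>M\<^esub> y \<in> hcomp M e"
  using subgroup.m_closed[OF hcomp_subgroup] by simp

lemma gr_comp_decomposition:
  assumes "x \<in> carrier M"
  shows "gr_comp M e x \<in> hcomp M e" and "finite {e. gr_comp M e x \<noteq> \<zero>\<^bsub>M\<^esub>}"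
    and "x = (\<Oplus>\<^bsub>M\<^esub>e\<in>{e. gr_comp M e x \<noteq> \<zero>\<^bsub>M\<^esub>}. gr_comp M e x)"
proof -
  let ?P = "\<lambda>c. (\<forall>\<gamma>. c \<gamma> \<in> hcomp M \<gamma>) \<and> finite {\<gamma>. c \<gamma> \<noteq> \<zero>\<^bsub>M\<^esub>} \<and>
     x = (\<Oplus>\<^bsub>M\<^esub>\<gamma>\<in>{\<gamma>. c \<gamma> \<noteq> \<zero>\<^bsub>M\<^esub>}. c \<gamma>)"
  have "\<exists>!c. ?P c"
    using decomposition assms unfolding direct_sum_decomposition_def by blast
  then have "?P (THE c. ?P c)"
    by (rule theI')
  moreover have eq: "gr_comp M e x = (THE c. ?P c) e" for e
    by (simp add: gr_comp_def)
  ultimately show "gr_comp M e x \<in> hcomp M e" "finite {e. gr_comp M e x \<noteq> \<zero>\<^bsub>M\<^esub>}"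
    "x = (\<Oplus>\<^bsub>M\<^esub>e\<in>{e. gr_comp M e x \<noteq> \<zero>\<^bsub>M\<^esub>}. gr_comp M e x)"
    unfolding eq by blast+
qed

lemma gr_comp_eqI:
  assumes "finite A" "\<And>e. c e \<in> hcomp M e" "\<And>e. e \<notin> A \<Longrightarrow> c e = \<zero>\<^bsub>M\<^esub>" "x = (\<Oplus>\<^bsub>M\<^esub>e\<in>A. c e)"
  shows "gr_comp M e x = c e"
proof -
  let ?P = "\<lambda>c. (\<forall>\<gamma>. c \<gamma> \<in> hcomp M \<gamma>) \<and> finite {\<gamma>. c \<gamma> \<noteq> \<zero>\<^bsub>M\<^esub>} \<and>
     x = (\<Oplus>\<^bsub>M\<^esub>\<gamma>\<in>{\<gamma>. c \<gamma> \<noteq> \<zero>\<^bsub>M\<^esub>}. c \<gamma>)"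
  have c: "c e \<in> carrier M" for e
    using assms(2) hcomp_closed by blast
  have sub: "{e. c e \<noteq> \<zero>\<^bsub>M\<^esub>} \<subseteq> A"
    using assms(3) by blast
  have "x = (\<Oplus>\<^bsub>M\<^esub>e\<in>{e. c e \<noteq> \<zero>\<^bsub>M\<^esub>}. c e)"
    unfolding assms(4) using assms(1) sub c by (intro add.finprod_mono_neutral_cong_right) auto
  then have P: "?P c"
    using assms sub finite_subset by blast
  have "x \<in> carrier M"
    unfolding assms(4) using c by (intro finsum_closed) auto
  then have "\<exists>!c. ?P c"
    using decomposition unfolding direct_sum_decomposition_def by blast
  then have "(THE c. ?P c) = c"
    using P by (intro the1_equality[of ?P])
  then show ?thesis
    by (simp add: gr_comp_def)
qed

lemma gr_comp_homogeneous:
  assumes "x \<in> hcomp M e"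
  shows "gr_comp M e x = x"
proof -
  have "gr_comp M e x = (if e = e then x else \<zero>\<^bsub>M\<^esub>)"
    using assms hcomp_closed[OF assms] hcomp_zero
    by (intro gr_comp_eqI[of "{e}" "\<lambda>e'. if e' = e then x else \<zero>\<^bsub>M\<^esub>"]) auto
  then show ?thesis by simp
qed

lemma gr_comp_sum_superset:
  assumes "x \<in> carrier M" "finite A" "{e. gr_comp M e x \<noteq> \<zero>\<^bsub>M\<^esub>} \<subseteq> A"
  shows "x = (\<Oplus>\<^bsub>M\<^esub>e\<in>A. gr_comp M e x)"
proof -
  have "gr_comp M e x \<in> carrier M" for e
    using gr_comp_decomposition(1)[OF assms(1)] hcomp_closed by blast
  then have "(\<Oplus>\<^bsub>M\<^esub>e\<in>{e. gr_comp M e x \<noteq> \<zero>\<^bsub>M\<^esub>}. gr_comp M e x) = (\<Oplus>\<^bsub>M\<^esub>e\<in>A. gr_comp M e x)"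
    using assms by (intro add.finprod_mono_neutral_cong_left) auto
  then show ?thesis
    using gr_comp_decomposition(3)[OF assms(1)] by simp
qed

lemma gr_comp_add:
  assumes "x \<in> carrier M" "y \<in> carrier M"
  shows "gr_comp M e (x \<oplus>\<^bsub>M\<^esub> y) = gr_comp M e x \<oplus>\<^bsub>M\<^esub> gr_comp M e y"
proof -
  let ?A = "{e. gr_comp M e x \<noteq> \<zero>\<^bsub>M\<^esub>} \<union> {e. gr_comp M e y \<noteq> \<zero>\<^bsub>M\<^esub>}"
  have fin: "finite ?A"
    using gr_comp_decomposition(2) assms by blast
  have cl: "gr_comp M e x \<in> carrier M" "gr_comp M e y \<in> carrier M" for e
    using gr_comp_decomposition(1) assms hcomp_closed by blast+
  have "x \<oplus>\<^bsub>M\<^esub> y = (\<Oplus>\<^bsub>M\<^esub>e\<in>?A. gr_comp M e x) \<oplus>\<^bsub>M\<^esub> (\<Oplus>\<^bsub>M\<^esub>e\<in>?A. gr_comp M e y)"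
    using gr_comp_sum_superset[OF assms(1) fin] gr_comp_sum_superset[OF assms(2) fin] by auto
  also have "\<dots> = (\<Oplus>\<^bsub>M\<^esub>e\<in>?A. gr_comp M e x \<oplus>\<^bsub>M\<^esub> gr_comp M e y)"
    using cl by (intro finsum_addf[symmetric]) auto
  finally show ?thesis
    using fin gr_comp_decomposition(1) assms hcomp_add cl
    by (intro gr_comp_eqI[of ?A "\<lambda>e. gr_comp M e x \<oplus>\<^bsub>M\<^esub> gr_comp M e y"]) auto
qed

lemma gr_projection_gr_comp: "gr_projection M (gr_comp M)"
  unfolding gr_projection_def additive_def
  by (auto intro: hcomp_closed gr_comp_decomposition(1) simp: gr_comp_add gr_comp_homogeneous)

end

text \<open>
  The images of the components of \<open>x\<close>, with degrees shifted by \<open>\<beta>\<close>, decompose \<open>h x\<close>.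
\<close>

lemma gr_comp_additive_map:
  assumes "gr_group M" "gr_group N" and h: "additive M N h"
    and deg: "\<And>e. h ` hcomp M e \<subseteq> hcomp N (e + \<beta>)" and x: "x \<in> carrier M"
  shows "h (gr_comp M e x) = gr_comp N (e + \<beta>) (h x)"
proof -
  interpret M: gr_group M by fact
  interpret N: gr_group N by fact
  let ?A = "{e. gr_comp M e x \<noteq> \<zero>\<^bsub>M\<^esub>}"
  let ?c = "\<lambda>e. h (gr_comp M (e - \<beta>) x)"
  have cl: "gr_comp M e x \<in> carrier M" for e
    using M.gr_comp_decomposition(1)[OF x] M.hcomp_closed by blast
  have "h x = h (\<Oplus>\<^bsub>M\<^esub>e\<in>?A. gr_comp M e x)"
    using M.gr_comp_decomposition(3)[OF x] by simp
  also have "\<dots> = (\<Oplus>\<^bsub>N\<^esub>e\<in>?A. h (gr_comp M e x))"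
    using cl M.gr_comp_decomposition(2)[OF x]
    by (intro additive_finsum[OF M.abelian_group_axioms N.abelian_group_axioms h]) auto
  also have "\<dots> = (\<Oplus>\<^bsub>N\<^esub>e\<in>(\<lambda>e. e + \<beta>) ` ?A. ?c e)"
    using additive_closed[OF h cl] by (subst N.finsum_reindex) (auto simp: inj_on_def)
  finally have "gr_comp N (e + \<beta>) (h x) = ?c (e + \<beta>)"
  proof (intro N.gr_comp_eqI)
    show "finite ((\<lambda>e. e + \<beta>) ` ?A)"
      using M.gr_comp_decomposition(2)[OF x] by blast
    show "?c e \<in> hcomp N e" for e
      using deg[of "e - \<beta>"] M.gr_comp_decomposition(1)[OF x, of "e - \<beta>"] by auto
    show "?c e = \<zero>\<^bsub>N\<^esub>" if "e \<notin> (\<lambda>e. e + \<beta>) ` ?A" for e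
    proof -
      have "e - \<beta> \<notin> ?A"
        using that by (metis (no_types, lifting) diff_add_cancel image_eqI)
      then show ?thesis
        using additive_zero[OF M.abelian_group_axioms N.abelian_group_axioms h] by simp
    qed
  qed
  then show ?thesis by simp
qed

section \<open>The graded Koszul complex\<close>

text \<open>
  The chains of homological degree \<open>p\<close> and degree \<open>g\<close>: the basis element \<open>e\<^sub>J\<close> has the degree
  \<open>\<Sum>j\<in>J. \<gamma> j\<close>. They see the module only in the degrees \<open>g - (\<Sum>j\<in>J. \<gamma> j)\<close> with \<open>card J = p\<close>, which is
  where the sets of degree sums in the theorem come from.
\<close>

definition kchains :: "('a, 'b, 'g::ab_group_add) gr_module \<Rightarrow> nat \<Rightarrow> (nat \<Rightarrow> 'g) \<Rightarrow> 'g \<Rightarrow> nat \<Rightarrow>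
    (nat set \<Rightarrow> 'b) set" where
  "kchains M n \<gamma> g p = {c. \<forall>J. (J \<subseteq> {..<n} \<and> card J = p \<longrightarrow> c J \<in> hcomp M (g - (\<Sum>j\<in>J. \<gamma> j))) \<and>
     (\<not> (J \<subseteq> {..<n} \<and> card J = p) \<longrightarrow> c J = \<zero>\<^bsub>M\<^esub>)}"

text \<open>
  For a graded submodule \<open>N\<close> this expresses that the \<open>p\<close>-th Koszul homology of \<open>M/N\<close> is zero in
  degree \<open>g\<close>, in terms of representatives.
\<close>

definition koszul_vanishes :: "('a, 'g::ab_group_add) gr_ring \<Rightarrow> ('a, 'b, 'g) gr_module \<Rightarrow>
    (nat \<Rightarrow> 'a) \<Rightarrow> nat \<Rightarrow> (nat \<Rightarrow> 'g) \<Rightarrow> 'g \<Rightarrow> nat \<Rightarrow> 'b set \<Rightarrow> bool" where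
  "koszul_vanishes R M v n \<gamma> g p N \<longleftrightarrow>
     (\<forall>z\<in>kchains M n \<gamma> g p. (\<forall>J. kdiff R M v n z J \<in> N) \<longrightarrow>
       (\<exists>w\<in>kchains M n \<gamma> g (Suc p). \<forall>J. z J \<ominus>\<^bsub>M\<^esub> kdiff R M v n w J \<in> N))"

locale gr_koszul = koszul R M v n
  for R :: "('a, 'g::ab_group_add) gr_ring" (structure)
    and M :: "('a, 'b, 'g) gr_module" (structure) and v n +
  fixes \<gamma> :: "nat \<Rightarrow> 'g" and \<pi> :: "'g \<Rightarrow> 'b \<Rightarrow> 'b"
  assumes projection: "gr_projection M \<pi>"
    and projection_v: "\<And>j e x. j < n \<Longrightarrow> x \<in> carrier M \<Longrightarrow> \<pi> (e + \<gamma> j) (v j \<odot>\<^bsub>M\<^esub> x) = v j \<odot>\<^bsub>M\<^esub> \<pi> e x"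
begin

lemma projection_additive: "additive M M (\<pi> e)"
  and hcomp_closed: "x \<in> hcomp M e \<Longrightarrow> x \<in> carrier M"
  and projection_in: "x \<in> carrier M \<Longrightarrow> \<pi> e x \<in> hcomp M e"
  and projection_id: "x \<in> hcomp M e \<Longrightarrow> \<pi> e x = x"
  using projection unfolding gr_projection_def by blast+

lemma projection_closed: "x \<in> carrier M \<Longrightarrow> \<pi> e x \<in> carrier M"
  using projection_in hcomp_closed by blast

lemma hcomp_eq: "hcomp M e = {x \<in> carrier M. \<pi> e x = x}"
proof
  show "hcomp M e \<subseteq> {x \<in> carrier M. \<pi> e x = x}"
    using projection_id hcomp_closed by blast
  show "{x \<in> carrier M. \<pi> e x = x} \<subseteq> hcomp M e"
  proof
    fix x assume "x \<in> {x \<in> carrier M. \<pi> e x = x}"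
    then show "x \<in> hcomp M e"
      using projection_in[of x e] by simp
  qed
qed

lemma hcomp_zero: "\<zero>\<^bsub>M\<^esub> \<in> hcomp M e"
  using additive_zero[OF M.abelian_group_axioms M.abelian_group_axioms projection_additive]
  by (simp add: hcomp_eq)

lemma hcomp_diff: "x \<in> hcomp M e \<Longrightarrow> y \<in> hcomp M e \<Longrightarrow> x \<ominus>\<^bsub>M\<^esub> y \<in> hcomp M e"
  using additive_diff[OF M.abelian_group_axioms M.abelian_group_axioms projection_additive]
  by (simp add: hcomp_eq)

lemma projection_term:
  assumes "j < n" "x \<in> carrier M"
  shows "\<pi> (e + \<gamma> j) ((ksign R j J \<otimes> v j) \<odot>\<^bsub>M\<^esub> x) = (ksign R j J \<otimes> v j) \<odot>\<^bsub>M\<^esub> \<pi> e x"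
  using assms projection_v[of j x e] projection_closed
    additive_minus[OF M.abelian_group_axioms M.abelian_group_axioms projection_additive]
  by (simp add: ksign_def smult_l_minus R.l_minus)

lemma projection_kdiff:
  assumes b: "\<And>J. b J \<in> carrier M" and J: "J \<subseteq> {..<n}"
  shows "\<pi> (g - (\<Sum>j\<in>J. \<gamma> j)) (d b J) = d (\<lambda>J. \<pi> (g - (\<Sum>j\<in>J. \<gamma> j)) (b J)) J"
proof -
  have "finite J"
    using J finite_subset by blast
  have "\<pi> (g - (\<Sum>j\<in>J. \<gamma> j)) (d b J) = (\<Oplus>\<^bsub>M\<^esub>j\<in>{..<n} - J.
      \<pi> (g - (\<Sum>j\<in>J. \<gamma> j)) ((ksign R j J \<otimes> v j) \<odot>\<^bsub>M\<^esub> b (insert j J)))"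
    unfolding kdiff_def using b
    by (intro additive_finsum[OF M.abelian_group_axioms M.abelian_group_axioms projection_additive]) auto
  also have "\<dots> = d (\<lambda>J. \<pi> (g - (\<Sum>j\<in>J. \<gamma> j)) (b J)) J"
    unfolding kdiff_def
  proof (intro M.finsum_cong')
    fix j assume j: "j \<in> {..<n} - J"
    have e: "g - (\<Sum>j\<in>insert j J. \<gamma> j) + \<gamma> j = g - (\<Sum>j\<in>J. \<gamma> j)"
      using j \<open>finite J\<close> by simp
    have "\<pi> (g - (\<Sum>j\<in>insert j J. \<gamma> j) + \<gamma> j) ((ksign R j J \<otimes> v j) \<odot>\<^bsub>M\<^esub> b (insert j J))
        = (ksign R j J \<otimes> v j) \<odot>\<^bsub>M\<^esub> \<pi> (g - (\<Sum>j\<in>insert j J. \<gamma> j)) (b (insert j J))"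
      using j b by (intro projection_term) auto
    then show "\<pi> (g - (\<Sum>j\<in>J. \<gamma> j)) ((ksign R j J \<otimes> v j) \<odot>\<^bsub>M\<^esub> b (insert j J))
        = (ksign R j J \<otimes> v j) \<odot>\<^bsub>M\<^esub> \<pi> (g - (\<Sum>j\<in>insert j J. \<gamma> j)) (b (insert j J))"
      by (simp only: e)
  qed (use b projection_closed in auto)
  finally show ?thesis .
qed

lemma kchainsI:
  assumes "\<And>J. J \<subseteq> {..<n} \<Longrightarrow> card J = p \<Longrightarrow> c J \<in> hcomp M (g - (\<Sum>j\<in>J. \<gamma> j))"
    and "\<And>J. \<not> (J \<subseteq> {..<n} \<and> card J = p) \<Longrightarrow> c J = \<zero>\<^bsub>M\<^esub>"
  shows "c \<in> kchains M n \<gamma> g p"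
  using assms unfolding kchains_def by blast

lemma kchains_index: "c \<in> kchains M n \<gamma> g p \<Longrightarrow> J \<subseteq> {..<n} \<Longrightarrow> card J = p \<Longrightarrow>
    c J \<in> hcomp M (g - (\<Sum>j\<in>J. \<gamma> j))"
  unfolding kchains_def by blast

lemma kchains_non_index:
  "c \<in> kchains M n \<gamma> g p \<Longrightarrow> \<not> (J \<subseteq> {..<n} \<and> card J = p) \<Longrightarrow> c J = \<zero>\<^bsub>M\<^esub>"
  unfolding kchains_def by blast

lemma kchains_closed:
  assumes "c \<in> kchains M n \<gamma> g p" shows "c J \<in> carrier M"
proof (cases "J \<subseteq> {..<n} \<and> card J = p")
  case True
  then show ?thesis
    using kchains_index[OF assms] hcomp_closed by blast
next
  case False
  then show ?thesis
    using kchains_non_index[OF assms] by simp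
qed

lemma kchains_diff:
  assumes "c \<in> kchains M n \<gamma> g p" "c' \<in> kchains M n \<gamma> g p"
  shows "(\<lambda>J. c J \<ominus>\<^bsub>M\<^esub> c' J) \<in> kchains M n \<gamma> g p"
proof (rule kchainsI)
  fix J assume "\<not> (J \<subseteq> {..<n} \<and> card J = p)"
  then show "c J \<ominus>\<^bsub>M\<^esub> c' J = \<zero>\<^bsub>M\<^esub>"
    using assms[THEN kchains_non_index] by (simp add: a_minus_def)
qed (use assms[THEN kchains_index] hcomp_diff in blast)

lemma kdiff_non_index:
  assumes "c \<in> kchains M n \<gamma> g (Suc p)" "\<not> (J \<subseteq> {..<n} \<and> card J = p)"
  shows "d c J = \<zero>\<^bsub>M\<^esub>"
proof -
  have "(ksign R j J \<otimes> v j) \<odot>\<^bsub>M\<^esub> c (insert j J) = \<zero>\<^bsub>M\<^esub>" if "j \<in> {..<n} - J" for j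
  proof -
    have "\<not> (insert j J \<subseteq> {..<n} \<and> card (insert j J) = Suc p)"
      using assms(2) that by (metis DiffD2 card_insert_disjoint diff_Suc_1 finite_lessThan finite_subset insert_subset)
    then show ?thesis
      using kchains_non_index[OF assms(1)] that by simp
  qed
  then show ?thesis
    unfolding kdiff_def by (intro M.add.finprod_one_eqI) auto
qed

lemma kdiff_kchains:
  assumes c: "c \<in> kchains M n \<gamma> g (Suc p)"
  shows "d c \<in> kchains M n \<gamma> g p"
proof -
  have "d c J \<in> hcomp M (g - (\<Sum>j\<in>J. \<gamma> j))" if J: "J \<subseteq> {..<n}" "card J = p" for J
  proof -
    have eq: "\<pi> (g - (\<Sum>j\<in>J. \<gamma> j)) (c J) = c J" if "J \<subseteq> {..<n}" "card J = Suc p" for J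
      using kchains_index[OF c that] projection_id by blast
    have "\<pi> (g - (\<Sum>j\<in>J. \<gamma> j)) (d c J) = d (\<lambda>J. \<pi> (g - (\<Sum>j\<in>J. \<gamma> j)) (c J)) J"
      by (rule projection_kdiff[OF kchains_closed[OF c] J(1)])
    also have "\<dots> = d c J"
      unfolding kdiff_def
    proof (intro M.finsum_cong')
      fix j assume "j \<in> {..<n} - J"
      then have "insert j J \<subseteq> {..<n}" "card (insert j J) = Suc p"
        using J finite_subset[OF J(1)] by auto
      then show "(ksign R j J \<otimes> v j) \<odot>\<^bsub>M\<^esub> \<pi> (g - (\<Sum>j\<in>insert j J. \<gamma> j)) (c (insert j J))
          = (ksign R j J \<otimes> v j) \<odot>\<^bsub>M\<^esub> c (insert j J)"
        using eq by presburger
    qed (use kchains_closed[OF c] in auto)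
    finally show ?thesis
      using kdiff_closed[of c J] kchains_closed[OF c] by (simp add: hcomp_eq)
  qed
  then show ?thesis
    using kdiff_non_index[OF c] by (intro kchainsI) blast+
qed

text \<open>
  A chain bounding \<open>c\<close> may be replaced by its part of the right degree and homological degree.
\<close>

lemma kchains_boundary:
  assumes c: "c \<in> kchains M n \<gamma> g p" and b: "\<And>J. b J \<in> carrier M" "\<And>J. d b J = c J"
  shows "\<exists>b'\<in>kchains M n \<gamma> g (Suc p). \<forall>J. d b' J = c J"
proof -
  define b' where "b' J = (if J \<subseteq> {..<n} \<and> card J = Suc p
      then \<pi> (g - (\<Sum>j\<in>J. \<gamma> j)) (b J) else \<zero>\<^bsub>M\<^esub>)" for J
  have b': "b' \<in> kchains M n \<gamma> g (Suc p)"
    using projection_in[OF b(1)] by (intro kchainsI) (auto simp: b'_def)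
  have "d b' J = c J" for J
  proof (cases "J \<subseteq> {..<n} \<and> card J = p")
    case True
    then have "\<pi> (g - (\<Sum>j\<in>J. \<gamma> j)) (c J) = c J"
      using kchains_index[OF c] projection_id by blast
    then have "c J = d (\<lambda>J. \<pi> (g - (\<Sum>j\<in>J. \<gamma> j)) (b J)) J"
      using projection_kdiff[of b J g] b True by simp
    also have "\<dots> = d b' J"
      unfolding kdiff_def
    proof (intro M.finsum_cong')
      fix j assume "j \<in> {..<n} - J"
      then have "insert j J \<subseteq> {..<n}" "card (insert j J) = Suc p"
        using True finite_subset[of J "{..<n}"] by auto
      then show "(ksign R j J \<otimes> v j) \<odot>\<^bsub>M\<^esub> \<pi> (g - (\<Sum>j\<in>insert j J. \<gamma> j)) (b (insert j J))
          = (ksign R j J \<otimes> v j) \<odot>\<^bsub>M\<^esub> b' (insert j J)"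
        unfolding b'_def by presburger
    qed (use kchains_closed[OF b'] in auto)
    finally show ?thesis by simp
  next
    case False
    then show ?thesis
      using kdiff_non_index[OF b'] kchains_non_index[OF c] by simp
  qed
  then show ?thesis
    using b' by blast
qed

end

section \<open>Moving Koszul vanishing along a graded complex\<close>

lemma kchains_map:
  assumes "c \<in> kchains M n \<gamma> g p" "h \<zero>\<^bsub>M\<^esub> = \<zero>\<^bsub>N\<^esub>" "\<And>e. h ` hcomp M e \<subseteq> hcomp N e"
  shows "(\<lambda>J. h (c J)) \<in> kchains N n \<gamma> g p"
  using assms unfolding kchains_def by (auto simp: image_subset_iff)

lemma kchains_lift:
  assumes c: "c \<in> kchains N n \<gamma> g p" and h: "h \<zero>\<^bsub>M\<^esub> = \<zero>\<^bsub>N\<^esub>"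
    and lift: "\<And>J. J \<subseteq> {..<n} \<Longrightarrow> card J = p \<Longrightarrow> c J \<in> h ` hcomp M (g - (\<Sum>j\<in>J. \<gamma> j))"
  shows "\<exists>b\<in>kchains M n \<gamma> g p. \<forall>J. h (b J) = c J"
proof -
  have "\<forall>J. \<exists>y. (J \<subseteq> {..<n} \<and> card J = p \<longrightarrow> y \<in> hcomp M (g - (\<Sum>j\<in>J. \<gamma> j))) \<and>
      (\<not> (J \<subseteq> {..<n} \<and> card J = p) \<longrightarrow> y = \<zero>\<^bsub>M\<^esub>) \<and> h y = c J"
  proof
    fix J
    show "\<exists>y. (J \<subseteq> {..<n} \<and> card J = p \<longrightarrow> y \<in> hcomp M (g - (\<Sum>j\<in>J. \<gamma> j))) \<and>
      (\<not> (J \<subseteq> {..<n} \<and> card J = p) \<longrightarrow> y = \<zero>\<^bsub>M\<^esub>) \<and> h y = c J"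
    proof (cases "J \<subseteq> {..<n} \<and> card J = p")
      case True
      then show ?thesis using lift[of J] by auto
    next
      case False
      then have "c J = \<zero>\<^bsub>N\<^esub>" using c unfolding kchains_def by blast
      then show ?thesis using False h by auto
    qed
  qed
  then obtain b where "\<And>J. (J \<subseteq> {..<n} \<and> card J = p \<longrightarrow> b J \<in> hcomp M (g - (\<Sum>j\<in>J. \<gamma> j))) \<and>
      (\<not> (J \<subseteq> {..<n} \<and> card J = p) \<longrightarrow> b J = \<zero>\<^bsub>M\<^esub>) \<and> h (b J) = c J"
    by metis
  then show ?thesis
    unfolding kchains_def by blast
qed

lemma (in abelian_group) eq_if_diff_zero:
  assumes "x \<ominus>\<^bsub>G\<^esub> y = \<zero>\<^bsub>G\<^esub>" "x \<in> carrier G" "y \<in> carrier G"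
  shows "x = y"
  using assms minus_equality[of x "\<ominus>\<^bsub>G\<^esub> y"] by (simp add: a_minus_def)

locale gr_koszul_map = L: gr_koszul R L v n \<gamma> \<pi> + L': gr_koszul R L' v n \<gamma> \<pi>'
  for R :: "('a, 'g::ab_group_add) gr_ring"
    and L :: "('a, 'b, 'g) gr_module" and L' :: "('a, 'c, 'g) gr_module" and v n \<gamma> \<pi> \<pi>' +
  fixes h :: "'b \<Rightarrow> 'c"
  assumes h_linear: "R_linear R L L' h"
    and h_hcomp: "\<And>e. h ` hcomp L e \<subseteq> hcomp L' e"
begin

lemma h_zero: "h \<zero>\<^bsub>L\<^esub> = \<zero>\<^bsub>L'\<^esub>"
  by (rule additive_zero[OF L.M.abelian_group_axioms L'.M.abelian_group_axioms
        R_linear_additive[OF h_linear]])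

lemma h_closed: "x \<in> carrier L \<Longrightarrow> h x \<in> carrier L'"
  by (rule additive_closed[OF R_linear_additive[OF h_linear]])

lemma h_diff: "x \<in> carrier L \<Longrightarrow> y \<in> carrier L \<Longrightarrow> h (x \<ominus>\<^bsub>L\<^esub> y) = h x \<ominus>\<^bsub>L'\<^esub> h y"
  by (rule additive_diff[OF L.M.abelian_group_axioms L'.M.abelian_group_axioms
        R_linear_additive[OF h_linear]])

lemma h_kdiff:
  assumes "\<And>J. c J \<in> carrier L" shows "h (kdiff R L v n c J) = kdiff R L' v n (\<lambda>J. h (c J)) J"
  by (rule kdiff_natural[OF L.koszul_axioms L'.module_axioms h_linear assms])

lemma h_kchains: "c \<in> kchains L n \<gamma> g p \<Longrightarrow> (\<lambda>J. h (c J)) \<in> kchains L' n \<gamma> g p"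
  by (rule kchains_map[OF _ h_zero h_hcomp])

text \<open>
  The chain \<open>z - d u\<close> is mapped to zero, and in the degrees of its values the kernel of \<open>h\<close> lies
  in \<open>N\<close>.
\<close>

lemma correct_by_boundary:
  assumes z: "z \<in> kchains L n \<gamma> g p" and u: "u \<in> kchains L n \<gamma> g (Suc p)"
    and eq: "\<And>J. h (z J) = h (kdiff R L v n u J)"
    and ker: "\<And>J x. J \<subseteq> {..<n} \<Longrightarrow> card J = p \<Longrightarrow> x \<in> hcomp L (g - (\<Sum>j\<in>J. \<gamma> j)) \<Longrightarrow>
      h x = \<zero>\<^bsub>L'\<^esub> \<Longrightarrow> x \<in> N"
    and N: "\<zero>\<^bsub>L\<^esub> \<in> N"
  shows "z J \<ominus>\<^bsub>L\<^esub> kdiff R L v n u J \<in> N"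
proof -
  have zu: "(\<lambda>J. z J \<ominus>\<^bsub>L\<^esub> kdiff R L v n u J) \<in> kchains L n \<gamma> g p"
    by (rule L.kchains_diff[OF z L.kdiff_kchains[OF u]])
  show ?thesis
  proof (cases "J \<subseteq> {..<n} \<and> card J = p")
    case True
    have "h (z J \<ominus>\<^bsub>L\<^esub> kdiff R L v n u J) = h (z J) \<ominus>\<^bsub>L'\<^esub> h (kdiff R L v n u J)"
      by (intro h_diff L.kchains_closed[OF z] L.kchains_closed[OF L.kdiff_kchains[OF u]])
    also have "\<dots> = \<zero>\<^bsub>L'\<^esub>"
      using eq h_closed[OF L.kchains_closed[OF z]] by (simp add: a_minus_def L'.M.r_neg)
    finally show ?thesis
      using True L.kchains_index[OF zu, of J] ker[of J] by blast
  next
    case False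
    then show ?thesis
      using L.kchains_non_index[OF zu] N by simp
  qed
qed

text \<open>
  This is the dimension shift on which the proof rests. Modulo the image of \<open>h\<close>, the chain \<open>z'\<close> is
  a cycle, as \<open>d z' = h z\<close>; therefore \<open>z' = h u + d w'\<close>. Then \<open>h z = d z' = h (d u)\<close>, so that
  \<open>z - d u\<close> takes values in the kernel of \<open>h\<close>.
\<close>

lemma koszul_vanishes_lift:
  assumes van: "koszul_vanishes R L' v n \<gamma> g (Suc p) (h ` carrier L)"
    and strict: "\<And>e x. x \<in> carrier L \<Longrightarrow> h x \<in> hcomp L' e \<Longrightarrow> h x \<in> h ` hcomp L e"
    and ker: "\<And>J x. J \<subseteq> {..<n} \<Longrightarrow> card J = p \<Longrightarrow> x \<in> hcomp L (g - (\<Sum>j\<in>J. \<gamma> j)) \<Longrightarrow>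
      h x = \<zero>\<^bsub>L'\<^esub> \<Longrightarrow> x \<in> N"
    and N: "\<zero>\<^bsub>L\<^esub> \<in> N"
    and z: "z \<in> kchains L n \<gamma> g p" and z': "z' \<in> kchains L' n \<gamma> g (Suc p)"
    and zz': "\<And>J. h (z J) = kdiff R L' v n z' J"
  shows "\<exists>w\<in>kchains L n \<gamma> g (Suc p). \<forall>J. z J \<ominus>\<^bsub>L\<^esub> kdiff R L v n w J \<in> N"
proof -
  have "\<forall>J. kdiff R L' v n z' J \<in> h ` carrier L"
    using zz' L.kchains_closed[OF z] by (metis image_eqI)
  then obtain w' where w': "w' \<in> kchains L' n \<gamma> g (Suc (Suc p))"
    and w'_im: "\<And>J. z' J \<ominus>\<^bsub>L'\<^esub> kdiff R L' v n w' J \<in> h ` carrier L"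
    using van z' unfolding koszul_vanishes_def by blast
  let ?y = "\<lambda>J. z' J \<ominus>\<^bsub>L'\<^esub> kdiff R L' v n w' J"
  have dw': "kdiff R L' v n w' \<in> kchains L' n \<gamma> g (Suc p)"
    by (rule L'.kdiff_kchains[OF w'])
  have y: "?y \<in> kchains L' n \<gamma> g (Suc p)"
    by (rule L'.kchains_diff[OF z' dw'])
  have "?y J \<in> h ` hcomp L (g - (\<Sum>j\<in>J. \<gamma> j))" if "J \<subseteq> {..<n}" "card J = Suc p" for J
    using w'_im[of J] L'.kchains_index[OF y that] strict by auto
  from kchains_lift[where h = h and M = L, OF y h_zero this]
  obtain u where u: "u \<in> kchains L n \<gamma> g (Suc p)" and hu: "\<And>J. h (u J) = ?y J"
    by blast
  have "h (z J) = h (kdiff R L v n u J)" for J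
  proof -
    have "h (kdiff R L v n u J) = kdiff R L' v n ?y J"
      using h_kdiff[of u J] L.kchains_closed[OF u] hu by simp
    also have "\<dots> = kdiff R L' v n z' J \<ominus>\<^bsub>L'\<^esub> kdiff R L' v n (kdiff R L' v n w') J"
      by (rule L'.kdiff_diff[OF L'.kchains_closed[OF z'] L'.kchains_closed[OF dw']])
    also have "kdiff R L' v n (kdiff R L' v n w') J = \<zero>\<^bsub>L'\<^esub>"
      by (rule L'.kdiff_kdiff[OF L'.kchains_closed[OF w']])
    finally show ?thesis
      using h_closed[OF L.kchains_closed[OF z]] by (simp add: a_minus_def zz'[symmetric])
  qed
  then have "z J \<ominus>\<^bsub>L\<^esub> kdiff R L v n u J \<in> N" for J
    by (rule correct_by_boundary[OF z u _ _ N]) (rule ker)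
  then show ?thesis
    using u by blast
qed

text \<open>
  When \<open>d z\<close> takes values in \<open>N\<close>, the chain \<open>h z\<close> is a cycle, and exactness of the Koszul complex
  of \<open>L'\<close> provides the \<open>z'\<close> for the preceding lemma.
\<close>

lemma koszul_vanishes_step:
  assumes van: "koszul_vanishes R L' v n \<gamma> g (Suc p) (h ` carrier L)"
    and strict: "\<And>e x. x \<in> carrier L \<Longrightarrow> h x \<in> hcomp L' e \<Longrightarrow> h x \<in> h ` hcomp L e"
    and ker: "\<And>J x. J \<subseteq> {..<n} \<Longrightarrow> card J = p \<Longrightarrow> x \<in> hcomp L (g - (\<Sum>j\<in>J. \<gamma> j)) \<Longrightarrow>
      h x = \<zero>\<^bsub>L'\<^esub> \<Longrightarrow> x \<in> N"
    and N: "\<zero>\<^bsub>L\<^esub> \<in> N" and hN: "\<And>x. x \<in> N \<Longrightarrow> h x = \<zero>\<^bsub>L'\<^esub>"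
    and row: "\<And>c. c \<in> kchains L' n \<gamma> g p \<Longrightarrow> (\<And>J. kdiff R L' v n c J = \<zero>\<^bsub>L'\<^esub>) \<Longrightarrow>
      \<exists>b. (\<forall>J. b J \<in> carrier L') \<and> (\<forall>J. kdiff R L' v n b J = c J)"
  shows "koszul_vanishes R L v n \<gamma> g p N"
  unfolding koszul_vanishes_def
proof (intro ballI impI)
  fix z assume z: "z \<in> kchains L n \<gamma> g p" and dz: "\<forall>J. kdiff R L v n z J \<in> N"
  have "kdiff R L' v n (\<lambda>J. h (z J)) J = \<zero>\<^bsub>L'\<^esub>" for J
    using h_kdiff[of z J] L.kchains_closed[OF z] dz hN by simp
  from row[OF h_kchains[OF z] this] obtain b where
    "\<And>J. b J \<in> carrier L'" "\<And>J. kdiff R L' v n b J = h (z J)"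
    by blast
  from L'.kchains_boundary[OF h_kchains[OF z] this] obtain z' where
    z': "z' \<in> kchains L' n \<gamma> g (Suc p)" "\<And>J. h (z J) = kdiff R L' v n z' J"
    by auto
  show "\<exists>w\<in>kchains L n \<gamma> g (Suc p). \<forall>J. z J \<ominus>\<^bsub>L\<^esub> kdiff R L v n w J \<in> N"
    by (rule koszul_vanishes_lift[OF van strict _ N z z']) (assumption | rule ker)+
qed

text \<open>
  Here \<open>h\<close> identifies \<open>L/N\<close> with \<open>L'\<close>.
\<close>

lemma koszul_vanishes_of_quotient:
  assumes van: "koszul_vanishes R L' v n \<gamma> g p {\<zero>\<^bsub>L'\<^esub>}"
    and surj: "\<And>e. hcomp L' e \<subseteq> h ` hcomp L e"
    and ker: "\<And>x. x \<in> carrier L \<Longrightarrow> h x = \<zero>\<^bsub>L'\<^esub> \<longleftrightarrow> x \<in> N"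
    and N: "N \<subseteq> carrier L"
  shows "koszul_vanishes R L v n \<gamma> g p N"
  unfolding koszul_vanishes_def
proof (intro ballI impI)
  fix z assume z: "z \<in> kchains L n \<gamma> g p" and dz: "\<forall>J. kdiff R L v n z J \<in> N"
  have "h (kdiff R L v n z J) = \<zero>\<^bsub>L'\<^esub>" for J
    using dz ker N by blast
  then have "\<forall>J. kdiff R L' v n (\<lambda>J. h (z J)) J \<in> {\<zero>\<^bsub>L'\<^esub>}"
    using h_kdiff[of z] L.kchains_closed[OF z] by simp
  then obtain w' where w': "w' \<in> kchains L' n \<gamma> g (Suc p)"
    and eq: "\<And>J. h (z J) \<ominus>\<^bsub>L'\<^esub> kdiff R L' v n w' J = \<zero>\<^bsub>L'\<^esub>"
    using van h_kchains[OF z] unfolding koszul_vanishes_def by blast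
  have "w' J \<in> h ` hcomp L (g - (\<Sum>j\<in>J. \<gamma> j))" if "J \<subseteq> {..<n}" "card J = Suc p" for J
    using L'.kchains_index[OF w' that] surj by blast
  from kchains_lift[where h = h and M = L, OF w' h_zero this]
  obtain w where w: "w \<in> kchains L n \<gamma> g (Suc p)" and hw: "\<And>J. h (w J) = w' J"
    by blast
  have "h (z J) = h (kdiff R L v n w J)" for J
  proof -
    have "h (kdiff R L v n w J) = kdiff R L' v n w' J"
      using h_kdiff[of w J] L.kchains_closed[OF w] hw by simp
    moreover have "kdiff R L' v n w' J \<in> carrier L'"
      by (rule L'.kchains_closed[OF L'.kdiff_kchains[OF w']])
    ultimately show ?thesis
      using eq[of J] h_closed[OF L.kchains_closed[OF z]] by (simp add: L'.M.eq_if_diff_zero)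
  qed
  moreover have "\<zero>\<^bsub>L\<^esub> \<in> N"
    using ker h_zero by simp
  moreover have "x \<in> N" if "x \<in> hcomp L e" "h x = \<zero>\<^bsub>L'\<^esub>" for x e
    using that ker L.hcomp_closed by blast
  ultimately show "\<exists>w\<in>kchains L n \<gamma> g (Suc p). \<forall>J. z J \<ominus>\<^bsub>L\<^esub> kdiff R L v n w J \<in> N"
    using correct_by_boundary[OF z w, of N] w by blast
qed

end

section \<open>Localization\<close>

locale localization = module R M
  for R :: "('a, 'g::ab_group_add) gr_ring" (structure)
    and M :: "('a, 'b, 'g) gr_module" (structure) +
  fixes f :: 'a
  assumes f_closed [simp]: "f \<in> carrier R"
begin

definition pw :: "nat \<Rightarrow> 'b \<Rightarrow> 'b" where
  "pw k x = (f [^] k) \<odot>\<^bsub>M\<^esub> x"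

definition frac :: "'b \<Rightarrow> nat \<Rightarrow> ('b \<times> nat) set" where
  "frac x k = frac_rel R M f `` {(x, k)}"

lemma pw_closed [simp]: "x \<in> carrier M \<Longrightarrow> pw k x \<in> carrier M"
  by (simp add: pw_def)

lemma pw_0 [simp]: "x \<in> carrier M \<Longrightarrow> pw 0 x = x"
  by (simp add: pw_def)

lemma pw_pw: "x \<in> carrier M \<Longrightarrow> pw k (pw l x) = pw (k + l) x"
  by (simp add: pw_def smult_assoc1[symmetric] R.nat_pow_mult)

lemma pw_Suc: "x \<in> carrier M \<Longrightarrow> pw (Suc k) x = pw k (f \<odot>\<^bsub>M\<^esub> x)"
  by (simp add: pw_def smult_assoc1[symmetric])

lemma pw_add: "x \<in> carrier M \<Longrightarrow> y \<in> carrier M \<Longrightarrow> pw k (x \<oplus>\<^bsub>M\<^esub> y) = pw k x \<oplus>\<^bsub>M\<^esub> pw k y"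
  by (simp add: pw_def smult_r_distr)

lemma pw_zero [simp]: "pw k \<zero>\<^bsub>M\<^esub> = \<zero>\<^bsub>M\<^esub>"
  by (simp add: pw_def)

lemma pw_minus: "x \<in> carrier M \<Longrightarrow> pw k (\<ominus>\<^bsub>M\<^esub> x) = \<ominus>\<^bsub>M\<^esub> pw k x"
  by (simp add: pw_def smult_r_minus)

lemma pw_smult: "r \<in> carrier R \<Longrightarrow> x \<in> carrier M \<Longrightarrow> pw k (r \<odot>\<^bsub>M\<^esub> x) = r \<odot>\<^bsub>M\<^esub> pw k x"
  by (simp add: pw_def smult_assoc1[symmetric] R.m_comm)

lemma pw_eq_shift:
  assumes "pw a x = pw b y" "x \<in> carrier M" "y \<in> carrier M"
  shows "pw (c + a) x = pw (c + b) y"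
  using assms pw_pw[of x c a] pw_pw[of y c b] by simp

lemma equiv_frac_rel: "equiv (carrier M \<times> UNIV) (frac_rel R M f)"
proof (rule equivI)
  show "frac_rel R M f \<subseteq> (carrier M \<times> UNIV) \<times> (carrier M \<times> UNIV)"
    by (auto simp: frac_rel_def)
  show "refl_on (carrier M \<times> UNIV) (frac_rel R M f)"
    by (auto simp: refl_on_def frac_rel_def)
  show "sym (frac_rel R M f)"
    by (auto simp: sym_def frac_rel_def) metis
  show "trans (frac_rel R M f)"
  proof (rule transI)
    fix p q u assume "(p, q) \<in> frac_rel R M f" "(q, u) \<in> frac_rel R M f"
    then obtain x k y l z m t s where eq: "p = (x, k)" "q = (y, l)" "u = (z, m)"
      and cl: "x \<in> carrier M" "y \<in> carrier M" "z \<in> carrier M"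
      and "pw (t + l) x = pw (t + k) y" "pw (s + m) y = pw (s + l) z"
      unfolding frac_rel_def pw_def by blast
    then have "pw ((s + m) + (t + l)) x = pw ((s + m) + (t + k)) y"
      and "pw ((t + k) + (s + m)) y = pw ((t + k) + (s + l)) z"
      by (auto intro!: pw_eq_shift)
    then have "pw ((t + s + l) + m) x = pw ((t + s + l) + k) z"
      by (simp add: ac_simps)
    then show "(p, u) \<in> frac_rel R M f"
      unfolding frac_rel_def pw_def using eq cl by blast
  qed
qed

lemma frac_eq_iff:
  assumes "x \<in> carrier M" "y \<in> carrier M"
  shows "frac x k = frac y l \<longleftrightarrow> (\<exists>t. pw (t + l) x = pw (t + k) y)"
proof -
  have "frac x k = frac y l \<longleftrightarrow> ((x, k), (y, l)) \<in> frac_rel R M f"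
    unfolding frac_def using assms by (intro eq_equiv_class_iff[OF equiv_frac_rel]) auto
  then show ?thesis
    using assms by (auto simp: frac_rel_def pw_def)
qed

lemma fracI: "x \<in> carrier M \<Longrightarrow> y \<in> carrier M \<Longrightarrow> pw l x = pw k y \<Longrightarrow> frac x k = frac y l"
  by (subst frac_eq_iff) (auto intro: exI[of _ 0])

lemma frac_scale: "x \<in> carrier M \<Longrightarrow> frac (pw l x) (k + l) = frac x k"
  by (rule fracI) (simp_all add: pw_pw)

text \<open>
  Operations on fractions are defined as unions over all representatives. Such a union can be
  evaluated at a single one if all of them contribute the same class.
\<close>

lemma UN_frac:
  assumes x: "x \<in> carrier M"
    and "\<And>y l. y \<in> carrier M \<Longrightarrow> frac y l = frac x k \<Longrightarrow> g y l = g x k"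
  shows "(\<Union>(y, l)\<in>frac x k. g y l) = g x k"
proof -
  have "g y l = g x k" if "(y, l) \<in> frac x k" for y l
  proof -
    have "((x, k), (y, l)) \<in> frac_rel R M f"
      using that by (simp add: frac_def)
    moreover from this have "y \<in> carrier M"
      by (auto simp: frac_rel_def)
    ultimately show ?thesis
      using assms(2) equiv_class_eq[OF equiv_frac_rel] unfolding frac_def by metis
  qed
  moreover have "(x, k) \<in> frac x k"
    unfolding frac_def using x by (intro equiv_class_self[OF equiv_frac_rel]) simp
  ultimately show ?thesis by blast
qed

lemma frac_mem_closed: "(y, l) \<in> frac x k \<Longrightarrow> y \<in> carrier M"
  by (auto simp: frac_def frac_rel_def)

lemma carrier_localization: "carrier (gr_localization R M f \<delta>) = {frac x k | x k. x \<in> carrier M}"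
  by (auto simp: gr_localization_def quotient_def frac_def)

lemma frac_in_carrier [simp]: "x \<in> carrier M \<Longrightarrow> frac x k \<in> carrier (gr_localization R M f \<delta>)"
  by (auto simp: carrier_localization)

lemma localization_cases:
  assumes "C \<in> carrier (gr_localization R M f \<delta>)"
  obtains x k where "C = frac x k" "x \<in> carrier M"
  using assms that unfolding carrier_localization by blast

lemma zero_localization: "\<zero>\<^bsub>gr_localization R M f \<delta>\<^esub> = frac \<zero>\<^bsub>M\<^esub> 0"
  by (simp add: gr_localization_def frac_def)

lemma frac_zero: "frac \<zero>\<^bsub>M\<^esub> k = frac \<zero>\<^bsub>M\<^esub> 0"
  by (rule fracI) simp_all

lemma add_localization:
  assumes x: "x \<in> carrier M" and y: "y \<in> carrier M"
  shows "frac x k \<oplus>\<^bsub>gr_localization R M f \<delta>\<^esub> frac y l = frac (pw l x \<oplus>\<^bsub>M\<^esub> pw k y) (k + l)"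
proof -
  let ?g = "\<lambda>x k y l. frac (pw l x \<oplus>\<^bsub>M\<^esub> pw k y) (k + l)"
  have wd: "?g x' k' y' l' = ?g x k y l"
    if cl: "x' \<in> carrier M" "y' \<in> carrier M" "x \<in> carrier M" "y \<in> carrier M"
      and eq: "frac x' k' = frac x k" "frac y' l' = frac y l" for x' k' y' l' x k y l
  proof -
    obtain t s where ts: "pw (t + k) x' = pw (t + k') x" "pw (s + l) y' = pw (s + l') y"
      using eq cl by (auto simp: frac_eq_iff)
    have "pw ((s + l + l') + (t + k)) x' = pw ((s + l + l') + (t + k')) x"
      "pw ((t + k + k') + (s + l)) y' = pw ((t + k + k') + (s + l')) y"
      using ts cl by (auto intro!: pw_eq_shift)
    then have "pw (t + s + (k + l)) (pw l' x' \<oplus>\<^bsub>M\<^esub> pw k' y')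
        = pw (t + s + (k' + l')) (pw l x \<oplus>\<^bsub>M\<^esub> pw k y)"
      using cl by (simp add: pw_add pw_pw ac_simps)
    then show ?thesis
      using cl by (subst frac_eq_iff) auto
  qed
  have "frac x k \<oplus>\<^bsub>gr_localization R M f \<delta>\<^esub> frac y l
      = (\<Union>(x, k)\<in>frac x k. \<Union>(y, l)\<in>frac y l. ?g x k y l)"
    by (simp add: gr_localization_def frac_def pw_def)
  also have "\<dots> = (\<Union>(x, k)\<in>frac x k. ?g x k y l)"
  proof (intro SUP_cong refl, clarify)
    fix x' k' assume "(x', k') \<in> frac x k"
    then have "x' \<in> carrier M" by (rule frac_mem_closed)
    then show "(\<Union>(y, l)\<in>frac y l. ?g x' k' y l) = ?g x' k' y l"
      using y by (intro UN_frac wd) (assumption | rule refl)+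
  qed
  also have "\<dots> = ?g x k y l"
    using x y by (intro UN_frac wd) (assumption | rule refl)+
  finally show ?thesis .
qed

lemma smult_localization:
  assumes x: "x \<in> carrier M" and r: "r \<in> carrier R"
  shows "r \<odot>\<^bsub>gr_localization R M f \<delta>\<^esub> frac x k = frac (r \<odot>\<^bsub>M\<^esub> x) k"
proof -
  have "r \<odot>\<^bsub>gr_localization R M f \<delta>\<^esub> frac x k = (\<Union>(x, k)\<in>frac x k. frac (r \<odot>\<^bsub>M\<^esub> x) k)"
    by (simp add: gr_localization_def frac_def)
  also have "\<dots> = frac (r \<odot>\<^bsub>M\<^esub> x) k"
  proof (rule UN_frac[OF x])
    fix y l assume y: "y \<in> carrier M" and "frac y l = frac x k"
    then obtain t where "pw (t + k) y = pw (t + l) x"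
      using x by (auto simp: frac_eq_iff)
    then have "pw (t + k) (r \<odot>\<^bsub>M\<^esub> y) = pw (t + l) (r \<odot>\<^bsub>M\<^esub> x)"
      using x y r by (simp add: pw_smult)
    then show "frac (r \<odot>\<^bsub>M\<^esub> y) l = frac (r \<odot>\<^bsub>M\<^esub> x) k"
      using x y r by (subst frac_eq_iff) auto
  qed
  finally show ?thesis .
qed

lemma abelian_group_localization: "abelian_group (gr_localization R M f \<delta>)"
proof (rule abelian_groupI)
  let ?L = "gr_localization R M f \<delta>"
  fix C D E assume "C \<in> carrier ?L" "D \<in> carrier ?L" "E \<in> carrier ?L"
  then obtain x k y l z m where eq: "C = frac x k" "D = frac y l" "E = frac z m"
    and cl: "x \<in> carrier M" "y \<in> carrier M" "z \<in> carrier M"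
    by (metis localization_cases)
  show "(C \<oplus>\<^bsub>?L\<^esub> D) \<oplus>\<^bsub>?L\<^esub> E = C \<oplus>\<^bsub>?L\<^esub> (D \<oplus>\<^bsub>?L\<^esub> E)"
    using cl by (simp add: eq add_localization pw_add pw_pw M.a_assoc ac_simps)
next
  let ?L = "gr_localization R M f \<delta>"
  fix C D assume "C \<in> carrier ?L" "D \<in> carrier ?L"
  then obtain x k y l where eq: "C = frac x k" "D = frac y l"
    and cl: "x \<in> carrier M" "y \<in> carrier M"
    by (metis localization_cases)
  show "C \<oplus>\<^bsub>?L\<^esub> D \<in> carrier ?L" "C \<oplus>\<^bsub>?L\<^esub> D = D \<oplus>\<^bsub>?L\<^esub> C"
    using cl by (simp_all add: eq add_localization M.a_comm add.commute)
next
  let ?L = "gr_localization R M f \<delta>"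
  fix C assume "C \<in> carrier ?L"
  then obtain x k where eq: "C = frac x k" and cl: "x \<in> carrier M"
    by (metis localization_cases)
  show "\<zero>\<^bsub>?L\<^esub> \<oplus>\<^bsub>?L\<^esub> C = C"
    using cl by (simp add: eq add_localization zero_localization)
  have "frac (\<ominus>\<^bsub>M\<^esub> x) k \<oplus>\<^bsub>?L\<^esub> C = \<zero>\<^bsub>?L\<^esub>"
    using cl frac_zero by (simp add: eq add_localization zero_localization pw_minus M.l_neg)
  then show "\<exists>D\<in>carrier ?L. D \<oplus>\<^bsub>?L\<^esub> C = \<zero>\<^bsub>?L\<^esub>"
    using cl by (intro bexI[of _ "frac (\<ominus>\<^bsub>M\<^esub> x) k"]) auto
qed (simp add: zero_localization)

lemma module_localization: "module R (gr_localization R M f \<delta>)"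
proof (rule moduleI[OF R.is_cring abelian_group_localization])
  let ?L = "gr_localization R M f \<delta>"
  fix a b C D assume ab: "a \<in> carrier R" "b \<in> carrier R" and "C \<in> carrier ?L" "D \<in> carrier ?L"
  then obtain x k y l where eq: "C = frac x k" "D = frac y l"
    and cl: "x \<in> carrier M" "y \<in> carrier M"
    by (metis localization_cases)
  show "a \<odot>\<^bsub>?L\<^esub> (C \<oplus>\<^bsub>?L\<^esub> D) = a \<odot>\<^bsub>?L\<^esub> C \<oplus>\<^bsub>?L\<^esub> a \<odot>\<^bsub>?L\<^esub> D"
    using ab cl by (simp add: eq add_localization smult_localization pw_smult smult_r_distr)
next
  let ?L = "gr_localization R M f \<delta>"
  fix a b C assume ab: "a \<in> carrier R" "b \<in> carrier R" and "C \<in> carrier ?L"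
  then obtain x k where eq: "C = frac x k" and cl: "x \<in> carrier M"
    by (metis localization_cases)
  have "frac (pw k ((a \<oplus> b) \<odot>\<^bsub>M\<^esub> x)) (k + k) = frac ((a \<oplus> b) \<odot>\<^bsub>M\<^esub> x) k"
    using ab cl by (intro frac_scale) auto
  then show "(a \<oplus> b) \<odot>\<^bsub>?L\<^esub> C = a \<odot>\<^bsub>?L\<^esub> C \<oplus>\<^bsub>?L\<^esub> b \<odot>\<^bsub>?L\<^esub> C"
    using ab cl by (simp add: eq add_localization smult_localization smult_l_distr pw_add)
  show "a \<otimes> b \<odot>\<^bsub>?L\<^esub> C = a \<odot>\<^bsub>?L\<^esub> (b \<odot>\<^bsub>?L\<^esub> C)"
    using ab cl by (simp add: eq smult_localization smult_assoc1)
qed (auto elim!: localization_cases simp: smult_localization)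

lemma localization_unit_injective:
  assumes "C \<in> carrier (gr_localization R M f \<delta>)"
    and "f \<odot>\<^bsub>gr_localization R M f \<delta>\<^esub> C = \<zero>\<^bsub>gr_localization R M f \<delta>\<^esub>"
  shows "C = \<zero>\<^bsub>gr_localization R M f \<delta>\<^esub>"
proof -
  obtain x k where eq: "C = frac x k" and cl: "x \<in> carrier M"
    using assms(1) by (rule localization_cases)
  then have "frac (f \<odot>\<^bsub>M\<^esub> x) k = frac \<zero>\<^bsub>M\<^esub> 0"
    using assms(2) by (simp add: smult_localization zero_localization)
  then obtain t where "pw t (f \<odot>\<^bsub>M\<^esub> x) = \<zero>\<^bsub>M\<^esub>"
    using cl by (auto simp: frac_eq_iff)
  then have "pw (Suc t + 0) x = pw (Suc t + k) \<zero>\<^bsub>M\<^esub>"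
    using cl by (simp add: pw_Suc)
  then show ?thesis
    unfolding eq zero_localization using cl by (subst frac_eq_iff) blast+
qed

lemma localization_unit_surjective:
  assumes "C \<in> carrier (gr_localization R M f \<delta>)"
  shows "\<exists>D\<in>carrier (gr_localization R M f \<delta>). f \<odot>\<^bsub>gr_localization R M f \<delta>\<^esub> D = C"
proof -
  obtain x k where eq: "C = frac x k" and cl: "x \<in> carrier M"
    using assms(1) by (rule localization_cases)
  have "f \<odot>\<^bsub>M\<^esub> x = pw 1 x"
    using cl by (simp add: pw_def)
  then have "f \<odot>\<^bsub>gr_localization R M f \<delta>\<^esub> frac x (k + 1) = C"
    using cl frac_scale[OF cl, of 1 k] by (simp add: eq smult_localization)
  then show ?thesis
    using cl by (intro bexI[of _ "frac x (k + 1)"]) auto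
qed

end

definition loc_projection :: "('a, 'g::ab_group_add) gr_ring \<Rightarrow> ('a, 'b, 'g) gr_module \<Rightarrow> 'a \<Rightarrow> 'g \<Rightarrow>
    ('g \<Rightarrow> 'b \<Rightarrow> 'b) \<Rightarrow> 'g \<Rightarrow> ('b \<times> nat) set \<Rightarrow> ('b \<times> nat) set" where
  "loc_projection R M f \<delta> \<pi> e C =
     (\<Union>(x, k)\<in>C. frac_rel R M f `` {(\<pi> (e + (\<Sum>i<k. \<delta>)) x, k)})"

locale graded_localization = localization R M f
  for R :: "('a, 'g::ab_group_add) gr_ring" (structure)
    and M :: "('a, 'b, 'g) gr_module" (structure) and f +
  fixes \<delta> :: 'g and \<pi> :: "'g \<Rightarrow> 'b \<Rightarrow> 'b"
  assumes projection: "gr_projection M \<pi>"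
    and projection_f: "\<And>e x. x \<in> carrier M \<Longrightarrow> \<pi> (e + \<delta>) (f \<odot>\<^bsub>M\<^esub> x) = f \<odot>\<^bsub>M\<^esub> \<pi> e x"
begin

lemma projection_additive: "additive M M (\<pi> e)"
  and hcomp_closed: "x \<in> hcomp M e \<Longrightarrow> x \<in> carrier M"
  and projection_in: "x \<in> carrier M \<Longrightarrow> \<pi> e x \<in> hcomp M e"
  and projection_id: "x \<in> hcomp M e \<Longrightarrow> \<pi> e x = x"
  using projection unfolding gr_projection_def by blast+

lemma projection_closed [simp]: "x \<in> carrier M \<Longrightarrow> \<pi> e x \<in> carrier M"
  using projection_in hcomp_closed by blast

lemma projection_pw: "x \<in> carrier M \<Longrightarrow> \<pi> (e + (\<Sum>i<k. \<delta>)) (pw k x) = pw k (\<pi> e x)"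
proof (induction k arbitrary: e x)
  case (Suc k)
  have "\<pi> (e + (\<Sum>i<Suc k. \<delta>)) (pw (Suc k) x) = \<pi> (e + \<delta> + (\<Sum>i<k. \<delta>)) (pw k (f \<odot>\<^bsub>M\<^esub> x))"
    using Suc.prems by (simp add: pw_Suc ac_simps)
  also have "\<dots> = pw k (\<pi> (e + \<delta>) (f \<odot>\<^bsub>M\<^esub> x))"
    using Suc.prems by (intro Suc.IH) simp
  finally show ?case
    using Suc.prems by (simp add: projection_f pw_Suc)
qed simp

lemma loc_projection_frac:
  assumes x: "x \<in> carrier M"
  shows "loc_projection R M f \<delta> \<pi> e (frac x k) = frac (\<pi> (e + (\<Sum>i<k. \<delta>)) x) k"
proof -
  have "loc_projection R M f \<delta> \<pi> e (frac x k) = (\<Union>(x, k)\<in>frac x k. frac (\<pi> (e + (\<Sum>i<k. \<delta>)) x) k)"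
    by (simp add: loc_projection_def frac_def)
  also have "\<dots> = frac (\<pi> (e + (\<Sum>i<k. \<delta>)) x) k"
  proof (rule UN_frac[OF x])
    fix y l assume y: "y \<in> carrier M" and "frac y l = frac x k"
    then obtain t where t: "pw (t + k) y = pw (t + l) x"
      using x by (auto simp: frac_eq_iff)
    have deg: "(\<Sum>i<a + b. \<delta>) = (\<Sum>i<a. \<delta>) + (\<Sum>i<b. \<delta>)" for a b :: nat
      by (induction b) (simp_all add: ac_simps)
    have "pw (t + k) (\<pi> (e + (\<Sum>i<l. \<delta>)) y) = \<pi> (e + (\<Sum>i<l. \<delta>) + (\<Sum>i<t + k. \<delta>)) (pw (t + k) y)"
      using y by (simp add: projection_pw)
    also have "\<dots> = \<pi> (e + (\<Sum>i<k. \<delta>) + (\<Sum>i<t + l. \<delta>)) (pw (t + l) x)"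
      unfolding t by (simp add: deg ac_simps)
    also have "\<dots> = pw (t + l) (\<pi> (e + (\<Sum>i<k. \<delta>)) x)"
      using x by (simp add: projection_pw)
    finally show "frac (\<pi> (e + (\<Sum>i<l. \<delta>)) y) l = frac (\<pi> (e + (\<Sum>i<k. \<delta>)) x) k"
      using x y by (subst frac_eq_iff) auto
  qed
  finally show ?thesis .
qed

lemma hcomp_localization:
  "hcomp (gr_localization R M f \<delta>) e = {frac x k | x k. x \<in> hcomp M (e + (\<Sum>i<k. \<delta>))}"
  by (simp add: gr_localization_def frac_def)

lemma loc_projection:
  "gr_projection (gr_localization R M f \<delta>) (loc_projection R M f \<delta> \<pi>)"
  unfolding gr_projection_def
proof (intro allI conjI ballI subsetI)
  let ?L = "gr_localization R M f \<delta>" and ?\<pi> = "loc_projection R M f \<delta> \<pi>"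
  fix e
  show "additive ?L ?L (?\<pi> e)"
    unfolding additive_def
  proof (intro conjI ballI funcsetI)
    fix C D assume "C \<in> carrier ?L" "D \<in> carrier ?L"
    then obtain x k y l where eq: "C = frac x k" "D = frac y l"
      and cl: "x \<in> carrier M" "y \<in> carrier M"
      by (metis localization_cases)
    have deg: "(\<Sum>i<a + b. \<delta>) = (\<Sum>i<a. \<delta>) + (\<Sum>i<b. \<delta>)" for a b :: nat
      by (induction b) (simp_all add: ac_simps)
    have "\<pi> (e + (\<Sum>i<k + l. \<delta>)) (pw l x) = pw l (\<pi> (e + (\<Sum>i<k. \<delta>)) x)"
      "\<pi> (e + (\<Sum>i<k + l. \<delta>)) (pw k y) = pw k (\<pi> (e + (\<Sum>i<l. \<delta>)) y)"
      using cl projection_pw[of x "e + (\<Sum>i<k. \<delta>)" l] projection_pw[of y "e + (\<Sum>i<l. \<delta>)" k]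
      by (simp_all add: deg ac_simps)
    then show "?\<pi> e (C \<oplus>\<^bsub>?L\<^esub> D) = ?\<pi> e C \<oplus>\<^bsub>?L\<^esub> ?\<pi> e D"
      using cl additive_add[OF projection_additive]
      by (simp add: eq loc_projection_frac add_localization)
  qed (auto elim!: localization_cases simp: loc_projection_frac)
  show "C \<in> carrier ?L" if "C \<in> hcomp ?L e" for C
    using that hcomp_closed by (auto simp: hcomp_localization)
  show "?\<pi> e C \<in> hcomp ?L e" if "C \<in> carrier ?L" for C
  proof -
    obtain x k where "C = frac x k" "x \<in> carrier M"
      using \<open>C \<in> carrier ?L\<close> by (rule localization_cases)
    then show ?thesis
      using projection_in unfolding hcomp_localization by (simp add: loc_projection_frac) blast
  qed
  show "?\<pi> e C = C" if "C \<in> hcomp ?L e" for C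
    using that hcomp_closed projection_id by (auto simp: hcomp_localization loc_projection_frac)
qed

lemma loc_projection_smult:
  assumes r: "r \<in> carrier R" "\<And>e x. x \<in> carrier M \<Longrightarrow> \<pi> (e + \<alpha>) (r \<odot>\<^bsub>M\<^esub> x) = r \<odot>\<^bsub>M\<^esub> \<pi> e x"
    and C: "C \<in> carrier (gr_localization R M f \<delta>)"
  shows "loc_projection R M f \<delta> \<pi> (e + \<alpha>) (r \<odot>\<^bsub>gr_localization R M f \<delta>\<^esub> C)
    = r \<odot>\<^bsub>gr_localization R M f \<delta>\<^esub> loc_projection R M f \<delta> \<pi> e C"
proof -
  obtain x k where eq: "C = frac x k" and x: "x \<in> carrier M"
    using C by (rule localization_cases)
  have "\<pi> (e + \<alpha> + (\<Sum>i<k. \<delta>)) (r \<odot>\<^bsub>M\<^esub> x) = r \<odot>\<^bsub>M\<^esub> \<pi> (e + (\<Sum>i<k. \<delta>)) x"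
    using r(2)[OF x, of "e + (\<Sum>i<k. \<delta>)"] by (simp add: ac_simps)
  then show ?thesis
    using x r(1) by (simp add: eq smult_localization loc_projection_frac)
qed

end

text \<open>
  The canonical map from the localization at \<open>f\<close> to the localization at \<open>g = f h\<close>: it sends
  \<open>x / f\<^sup>k\<close> to \<open>h\<^sup>k x / g\<^sup>k\<close>.
\<close>

definition loc_map :: "('a, 'g) gr_ring \<Rightarrow> ('a, 'b, 'g) gr_module \<Rightarrow> 'a \<Rightarrow> 'a \<Rightarrow>
    ('b \<times> nat) set \<Rightarrow> ('b \<times> nat) set" where
  "loc_map R M g h C = (\<Union>(x, k)\<in>C. frac_rel R M g `` {((h [^]\<^bsub>R\<^esub> k) \<odot>\<^bsub>M\<^esub> x, k)})"

locale localization_map = F: localization R M f + G: localization R M g + H: localization R M h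
  for R :: "('a, 'g::ab_group_add) gr_ring" (structure)
    and M :: "('a, 'b, 'g) gr_module" (structure) and f g h +
  assumes g: "g = f \<otimes> h"
begin

lemma pw_g: "y \<in> carrier M \<Longrightarrow> G.pw k y = F.pw k (H.pw k y)"
  unfolding G.pw_def F.pw_def H.pw_def by (simp add: g F.R.nat_pow_distrib F.smult_assoc1)

lemma pw_commute: "y \<in> carrier M \<Longrightarrow> F.pw k (H.pw l y) = H.pw l (F.pw k y)"
  unfolding H.pw_def by (simp add: F.pw_smult)

lemma loc_map_frac:
  assumes x: "x \<in> carrier M"
  shows "loc_map R M g h (F.frac x k) = G.frac (H.pw k x) k"
proof -
  have "loc_map R M g h (F.frac x k) = (\<Union>(x, k)\<in>F.frac x k. G.frac (H.pw k x) k)"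
    by (simp add: loc_map_def G.frac_def H.pw_def)
  also have "\<dots> = G.frac (H.pw k x) k"
  proof (rule F.UN_frac[OF x])
    fix y l assume y: "y \<in> carrier M" and "F.frac y l = F.frac x k"
    then obtain t where "F.pw (t + k) y = F.pw (t + l) x"
      using x by (auto simp: F.frac_eq_iff)
    then have "H.pw (t + k + l) (F.pw (t + k) y) = H.pw (t + l + k) (F.pw (t + l) x)"
      by (simp add: ac_simps)
    then have "G.pw (t + k) (H.pw l y) = G.pw (t + l) (H.pw k x)"
      using x y by (simp add: pw_g pw_commute H.pw_pw)
    then show "G.frac (H.pw l y) l = G.frac (H.pw k x) k"
      using x y by (subst G.frac_eq_iff) auto
  qed
  finally show ?thesis .
qed

lemma loc_map_linear:
  "R_linear R (gr_localization R M f \<delta>) (gr_localization R M g \<epsilon>) (loc_map R M g h)"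
  unfolding R_linear_def
proof (intro conjI ballI funcsetI)
  let ?L = "gr_localization R M f \<delta>" and ?L' = "gr_localization R M g \<epsilon>" and ?h = "loc_map R M g h"
  fix C assume C: "C \<in> carrier ?L"
  then obtain x k where eq: "C = F.frac x k" and x: "x \<in> carrier M"
    by (rule F.localization_cases)
  show "?h C \<in> carrier ?L'"
    using x by (simp add: eq loc_map_frac)
  show "?h (a \<odot>\<^bsub>?L\<^esub> C) = a \<odot>\<^bsub>?L'\<^esub> ?h C" if "a \<in> carrier R" for a
    using that x by (simp add: eq loc_map_frac F.smult_localization G.smult_localization H.pw_smult)
  fix D assume D: "D \<in> carrier ?L"
  then obtain y l where eq': "D = F.frac y l" and y: "y \<in> carrier M"
    by (rule F.localization_cases)
  show "?h (C \<oplus>\<^bsub>?L\<^esub> D) = ?h C \<oplus>\<^bsub>?L'\<^esub> ?h D"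
    using x y by (simp add: eq eq' loc_map_frac F.add_localization G.add_localization H.pw_add
        pw_g pw_commute H.pw_pw add.commute)
qed

end

lemma loc_map_projection:
  assumes "localization_map R M f g h" and F: "graded_localization R M f \<delta> \<pi>"
    and G: "graded_localization R M g (\<delta> + \<beta>) \<pi>" and H: "graded_localization R M h \<beta> \<pi>"
    and C: "C \<in> carrier (gr_localization R M f \<delta>)"
  shows "loc_map R M g h (loc_projection R M f \<delta> \<pi> e C)
    = loc_projection R M g (\<delta> + \<beta>) \<pi> e (loc_map R M g h C)"
proof -
  interpret localization_map R M f g h by fact
  interpret F: graded_localization R M f \<delta> \<pi> by fact
  interpret G: graded_localization R M g "\<delta> + \<beta>" \<pi> by fact
  interpret H: graded_localization R M h \<beta> \<pi> by fact
  obtain x k where eq: "C = F.frac x k" and x: "x \<in> carrier M"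
    using C by (rule F.localization_cases)
  have "e + (\<Sum>i<k. \<delta> + \<beta>) = e + (\<Sum>i<k. \<delta>) + (\<Sum>i<k. \<beta>)"
    by (simp only: sum.distrib add.assoc)
  then have "\<pi> (e + (\<Sum>i<k. \<delta> + \<beta>)) (H.pw k x) = H.pw k (\<pi> (e + (\<Sum>i<k. \<delta>)) x)"
    using H.projection_pw[OF x, of "e + (\<Sum>i<k. \<delta>)" k] by (simp add: add.assoc)
  then show ?thesis
    using x by (simp add: eq F.loc_projection_frac loc_map_frac G.loc_projection_frac)
qed

section \<open>Products of graded modules\<close>

definition prod_module :: "'i set \<Rightarrow> ('i \<Rightarrow> ('a, 'b, 'g) gr_module) \<Rightarrow> ('a, 'i \<Rightarrow> 'b, 'g) gr_module" where
  "prod_module A L =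
     \<lparr>carrier = (\<Pi>\<^sub>E I\<in>A. carrier (L I)),
      monoid.mult = undefined, monoid.one = undefined,
      ring.zero = (\<lambda>I\<in>A. \<zero>\<^bsub>L I\<^esub>),
      ring.add = (\<lambda>c c'. \<lambda>I\<in>A. c I \<oplus>\<^bsub>L I\<^esub> c' I),
      module.smult = (\<lambda>a c. \<lambda>I\<in>A. a \<odot>\<^bsub>L I\<^esub> c I),
      hcomp = (\<lambda>\<gamma>. \<Pi>\<^sub>E I\<in>A. hcomp (L I) \<gamma>)\<rparr>"

lemma prod_module_simps [simp]:
  "carrier (prod_module A L) = (\<Pi>\<^sub>E I\<in>A. carrier (L I))"
  "\<zero>\<^bsub>prod_module A L\<^esub> = (\<lambda>I\<in>A. \<zero>\<^bsub>L I\<^esub>)"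
  "c \<oplus>\<^bsub>prod_module A L\<^esub> c' = (\<lambda>I\<in>A. c I \<oplus>\<^bsub>L I\<^esub> c' I)"
  "a \<odot>\<^bsub>prod_module A L\<^esub> c = (\<lambda>I\<in>A. a \<odot>\<^bsub>L I\<^esub> c I)"
  "hcomp (prod_module A L) \<gamma> = (\<Pi>\<^sub>E I\<in>A. hcomp (L I) \<gamma>)"
  by (simp_all add: prod_module_def)

lemma module_prod_module:
  assumes "cring R" and L: "\<And>I. I \<in> A \<Longrightarrow> module R (L I)"
  shows "module R (prod_module A L)"
proof (rule moduleI[OF \<open>cring R\<close>])
  have ab: "abelian_group (L I)" if "I \<in> A" for I
    using L[OF that] by (simp add: module_def)
  note ag = abelian_monoid.a_assoc[OF abelian_group.axioms(1)] abelian_monoid.a_comm[OF abelian_group.axioms(1)]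
    abelian_monoid.a_closed[OF abelian_group.axioms(1)] abelian_monoid.l_zero[OF abelian_group.axioms(1)]
    abelian_monoid.zero_closed[OF abelian_group.axioms(1)]
  show "abelian_group (prod_module A L)"
  proof (rule abelian_groupI)
    fix x assume x: "x \<in> carrier (prod_module A L)"
    then have xI: "x I \<in> carrier (L I)" if "I \<in> A" for I
      using that by auto
    have "(\<lambda>I\<in>A. \<ominus>\<^bsub>L I\<^esub> x I) \<oplus>\<^bsub>prod_module A L\<^esub> x = \<zero>\<^bsub>prod_module A L\<^esub>"
      using xI ab by (auto simp: abelian_group.l_neg intro!: restrict_ext)
    moreover have "(\<lambda>I\<in>A. \<ominus>\<^bsub>L I\<^esub> x I) \<in> carrier (prod_module A L)"
      using xI ab by (auto simp: abelian_group.a_inv_closed)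
    ultimately show "\<exists>y\<in>carrier (prod_module A L). y \<oplus>\<^bsub>prod_module A L\<^esub> x = \<zero>\<^bsub>prod_module A L\<^esub>"
      by blast
    have "\<zero>\<^bsub>L I\<^esub> \<oplus>\<^bsub>L I\<^esub> x I = x I" if "I \<in> A" for I
      using xI ab that by (intro abelian_monoid.l_zero[OF abelian_group.axioms(1)])
    then have "\<zero>\<^bsub>prod_module A L\<^esub> \<oplus>\<^bsub>prod_module A L\<^esub> x = restrict x A"
      by (auto intro!: restrict_ext simp del: PiE_restrict)
    then show "\<zero>\<^bsub>prod_module A L\<^esub> \<oplus>\<^bsub>prod_module A L\<^esub> x = x"
      using x by (simp add: PiE_restrict)
    fix y assume y: "y \<in> carrier (prod_module A L)"
    then have yI: "y I \<in> carrier (L I)" if "I \<in> A" for I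
      using that by auto
    show "x \<oplus>\<^bsub>prod_module A L\<^esub> y \<in> carrier (prod_module A L)"
      using xI yI ab by (auto simp: ag)
    show "x \<oplus>\<^bsub>prod_module A L\<^esub> y = y \<oplus>\<^bsub>prod_module A L\<^esub> x"
      using xI yI ab by (auto intro!: restrict_ext abelian_monoid.a_comm[OF abelian_group.axioms(1)])
    fix z assume z: "z \<in> carrier (prod_module A L)"
    then have zI: "z I \<in> carrier (L I)" if "I \<in> A" for I
      using that by auto
    show "(x \<oplus>\<^bsub>prod_module A L\<^esub> y) \<oplus>\<^bsub>prod_module A L\<^esub> z = x \<oplus>\<^bsub>prod_module A L\<^esub> (y \<oplus>\<^bsub>prod_module A L\<^esub> z)"
      using xI yI zI ab by (auto intro!: restrict_ext abelian_monoid.a_assoc[OF abelian_group.axioms(1)])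
  qed (use ab in \<open>auto simp: ag\<close>)
  fix a b x y assume ab: "a \<in> carrier R" "b \<in> carrier R"
    and x: "x \<in> carrier (prod_module A L)" and y: "y \<in> carrier (prod_module A L)"
  then have xI: "x I \<in> carrier (L I)" and yI: "y I \<in> carrier (L I)" if "I \<in> A" for I
    using that by auto
  show "a \<odot>\<^bsub>prod_module A L\<^esub> (x \<oplus>\<^bsub>prod_module A L\<^esub> y)
      = a \<odot>\<^bsub>prod_module A L\<^esub> x \<oplus>\<^bsub>prod_module A L\<^esub> a \<odot>\<^bsub>prod_module A L\<^esub> y"
    using xI yI ab by (auto intro!: restrict_ext module.smult_r_distr[OF L])
next
  fix a b x assume ab: "a \<in> carrier R" "b \<in> carrier R" and x: "x \<in> carrier (prod_module A L)"
  then have xI: "x I \<in> carrier (L I)" if "I \<in> A" for I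
    using that by auto
  show "a \<odot>\<^bsub>prod_module A L\<^esub> x \<in> carrier (prod_module A L)"
    using xI ab by (auto intro!: module.smult_closed[OF L])
  show "(a \<oplus>\<^bsub>R\<^esub> b) \<odot>\<^bsub>prod_module A L\<^esub> x
      = a \<odot>\<^bsub>prod_module A L\<^esub> x \<oplus>\<^bsub>prod_module A L\<^esub> b \<odot>\<^bsub>prod_module A L\<^esub> x"
    using xI ab by (auto intro!: restrict_ext module.smult_l_distr[OF L])
  show "(a \<otimes>\<^bsub>R\<^esub> b) \<odot>\<^bsub>prod_module A L\<^esub> x = a \<odot>\<^bsub>prod_module A L\<^esub> (b \<odot>\<^bsub>prod_module A L\<^esub> x)"
    using xI ab by (auto intro!: restrict_ext module.smult_assoc1[OF L])
next
  fix x assume x: "x \<in> carrier (prod_module A L)"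
  then have "\<one>\<^bsub>R\<^esub> \<odot>\<^bsub>prod_module A L\<^esub> x = restrict x A"
    by (auto intro!: restrict_ext module.smult_one[OF L] simp del: PiE_restrict)
  then show "\<one>\<^bsub>R\<^esub> \<odot>\<^bsub>prod_module A L\<^esub> x = x"
    using x by (simp add: PiE_restrict)
qed

lemma prod_module_component_linear:
  "I \<in> A \<Longrightarrow> R_linear R (prod_module A L) (L I) (\<lambda>c. c I)"
  by (auto simp: R_linear_def)

lemma R_linear_into_prod_module:
  assumes h: "\<And>I. I \<in> A \<Longrightarrow> R_linear R M (L I) (\<lambda>x. h x I)" and ext: "\<And>x. h x \<in> extensional A"
  shows "R_linear R M (prod_module A L) h"
proof -
  have "h x = (\<lambda>I\<in>A. h x I)" for x
    using ext[of x] by (simp add: extensional_restrict)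
  then have "h x = h' \<longleftrightarrow> (\<lambda>I\<in>A. h x I) = h'" for x h'
    by simp
  then show ?thesis
    using h ext unfolding R_linear_def by (auto simp: PiE_def Pi_iff intro!: restrict_ext)
qed

lemma gr_projection_prod_module:
  assumes "\<And>I. I \<in> A \<Longrightarrow> gr_projection (L I) (\<pi> I)"
  shows "gr_projection (prod_module A L) (\<lambda>e c. \<lambda>I\<in>A. \<pi> I e (c I))"
proof -
  have *: "additive (L I) (L I) (\<pi> I e)" "hcomp (L I) e \<subseteq> carrier (L I)"
    "\<And>x. x \<in> carrier (L I) \<Longrightarrow> \<pi> I e x \<in> hcomp (L I) e" "\<And>x. x \<in> hcomp (L I) e \<Longrightarrow> \<pi> I e x = x"
    if "I \<in> A" for I e
    using assms[OF that] unfolding gr_projection_def by blast+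
  show ?thesis
    unfolding gr_projection_def
  proof (intro allI conjI ballI)
    fix e
    show "additive (prod_module A L) (prod_module A L) (\<lambda>c. \<lambda>I\<in>A. \<pi> I e (c I))"
      unfolding additive_def
    proof (intro conjI funcsetI ballI)
      fix x assume "x \<in> carrier (prod_module A L)"
      then have xI: "x I \<in> carrier (L I)" if "I \<in> A" for I
        using that by auto
      then show "(\<lambda>I\<in>A. \<pi> I e (x I)) \<in> carrier (prod_module A L)"
        by (auto intro!: additive_closed[OF *(1)])
      fix y assume "y \<in> carrier (prod_module A L)"
      then have yI: "y I \<in> carrier (L I)" if "I \<in> A" for I
        using that by auto
      then show "(\<lambda>I\<in>A. \<pi> I e ((x \<oplus>\<^bsub>prod_module A L\<^esub> y) I))
          = (\<lambda>I\<in>A. \<pi> I e (x I)) \<oplus>\<^bsub>prod_module A L\<^esub> (\<lambda>I\<in>A. \<pi> I e (y I))"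
        using xI by (auto intro!: restrict_ext additive_add[OF *(1)])
    qed
    show "hcomp (prod_module A L) e \<subseteq> carrier (prod_module A L)"
      using *(2) by (auto intro!: PiE_mono)
    show "(\<lambda>I\<in>A. \<pi> I e (x I)) \<in> hcomp (prod_module A L) e" if "x \<in> carrier (prod_module A L)" for x
      using that by (auto intro!: *(3))
    show "(\<lambda>I\<in>A. \<pi> I e (x I)) = x" if "x \<in> hcomp (prod_module A L) e" for x
    proof -
      have "(\<lambda>I\<in>A. \<pi> I e (x I)) = restrict x A"
        using that by (auto intro!: restrict_ext *(4) simp del: PiE_restrict)
      also have "\<dots> = x"
        using that by (simp add: PiE_restrict)
      finally show ?thesis .
    qed
  qed
qed

lemma kdiff_prod_module:
  assumes "cring R" "\<And>I. I \<in> A \<Longrightarrow> module R (L I)" "\<And>j. j < n \<Longrightarrow> v j \<in> carrier R"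
    and c: "\<And>J. c J \<in> carrier (prod_module A L)" and I: "I \<in> A"
  shows "kdiff R (prod_module A L) v n c J I = kdiff R (L I) v n (\<lambda>J. c J I) J"
proof -
  interpret P: module R "prod_module A L"
    using assms by (intro module_prod_module)
  interpret P: koszul R "prod_module A L" v n
    using assms(3) by unfold_locales
  show ?thesis
    using kdiff_natural[OF P.koszul_axioms assms(2)[OF I] prod_module_component_linear[OF I] c] .
qed

text \<open>
  A product is treated factor by factor, because in the Cech complex the element that acts
  bijectively depends on the factor.
\<close>

lemma koszul_exact_prod_module:
  assumes "cring R" "\<And>I. I \<in> A \<Longrightarrow> module R (L I)" "\<And>j. j < n \<Longrightarrow> v j \<in> carrier R"
    and exact: "\<And>I c. I \<in> A \<Longrightarrow> (\<And>J. c J \<in> carrier (L I)) \<Longrightarrow> (\<And>J. kdiff R (L I) v n c J = \<zero>\<^bsub>L I\<^esub>) \<Longrightarrow>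
      \<exists>b. (\<forall>J. b J \<in> carrier (L I)) \<and> (\<forall>J. kdiff R (L I) v n b J = c J)"
    and c: "\<And>J. c J \<in> carrier (prod_module A L)"
    and cycle: "\<And>J. kdiff R (prod_module A L) v n c J = \<zero>\<^bsub>prod_module A L\<^esub>"
  shows "\<exists>b. (\<forall>J. b J \<in> carrier (prod_module A L)) \<and> (\<forall>J. kdiff R (prod_module A L) v n b J = c J)"
proof -
  interpret P: module R "prod_module A L"
    using assms by (intro module_prod_module)
  interpret P: koszul R "prod_module A L" v n
    using assms(3) by unfold_locales
  have "\<exists>b. (\<forall>J. b J \<in> carrier (L I)) \<and> (\<forall>J. kdiff R (L I) v n b J = c J I)" if I: "I \<in> A" for I
  proof (rule exact[OF I])
    show "c J I \<in> carrier (L I)" for J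
      using c[of J] I by auto
    show "kdiff R (L I) v n (\<lambda>J. c J I) J = \<zero>\<^bsub>L I\<^esub>" for J
      using kdiff_prod_module[of R A L n v c I J] assms(1-3) c I cycle[of J] by simp
  qed
  then obtain b where b: "\<And>I J. I \<in> A \<Longrightarrow> b I J \<in> carrier (L I)"
    "\<And>I J. I \<in> A \<Longrightarrow> kdiff R (L I) v n (b I) J = c J I"
    by metis
  define b' where "b' J = (\<lambda>I\<in>A. b I J)" for J
  have b': "b' J \<in> carrier (prod_module A L)" for J
    using b(1) by (auto simp: b'_def)
  have "kdiff R (prod_module A L) v n b' J = c J" for J
  proof (rule PiE_ext)
    show "kdiff R (prod_module A L) v n b' J \<in> (\<Pi>\<^sub>E I\<in>A. carrier (L I))"
      using P.kdiff_closed[OF b'] by simp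
    show "c J \<in> (\<Pi>\<^sub>E I\<in>A. carrier (L I))"
      using c by simp
    fix I assume I: "I \<in> A"
    have "kdiff R (prod_module A L) v n b' J I = kdiff R (L I) v n (\<lambda>J. b' J I) J"
      by (rule kdiff_prod_module[OF assms(1-3) b' I])
    also have "(\<lambda>J. b' J I) = b I"
      using I by (simp add: b'_def)
    finally show "kdiff R (prod_module A L) v n b' J I = c J I"
      using b(2)[OF I] by simp
  qed
  then show ?thesis
    using b' by blast
qed

section \<open>The Cech complex\<close>

lemma cech_module_eq: "cech_module R M f \<delta> r p = prod_module (cech_index r p) (cech_loc R M f \<delta>)"
  by (simp add: cech_module_def prod_module_def)

lemma cech_index_subset: "I \<in> cech_index r p \<Longrightarrow> I \<subseteq> {..<r}"
  by (simp add: cech_index_def)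

lemma cech_index_finite: "I \<in> cech_index r p \<Longrightarrow> finite I"
  by (rule finite_subset[OF cech_index_subset]) simp_all

lemma cech_index_delete:
  assumes "J \<in> cech_index r (p + 1)" "j \<in> J"
  shows "J - {j} \<in> cech_index r p"
proof -
  have "Suc (card (J - {j})) = card J"
    by (rule card_Suc_Diff1[OF cech_index_finite[OF assms(1)] assms(2)])
  moreover have "J \<subseteq> {..<r}" "int (card J) = p + 1"
    using assms(1) by (simp_all add: cech_index_def)
  ultimately have "int (card (J - {j})) = p" "J - {j} \<subseteq> {..<r}"
    by auto
  then show ?thesis
    by (simp add: cech_index_def)
qed

lemma cech_restrict_eq: "cech_restrict R M f J j = loc_map R M (\<Otimes>\<^bsub>R\<^esub>i\<in>J. f i) (f j)"
  by (rule ext) (simp add: cech_restrict_def loc_map_def)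

lemma (in cring) ksign_swap_delete_both:
  assumes "j \<in> J" "k \<in> J" "j \<noteq> k"
  shows "ksign R j J \<otimes> ksign R k (J - {j}) = \<ominus> (ksign R k J \<otimes> ksign R j (J - {k}))"
proof -
  have sets: "insert k (J - {j} - {k}) = J - {j}" "insert j (J - {j} - {k}) = J - {k}"
    using assms by auto
  have K: "J - {j} - {k} = J - {k} - {j}"
    by auto
  have "ksign R j (J - {j} - {k}) \<otimes> ksign R k (J - {k}) = \<ominus> (ksign R k (J - {j} - {k}) \<otimes> ksign R j (J - {j}))"
    using ksign_swap[of j k "J - {j} - {k}"] assms(3) unfolding sets by blast
  moreover have "ksign R j (J - {j} - {k}) = ksign R j (J - {k})"
    unfolding K by (rule ksign_delete_self)
  moreover have "ksign R k (J - {j} - {k}) = ksign R k (J - {j})"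
    by (rule ksign_delete_self)
  ultimately have "ksign R j (J - {k}) \<otimes> ksign R k J = \<ominus> (ksign R k (J - {j}) \<otimes> ksign R j J)"
    by simp
  then have "ksign R k J \<otimes> ksign R j (J - {k}) = \<ominus> (ksign R j J \<otimes> ksign R k (J - {j}))"
    using m_comm[OF ksign_closed ksign_closed, of j "J - {k}" k J]
      m_comm[OF ksign_closed ksign_closed, of k "J - {j}" j J] by simp
  then show ?thesis
    by simp
qed

locale cech = module R M
  for R :: "('a, 'g::ab_group_add) gr_ring" (structure)
    and M :: "('a, 'b, 'g) gr_module" (structure) +
  fixes f :: "nat \<Rightarrow> 'a" and \<delta> :: "nat \<Rightarrow> 'g" and r :: nat and \<pi> :: "'g \<Rightarrow> 'b \<Rightarrow> 'b"
  assumes f_closed: "\<And>i. i < r \<Longrightarrow> f i \<in> carrier R"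
    and projection: "gr_projection M \<pi>"
    and projection_f: "\<And>i e x. i < r \<Longrightarrow> x \<in> carrier M \<Longrightarrow> \<pi> (e + \<delta> i) (f i \<odot>\<^bsub>M\<^esub> x) = f i \<odot>\<^bsub>M\<^esub> \<pi> e x"
begin

abbreviation fprod :: "nat set \<Rightarrow> 'a" where
  "fprod I \<equiv> (\<Otimes>\<^bsub>R\<^esub>i\<in>I. f i)"

abbreviation L where "L \<equiv> cech_loc R M f \<delta>"

abbreviation C where "C \<equiv> cech_module R M f \<delta> r"

abbreviation rho where "rho \<equiv> cech_restrict R M f"

abbreviation lpi where "lpi I \<equiv> loc_projection R M (fprod I) (\<Sum>i\<in>I. \<delta> i) \<pi>"

lemma fprod_closed: "I \<subseteq> {..<r} \<Longrightarrow> fprod I \<in> carrier R"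
  using f_closed by (intro R.finprod_closed) auto

lemma fprod_delete:
  assumes "J \<subseteq> {..<r}" "j \<in> J"
  shows "fprod J = fprod (J - {j}) \<otimes> f j"
proof -
  have "finite J"
    using assms finite_subset by auto
  then have "fprod (insert j (J - {j})) = f j \<otimes> fprod (J - {j})"
    using assms f_closed by (intro R.finprod_insert) auto
  then show ?thesis
    using assms R.m_comm[OF f_closed[of j] fprod_closed[of "J - {j}"]] by (auto simp: insert_absorb)
qed

lemma projection_fprod:
  assumes "I \<subseteq> {..<r}" "x \<in> carrier M"
  shows "\<pi> (e + (\<Sum>i\<in>I. \<delta> i)) (fprod I \<odot>\<^bsub>M\<^esub> x) = fprod I \<odot>\<^bsub>M\<^esub> \<pi> e x"
proof -
  have pc: "\<pi> e x \<in> carrier M" if "x \<in> carrier M" for e x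
    using projection that unfolding gr_projection_def by blast
  have "finite I"
    using assms(1) finite_subset by blast
  then show ?thesis
    using assms
  proof (induction I arbitrary: e x rule: finite_induct)
    case empty
    then show ?case
      using pc by simp
  next
    case (insert i I)
    then have i: "i < r" "f i \<in> carrier R" "fprod I \<in> carrier R"
      using f_closed fprod_closed by auto
    have prod: "fprod (insert i I) = fprod I \<otimes> f i"
      using fprod_delete[of "insert i I" i] insert by simp
    have "\<pi> (e + (\<Sum>i\<in>insert i I. \<delta> i)) (fprod (insert i I) \<odot>\<^bsub>M\<^esub> x)
        = \<pi> (e + \<delta> i + (\<Sum>i\<in>I. \<delta> i)) (fprod I \<odot>\<^bsub>M\<^esub> (f i \<odot>\<^bsub>M\<^esub> x))"
      using insert i by (simp add: prod smult_assoc1 add.assoc)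
    also have "\<dots> = fprod I \<odot>\<^bsub>M\<^esub> \<pi> (e + \<delta> i) (f i \<odot>\<^bsub>M\<^esub> x)"
      using insert i by simp
    also have "\<dots> = fprod (insert i I) \<odot>\<^bsub>M\<^esub> \<pi> e x"
      using insert i pc by (simp add: projection_f prod smult_assoc1)
    finally show ?case .
  qed
qed

lemma localization_fprod:
  assumes "I \<subseteq> {..<r}" shows "localization R M (fprod I)"
  by unfold_locales (rule fprod_closed[OF assms])

lemma graded_localization_fprod:
  assumes "I \<subseteq> {..<r}" shows "graded_localization R M (fprod I) (\<Sum>i\<in>I. \<delta> i) \<pi>"
  by unfold_locales (simp_all add: fprod_closed[OF assms] projection projection_fprod[OF assms])

lemma localization_map_fprod:
  assumes "J \<subseteq> {..<r}" "j \<in> J"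
  shows "localization_map R M (fprod (J - {j})) (fprod J) (f j)"
proof -
  have "J - {j} \<subseteq> {..<r}" "j < r"
    using assms by auto
  then show ?thesis
    by unfold_locales (simp_all add: fprod_closed assms f_closed fprod_delete[OF assms])
qed

lemma module_L: "I \<subseteq> {..<r} \<Longrightarrow> module R (L I)"
  unfolding cech_loc_def by (intro localization.module_localization localization_fprod)

lemma module_C: "module R (C p)"
  unfolding cech_module_eq using cech_index_subset
  by (intro module_prod_module module_L R.is_cring)

lemma rho_linear: "J \<subseteq> {..<r} \<Longrightarrow> j \<in> J \<Longrightarrow> R_linear R (L (J - {j})) (L J) (rho J j)"
  unfolding cech_loc_def cech_restrict_eq
  by (intro localization_map.loc_map_linear localization_map_fprod)

lemma rho_closed:
  "J \<subseteq> {..<r} \<Longrightarrow> j \<in> J \<Longrightarrow> x \<in> carrier (L (J - {j})) \<Longrightarrow> rho J j x \<in> carrier (L J)"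
  by (rule additive_closed[OF R_linear_additive[OF rho_linear]])

lemma rho_projection:
  assumes J: "J \<subseteq> {..<r}" "j \<in> J" and x: "x \<in> carrier (L (J - {j}))"
  shows "rho J j (lpi (J - {j}) e x) = lpi J e (rho J j x)"
proof -
  have sum: "(\<Sum>i\<in>J. \<delta> i) = (\<Sum>i\<in>J - {j}. \<delta> i) + \<delta> j"
    using J finite_subset[of J "{..<r}"] by (simp add: sum.remove[of J j] add.commute)
  have "graded_localization R M (f j) (\<delta> j) \<pi>"
    using J f_closed projection projection_f by unfold_locales auto
  then show ?thesis
    unfolding sum cech_restrict_eq
    using J graded_localization_fprod[of J] graded_localization_fprod[of "J - {j}"] x
    by (intro loc_map_projection localization_map_fprod) (auto simp: sum cech_loc_def)
qed

lemma rho_commute: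
  assumes J: "J \<subseteq> {..<r}" "j \<in> J" "k \<in> J" "j \<noteq> k" and x: "x \<in> carrier (L (J - {j} - {k}))"
  shows "rho J j (rho (J - {j}) k x) = rho J k (rho (J - {k}) j x)"
proof -
  have eq: "J - {k} - {j} = J - {j} - {k}" by auto
  interpret A: localization_map R M "fprod (J - {j})" "fprod J" "f j"
    using J by (intro localization_map_fprod)
  interpret B: localization_map R M "fprod (J - {k})" "fprod J" "f k"
    using J by (intro localization_map_fprod)
  interpret A': localization_map R M "fprod (J - {j} - {k})" "fprod (J - {j})" "f k"
    using J by (intro localization_map_fprod) auto
  interpret B': localization_map R M "fprod (J - {j} - {k})" "fprod (J - {k})" "f j"
    using J localization_map_fprod[of "J - {k}" j] unfolding eq by auto
  obtain y l where "x = A'.F.frac y l" "y \<in> carrier M"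
    using x unfolding cech_loc_def by (rule A'.F.localization_cases)
  then show ?thesis
    unfolding cech_restrict_eq
    by (simp add: A'.loc_map_frac B'.loc_map_frac A.loc_map_frac B.loc_map_frac)
      (simp add: A.H.pw_def B.H.pw_def B.H.pw_smult[unfolded B.H.pw_def])
qed

lemma cech_component:
  assumes "c \<in> carrier (C p)" "J \<in> cech_index r (p + 1)" "j \<in> J"
  shows "c (J - {j}) \<in> carrier (L (J - {j}))"
proof -
  have "c \<in> (\<Pi>\<^sub>E I\<in>cech_index r p. carrier (L I))"
    using assms(1) by (simp add: cech_module_eq)
  then show ?thesis
    using cech_index_delete[OF assms(2,3)] by (rule PiE_mem)
qed

lemma cech_term_closed:
  assumes "c \<in> carrier (C p)" "J \<in> cech_index r (p + 1)" "j \<in> J"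
  shows "rho J j (c (J - {j})) \<in> carrier (L J)"
  using assms by (intro rho_closed cech_component cech_index_subset)

abbreviation D where "D \<equiv> cech_diff R M f \<delta> r"

lemma cech_diff_apply:
  assumes c: "c \<in> carrier (C p)" and J: "J \<in> cech_index r (p + 1)"
  shows "D p c J = (\<Oplus>\<^bsub>L J\<^esub>j\<in>J. ksign R j J \<odot>\<^bsub>L J\<^esub> rho J j (c (J - {j})))"
proof -
  interpret L: module R "L J"
    using J cech_index_subset by (intro module_L)
  have "rho J j (c (J - {j})) \<in> carrier (L J)" if "j \<in> J" for j
    by (rule cech_term_closed[OF c J that])
  then have "(\<Oplus>\<^bsub>L J\<^esub>j\<in>J. if even (card {i \<in> J. i < j}) then rho J j (c (J - {j}))
      else \<ominus>\<^bsub>L J\<^esub> rho J j (c (J - {j})))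
    = (\<Oplus>\<^bsub>L J\<^esub>j\<in>J. ksign R j J \<odot>\<^bsub>L J\<^esub> rho J j (c (J - {j})))"
    by (intro L.M.finsum_cong') (simp_all add: ksign_def L.smult_l_minus)
  then show ?thesis
    unfolding cech_diff_def using J by simp
qed

lemma cech_diff_linear: "R_linear R (C p) (C (p + 1)) (D p)"
  unfolding cech_module_eq[of R M f \<delta> r "p + 1"]
proof (rule R_linear_into_prod_module)
  fix J assume J: "J \<in> cech_index r (p + 1)"
  note sub = cech_index_subset[OF J]
  have "R_linear R (C p) (L J) (\<lambda>c. \<Oplus>\<^bsub>L J\<^esub>j\<in>J. ksign R j J \<odot>\<^bsub>L J\<^esub> rho J j (c (J - {j})))"
  proof (rule R_linear_scaled_finsum[OF module_C module_L[OF sub] _ _ cech_index_finite[OF J]])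
    fix j assume j: "j \<in> J"
    have "R_linear R (C p) (L (J - {j})) (\<lambda>c. c (J - {j}))"
      unfolding cech_module_eq by (rule prod_module_component_linear[OF cech_index_delete[OF J j]])
    then show "R_linear R (C p) (L J) (\<lambda>c. rho J j (c (J - {j})))"
      using rho_linear[OF sub j] by (rule R_linear_comp)
  qed simp
  then show "R_linear R (C p) (L J) (\<lambda>c. D p c J)"
    by (rule R_linear_cong[OF module_C]) (rule cech_diff_apply[OF _ J])
qed (simp add: cech_diff_def)

lemma cech_diff_closed: "c \<in> carrier (C p) \<Longrightarrow> D p c \<in> carrier (C (p + 1))"
  by (rule additive_closed[OF R_linear_additive[OF cech_diff_linear]])

text \<open>
  Localizing at \<open>f j\<close> and \<open>f k\<close> in either order gives the same map, whereas the two signs are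
  opposite.
\<close>

lemma cech_diff_diff:
  assumes c: "c \<in> carrier (C p)"
  shows "D (p + 1) (D p c) = \<zero>\<^bsub>C (p + 1 + 1)\<^esub>"
proof (rule ext)
  fix J
  show "D (p + 1) (D p c) J = \<zero>\<^bsub>C (p + 1 + 1)\<^esub> J"
  proof (cases "J \<in> cech_index r (p + 1 + 1)")
    case J: True
    note sub = cech_index_subset[OF J]
    interpret L: module R "L J"
      using sub by (rule module_L)
    let ?t = "\<lambda>j k. (ksign R j J \<otimes> ksign R k (J - {j})) \<odot>\<^bsub>L J\<^esub> rho J j (rho (J - {j}) k (c (J - {j} - {k})))"
    have c2: "c (J - {j} - {k}) \<in> carrier (L (J - {j} - {k}))" if "j \<in> J" "k \<in> J" "j \<noteq> k" for j k
      using cech_component[OF c cech_index_delete[OF J]] that by simp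
    have rr: "rho J j (rho (J - {j}) k (c (J - {j} - {k}))) \<in> carrier (L J)"
      if "j \<in> J" "k \<in> J" "j \<noteq> k" for j k
      using that sub c2 by (intro rho_closed) auto
    have "D (p + 1) (D p c) J = (\<Oplus>\<^bsub>L J\<^esub>j\<in>J. ksign R j J \<odot>\<^bsub>L J\<^esub> rho J j (D p c (J - {j})))"
      by (rule cech_diff_apply[OF cech_diff_closed[OF c] J])
    also have "\<dots> = (\<Oplus>\<^bsub>L J\<^esub>j\<in>J. \<Oplus>\<^bsub>L J\<^esub>k\<in>J - {j}. ?t j k)"
    proof (intro L.M.finsum_cong')
      fix j assume j: "j \<in> J"
      note J' = cech_index_delete[OF J j]
      interpret L': module R "L (J - {j})"
        using sub by (intro module_L) auto
      note lin = rho_linear[OF sub j]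
      have "rho J j (D p c (J - {j})) = (\<Oplus>\<^bsub>L J\<^esub>k\<in>J - {j}. rho J j
          (ksign R k (J - {j}) \<odot>\<^bsub>L (J - {j})\<^esub> rho (J - {j}) k (c (J - {j} - {k}))))"
        unfolding cech_diff_apply[OF c J'] using cech_term_closed[OF c J'] cech_index_finite[OF J']
        by (intro additive_finsum[OF L'.M.abelian_group_axioms L.M.abelian_group_axioms
              R_linear_additive[OF lin]]) auto
      also have "\<dots> = (\<Oplus>\<^bsub>L J\<^esub>k\<in>J - {j}. ksign R k (J - {j}) \<odot>\<^bsub>L J\<^esub>
          rho J j (rho (J - {j}) k (c (J - {j} - {k}))))"
        using cech_term_closed[OF c J'] rr j
        by (intro L.M.finsum_cong') (auto simp: R_linear_smult[OF lin])
      finally have "ksign R j J \<odot>\<^bsub>L J\<^esub> rho J j (D p c (J - {j})) = ksign R j J \<odot>\<^bsub>L J\<^esub>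
          (\<Oplus>\<^bsub>L J\<^esub>k\<in>J - {j}. ksign R k (J - {j}) \<odot>\<^bsub>L J\<^esub> rho J j (rho (J - {j}) k (c (J - {j} - {k}))))"
        by simp
      also have "\<dots> = (\<Oplus>\<^bsub>L J\<^esub>k\<in>J - {j}. ksign R j J \<odot>\<^bsub>L J\<^esub> (ksign R k (J - {j}) \<odot>\<^bsub>L J\<^esub>
          rho J j (rho (J - {j}) k (c (J - {j} - {k})))))"
        using rr j cech_index_finite[OF J'] by (intro L.finsum_smult_ldistr) auto
      also have "\<dots> = (\<Oplus>\<^bsub>L J\<^esub>k\<in>J - {j}. ?t j k)"
        using rr j by (intro L.M.finsum_cong') (auto simp: L.smult_assoc1)
      finally show "ksign R j J \<odot>\<^bsub>L J\<^esub> rho J j (D p c (J - {j})) = (\<Oplus>\<^bsub>L J\<^esub>k\<in>J - {j}. ?t j k)" .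
    next
      show "(\<lambda>j. \<Oplus>\<^bsub>L J\<^esub>k\<in>J - {j}. ?t j k) \<in> J \<rightarrow> carrier (L J)"
        using rr by (auto intro!: L.M.finsum_closed)
    qed simp
    also have "\<dots> = \<zero>\<^bsub>L J\<^esub>"
    proof (rule L.M.finsum_antisymmetric[OF cech_index_finite[OF J]])
      fix j k assume jk: "j \<in> J" "k \<in> J" "j \<noteq> k"
      show "?t j k \<in> carrier (L J)"
        using rr jk by simp
      have "ksign R j J \<otimes> ksign R k (J - {j}) = \<ominus> (ksign R k J \<otimes> ksign R j (J - {k}))"
        using ksign_swap_delete_both jk by blast
      moreover have "rho J j (rho (J - {j}) k (c (J - {j} - {k}))) = rho J k (rho (J - {k}) j (c (J - {k} - {j})))"
      proof -
        have "J - {k} - {j} = J - {j} - {k}" by auto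
        then show ?thesis
          using rho_commute[OF sub jk c2[OF jk]] by simp
      qed
      ultimately show "?t j k = \<ominus>\<^bsub>L J\<^esub> ?t k j"
        using rr[of k j] jk by (simp add: L.smult_l_minus)
    qed
    finally show ?thesis
      using J by (simp add: cech_module_eq)
  qed (simp add: cech_diff_def cech_module_eq)
qed

end

section \<open>Koszul homology of the Cech modules\<close>

context cech begin

definition cpi :: "int \<Rightarrow> 'g \<Rightarrow> (nat set \<Rightarrow> ('b \<times> nat) set) \<Rightarrow> nat set \<Rightarrow> ('b \<times> nat) set" where
  "cpi p e c = (\<lambda>I\<in>cech_index r p. lpi I e (c I))"

lemma projection_L: "I \<subseteq> {..<r} \<Longrightarrow> gr_projection (L I) (lpi I)"
  unfolding cech_loc_def by (intro graded_localization.loc_projection graded_localization_fprod)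

lemma projection_C: "gr_projection (C p) (cpi p)"
proof -
  have "gr_projection (C p) (\<lambda>e c. \<lambda>I\<in>cech_index r p. lpi I e (c I))"
    unfolding cech_module_eq by (intro gr_projection_prod_module projection_L cech_index_subset)
  then show ?thesis
    by (simp add: cpi_def[abs_def])
qed

lemma lpi_additive: "I \<subseteq> {..<r} \<Longrightarrow> additive (L I) (L I) (lpi I e)"
  using projection_L unfolding gr_projection_def by blast

lemma cpi_closed: "c \<in> carrier (C p) \<Longrightarrow> cpi p e c \<in> carrier (C p)"
  using projection_C unfolding gr_projection_def by blast

lemma lpi_smult:
  assumes I: "I \<subseteq> {..<r}" and a: "a \<in> carrier R"
    and deg: "\<And>e x. x \<in> carrier M \<Longrightarrow> \<pi> (e + \<alpha>) (a \<odot>\<^bsub>M\<^esub> x) = a \<odot>\<^bsub>M\<^esub> \<pi> e x"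
    and x: "x \<in> carrier (L I)"
  shows "lpi I (e + \<alpha>) (a \<odot>\<^bsub>L I\<^esub> x) = a \<odot>\<^bsub>L I\<^esub> lpi I e x"
  using graded_localization.loc_projection_smult[OF graded_localization_fprod[OF I] a deg] x
  unfolding cech_loc_def by blast

lemma cech_diff_projection:
  assumes c: "c \<in> carrier (C p)"
  shows "D p (cpi p e c) = cpi (p + 1) e (D p c)"
proof (rule ext)
  fix J
  show "D p (cpi p e c) J = cpi (p + 1) e (D p c) J"
  proof (cases "J \<in> cech_index r (p + 1)")
    case J: True
    note sub = cech_index_subset[OF J]
    interpret L: module R "L J"
      using sub by (rule module_L)
    note cl = cech_term_closed[OF c J]
    note ab = L.M.abelian_group_axioms
    have "D p (cpi p e c) J = (\<Oplus>\<^bsub>L J\<^esub>j\<in>J. ksign R j J \<odot>\<^bsub>L J\<^esub> rho J j (cpi p e c (J - {j})))"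
      by (rule cech_diff_apply[OF cpi_closed[OF c] J])
    also have "\<dots> = (\<Oplus>\<^bsub>L J\<^esub>j\<in>J. lpi J e (ksign R j J \<odot>\<^bsub>L J\<^esub> rho J j (c (J - {j}))))"
    proof (intro L.M.finsum_cong')
      fix j assume j: "j \<in> J"
      have "rho J j (cpi p e c (J - {j})) = lpi J e (rho J j (c (J - {j})))"
        using rho_projection[OF sub j cech_component[OF c J j]] cech_index_delete[OF J j]
        by (simp add: cpi_def)
      moreover have "lpi J e (ksign R j J \<odot>\<^bsub>L J\<^esub> x) = ksign R j J \<odot>\<^bsub>L J\<^esub> lpi J e x"
        if x: "x \<in> carrier (L J)" for x
        using additive_minus[OF ab ab lpi_additive[OF sub] x] x
          additive_closed[OF lpi_additive[OF sub] x]
        by (simp add: ksign_def L.smult_l_minus)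
      ultimately show "ksign R j J \<odot>\<^bsub>L J\<^esub> rho J j (cpi p e c (J - {j}))
          = lpi J e (ksign R j J \<odot>\<^bsub>L J\<^esub> rho J j (c (J - {j})))"
        using cl[OF j] by simp
    qed (use cl additive_closed[OF lpi_additive[OF sub]] in auto)
    also have "\<dots> = lpi J e (D p c J)"
      unfolding cech_diff_apply[OF c J] using cl cech_index_finite[OF J]
      by (intro additive_finsum[OF ab ab lpi_additive[OF sub], symmetric]) auto
    finally show ?thesis
      using J by (simp add: cpi_def)
  qed (simp add: cech_diff_def cpi_def)
qed

lemma cpi_in: "c \<in> carrier (C p) \<Longrightarrow> cpi p e c \<in> hcomp (C p) e"
  and cpi_id: "c \<in> hcomp (C p) e \<Longrightarrow> cpi p e c = c"
  and hcomp_C_closed: "c \<in> hcomp (C p) e \<Longrightarrow> c \<in> carrier (C p)"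
  using projection_C unfolding gr_projection_def by blast+

lemma cech_diff_hcomp: "D p ` hcomp (C p) e \<subseteq> hcomp (C (p + 1)) e"
proof
  fix y assume "y \<in> D p ` hcomp (C p) e"
  then obtain c where c: "c \<in> hcomp (C p) e" "y = D p c"
    by blast
  then have "y = cpi (p + 1) e (D p c)"
    using cech_diff_projection[OF hcomp_C_closed[OF c(1)]] cpi_id[OF c(1)] by metis
  then show "y \<in> hcomp (C (p + 1)) e"
    using cpi_in[OF cech_diff_closed[OF hcomp_C_closed[OF c(1)]]] by simp
qed

lemma cech_diff_strict:
  assumes c: "c \<in> carrier (C p)" and "D p c \<in> hcomp (C (p + 1)) e"
  shows "D p c \<in> D p ` hcomp (C p) e"
proof -
  have "D p c = D p (cpi p e c)"
    using cech_diff_projection[OF c] cpi_id[OF assms(2)] by simp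
  then show ?thesis
    using cpi_in[OF c] by blast
qed

end

lemma gr_supp_homology_exact:
  assumes "e \<notin> gr_supp (gr_homology L M N f g)"
    and "abelian_group M" "\<zero>\<^bsub>M\<^esub> \<in> f ` carrier L"
    and x: "x \<in> hcomp M e" "x \<in> carrier M" "g x = \<zero>\<^bsub>N\<^esub>"
  shows "x \<in> f ` carrier L"
proof -
  interpret M: abelian_group M by fact
  have "x \<in> a_kernel M N g"
    using x by (simp add: a_kernel_def kernel_def)
  then have "f ` carrier L +>\<^bsub>M\<^esub> x \<in> hcomp (gr_homology L M N f g) e"
    using x by (simp add: gr_homology_def gr_subquot_def)
  then have "f ` carrier L +>\<^bsub>M\<^esub> x = f ` carrier L"
    using assms(1) by (simp add: gr_supp_def gr_homology_def gr_subquot_def)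
  moreover have "\<zero>\<^bsub>M\<^esub> \<oplus>\<^bsub>M\<^esub> x \<in> f ` carrier L +>\<^bsub>M\<^esub> x"
    using assms(3) unfolding a_r_coset_def' by blast
  ultimately show ?thesis
    using x by simp
qed

locale cech_koszul = cech R M f \<delta> r \<pi>
  for R :: "('a, 'g::ab_group_add) gr_ring" (structure)
    and M :: "('a, 'b, 'g) gr_module" (structure) and f \<delta> r \<pi> +
  fixes v :: "nat \<Rightarrow> 'a" and n :: nat and \<gamma> :: "nat \<Rightarrow> 'g"
  assumes v_closed: "\<And>j. j < n \<Longrightarrow> v j \<in> carrier R"
    and projection_v: "\<And>j e x. j < n \<Longrightarrow> x \<in> carrier M \<Longrightarrow> \<pi> (e + \<gamma> j) (v j \<odot>\<^bsub>M\<^esub> x) = v j \<odot>\<^bsub>M\<^esub> \<pi> e x"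
    and f_ideal: "\<And>i. i < r \<Longrightarrow> f i \<in> Idl\<^bsub>R\<^esub> (v ` {..<n})"
begin

lemma gr_koszul_C: "gr_koszul R (C p) v n \<gamma> (cpi p)"
proof -
  interpret C: module R "C p" by (rule module_C)
  have "cpi p (e + \<gamma> j) (v j \<odot>\<^bsub>C p\<^esub> c) = v j \<odot>\<^bsub>C p\<^esub> cpi p e c" if "j < n" "c \<in> carrier (C p)" for e j c
  proof -
    have "lpi I (e + \<gamma> j) (v j \<odot>\<^bsub>L I\<^esub> c I) = v j \<odot>\<^bsub>L I\<^esub> lpi I e (c I)"
      if I: "I \<in> cech_index r p" for I
    proof (rule lpi_smult[OF cech_index_subset[OF I] v_closed[OF \<open>j < n\<close>]])
      show "c I \<in> carrier (L I)"
        using \<open>c \<in> carrier (C p)\<close> I unfolding cech_module_eq prod_module_simps by (rule PiE_mem)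
    qed (rule projection_v[OF \<open>j < n\<close>])
    then show ?thesis
      by (auto simp: cech_module_eq cpi_def intro!: restrict_ext)
  qed
  then show ?thesis
    using v_closed projection_C by unfold_locales auto
qed

lemma fprod_ideal:
  assumes "I \<subseteq> {..<r}" "I \<noteq> {}"
  shows "fprod I \<in> Idl\<^bsub>R\<^esub> (v ` {..<n})"
proof -
  obtain i where i: "i \<in> I"
    using assms by blast
  interpret ideal "Idl\<^bsub>R\<^esub> (v ` {..<n})" R
    using v_closed by (intro R.genideal_ideal) auto
  have "f i \<in> Idl\<^bsub>R\<^esub> (v ` {..<n})" "fprod (I - {i}) \<in> carrier R"
    using assms i f_ideal[of i] fprod_closed[of "I - {i}"] by auto
  then show ?thesis
    unfolding fprod_delete[OF assms(1) i] by (rule I_l_closed)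
qed

text \<open>
  Each factor is a localization at a product of at least one \<open>f i\<close>, and this product lies in the
  ideal of the variables.
\<close>

lemma koszul_exact_C:
  assumes p: "p > 0" and c: "\<And>J. c J \<in> carrier (C p)"
    and cycle: "\<And>J. kdiff R (C p) v n c J = \<zero>\<^bsub>C p\<^esub>"
  shows "\<exists>b. (\<forall>J. b J \<in> carrier (C p)) \<and> (\<forall>J. kdiff R (C p) v n b J = c J)"
  unfolding cech_module_eq
proof (rule koszul_exact_prod_module)
  fix I b assume I: "I \<in> cech_index r p" and b: "\<And>J. b J \<in> carrier (L I)"
    "\<And>J. kdiff R (L I) v n b J = \<zero>\<^bsub>L I\<^esub>"
  have sub: "I \<subseteq> {..<r}" and ne: "I \<noteq> {}"
    using I p by (auto simp: cech_index_def)
  interpret L: module R "L I"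
    using sub by (rule module_L)
  interpret L: koszul R "L I" v n
    using v_closed by unfold_locales
  interpret loc: localization R M "fprod I"
    using sub by (rule localization_fprod)
  show "\<exists>b'. (\<forall>J. b' J \<in> carrier (L I)) \<and> (\<forall>J. kdiff R (L I) v n b' J = b J)"
  proof (rule L.koszul_exact_if_ideal_contains_unit[OF fprod_ideal[OF sub ne]])
    show "x = \<zero>\<^bsub>L I\<^esub>" if "x \<in> carrier (L I)" "fprod I \<odot>\<^bsub>L I\<^esub> x = \<zero>\<^bsub>L I\<^esub>" for x
      using that unfolding cech_loc_def by (rule loc.localization_unit_injective)
    show "\<exists>y\<in>carrier (L I). fprod I \<odot>\<^bsub>L I\<^esub> y = x" if "x \<in> carrier (L I)" for x
      using that unfolding cech_loc_def by (rule loc.localization_unit_surjective)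
  qed (use b in auto)
qed (use assms v_closed module_L cech_index_subset R.is_cring in \<open>simp_all add: cech_module_eq\<close>)

lemma gr_koszul_map_D: "gr_koszul_map R (C p) (C (p + 1)) v n \<gamma> (cpi p) (cpi (p + 1)) (D p)"
  by (intro gr_koszul_map.intro gr_koszul_C gr_koszul_map_axioms.intro cech_diff_linear cech_diff_hcomp)

abbreviation coboundaries :: "int \<Rightarrow> (nat set \<Rightarrow> ('b \<times> nat) set) set" where
  "coboundaries p \<equiv> D (p - 1) ` carrier (C (p - 1))"

lemma zero_coboundary: "\<zero>\<^bsub>C p\<^esub> \<in> coboundaries p"
proof -
  interpret C: module R "C p" by (rule module_C)
  interpret C': module R "C (p - 1)" by (rule module_C)
  have "R_linear R (C (p - 1)) (C p) (D (p - 1))"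
    using cech_diff_linear[of "p - 1"] by simp
  then have "D (p - 1) \<zero>\<^bsub>C (p - 1)\<^esub> = \<zero>\<^bsub>C p\<^esub>"
    by (rule additive_zero[OF C'.M.abelian_group_axioms C.M.abelian_group_axioms R_linear_additive])
  then show ?thesis
    using imageI[OF C'.M.zero_closed, of "D (p - 1)"] by simp
qed

lemma carrier_C_trivial:
  assumes "cech_index r p = {}"
  shows "carrier (C p) = {\<zero>\<^bsub>C p\<^esub>}"
  using assms by (simp add: cech_module_eq restrict_def)

text \<open>
  Descending induction on \<open>k\<close>, starting at the zero module \<open>C (r + 1)\<close>, shows that in degree \<open>g\<close> the
  Koszul homology of \<open>C k\<close> modulo coboundaries vanishes in homological degree \<open>j + k\<close>. In the step,
  the kernel of the Cech differential modulo coboundaries is the cohomology of \<open>M\<close>, which is zero in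
  the degrees \<open>g - (\<Sum>i\<in>J. \<gamma> i)\<close>, \<open>card J = j + k\<close>, that occur in these chains.
\<close>

lemma koszul_vanishes_cech:
  assumes van: "\<And>k J. J \<subseteq> {..<n} \<Longrightarrow> card J = j + k \<Longrightarrow>
      g - (\<Sum>i\<in>J. \<gamma> i) \<notin> gr_supp (cech_cohomology R M f \<delta> r (int k))"
  shows "koszul_vanishes R (C 0) v n \<gamma> g j {\<zero>\<^bsub>C 0\<^esub>}"
proof -
  have "koszul_vanishes R (C (int k)) v n \<gamma> g (j + k) (coboundaries (int k))" if "k \<le> Suc r" for k
    using that
  proof (induction k rule: inc_induct)
    case base
    interpret C: gr_koszul R "C (int (Suc r))" v n \<gamma> "cpi (int (Suc r))"
      by (rule gr_koszul_C)
    have "cech_index r (int (Suc r)) = {}"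
    proof (rule equals0I)
      fix I assume "I \<in> cech_index r (int (Suc r))"
      then have "I \<subseteq> {..<r}" "card I = Suc r"
        by (simp_all add: cech_index_def)
      then show False
        using card_mono[of "{..<r}" I] by simp
    qed
    note triv = carrier_C_trivial[OF this]
    have "\<zero>\<^bsub>C (int (Suc r))\<^esub> \<in> hcomp (C (int (Suc r))) e" for e
      by (rule C.hcomp_zero)
    then have "(\<lambda>J. \<zero>\<^bsub>C (int (Suc r))\<^esub>) \<in> kchains (C (int (Suc r))) n \<gamma> g (Suc (j + Suc r))"
      by (intro C.kchainsI) auto
    moreover have "x \<in> coboundaries (int (Suc r))" if "x \<in> carrier (C (int (Suc r)))" for x
      using that zero_coboundary[of "int (Suc r)"] unfolding triv by blast
    moreover have "z J \<ominus>\<^bsub>C (int (Suc r))\<^esub> kdiff R (C (int (Suc r))) v n (\<lambda>J. \<zero>\<^bsub>C (int (Suc r))\<^esub>) J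
        \<in> carrier (C (int (Suc r)))" if "z \<in> kchains (C (int (Suc r))) n \<gamma> g (j + Suc r)" for z J
      by (intro C.M.minus_closed C.kchains_closed[OF that] C.kdiff_closed C.M.zero_closed)
    ultimately show ?case
      unfolding koszul_vanishes_def by blast
  next
    case (step k)
    interpret D: gr_koszul_map R "C (int k)" "C (int k + 1)" v n \<gamma> "cpi (int k)" "cpi (int k + 1)" "D (int k)"
      by (rule gr_koszul_map_D)
    show ?case
    proof (rule D.koszul_vanishes_step)
      show "koszul_vanishes R (C (int k + 1)) v n \<gamma> g (Suc (j + k)) (D (int k) ` carrier (C (int k)))"
        using step.IH by (simp add: add.commute)
      show "D (int k) x \<in> D (int k) ` hcomp (C (int k)) e"
        if "x \<in> carrier (C (int k))" "D (int k) x \<in> hcomp (C (int k + 1)) e" for e x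
        using that by (rule cech_diff_strict)
      show "x \<in> coboundaries (int k)" if "J \<subseteq> {..<n}" "card J = j + k"
        "x \<in> hcomp (C (int k)) (g - (\<Sum>i\<in>J. \<gamma> i))" "D (int k) x = \<zero>\<^bsub>C (int k + 1)\<^esub>" for J x
      proof (rule gr_supp_homology_exact[where f = "D (int k - 1)" and L = "C (int k - 1)"])
        show "g - (\<Sum>i\<in>J. \<gamma> i) \<notin> gr_supp (gr_homology (C (int k - 1)) (C (int k)) (C (int k + 1))
            (D (int k - 1)) (D (int k)))"
          using van[OF that(1,2)] unfolding cech_cohomology_def .
      qed (rule D.L.M.abelian_group_axioms zero_coboundary that(3) D.L.hcomp_closed[OF that(3)] that(4))+
      show "\<zero>\<^bsub>C (int k)\<^esub> \<in> coboundaries (int k)"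
        by (rule zero_coboundary)
      show "D (int k) x = \<zero>\<^bsub>C (int k + 1)\<^esub>" if "x \<in> coboundaries (int k)" for x
        using that cech_diff_diff[of _ "int k - 1"] by auto
      show "\<exists>b. (\<forall>J. b J \<in> carrier (C (int k + 1))) \<and> (\<forall>J. kdiff R (C (int k + 1)) v n b J = c J)"
        if "c \<in> kchains (C (int k + 1)) n \<gamma> g (j + k)"
          "\<And>J. kdiff R (C (int k + 1)) v n c J = \<zero>\<^bsub>C (int k + 1)\<^esub>" for c
        using that(2) D.L'.kchains_closed[OF that(1)] by (intro koszul_exact_C) auto
    qed
  qed
  from this[of 0] have "koszul_vanishes R (C 0) v n \<gamma> g j (coboundaries 0)"
    by simp
  moreover have "coboundaries 0 = {\<zero>\<^bsub>C 0\<^esub>}"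
  proof -
    have "cech_index r (0 - 1) = {}"
      by (auto simp: cech_index_def)
    then have "coboundaries 0 = {D (0 - 1) \<zero>\<^bsub>C (0 - 1)\<^esub>}"
      using carrier_C_trivial[of "0 - 1"] by simp
    then show ?thesis
      using zero_coboundary[of 0] by auto
  qed
  ultimately show ?thesis by simp
qed

end

section \<open>The polynomial ring\<close>

lemma finite_submultisets: "finite {k. k \<subseteq># m}"
proof (induction m)
  case (add x m)
  have "{k. k \<subseteq># add_mset x m} \<subseteq> {k. k \<subseteq># m} \<union> add_mset x ` {k. k \<subseteq># m}"
  proof
    fix k assume k: "k \<in> {k. k \<subseteq># add_mset x m}"
    show "k \<in> {k. k \<subseteq># m} \<union> add_mset x ` {k. k \<subseteq># m}"
    proof (cases "x \<in># k")
      case True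
      then obtain l where "k = add_mset x l"
        by (blast dest: multi_member_split)
      then show ?thesis using k by auto
    next
      case False
      then show ?thesis
        using k subset_eq_diff_conv[of k "{#x#}" m] by (simp add: diff_single_trivial)
    qed
  qed
  then show ?case
    using add.IH finite_subset by blast
qed simp

text \<open>
  Division by the \<open>i\<close>-th variable; monomials that it does not divide are dropped.
\<close>

definition mpoly_shift :: "nat \<Rightarrow> (nat multiset \<Rightarrow> 's) \<Rightarrow> nat multiset \<Rightarrow> 's" where
  "mpoly_shift i P = (\<lambda>m. P (add_mset i m))"

locale mpoly = S: cring S for S :: "('s, 'x) ring_scheme" +
  fixes n :: nat and \<gamma> :: "nat \<Rightarrow> 'g::ab_group_add"
begin

abbreviation R where "R \<equiv> gr_mpoly_ring S n \<gamma>"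

abbreviation v where "v \<equiv> ring.indexed_var S :: nat \<Rightarrow> nat multiset \<Rightarrow> 's"

lemma carrier_R: "carrier R = ring.indexed_pset S {..<n} (carrier S)"
  by (simp add: gr_mpoly_ring_def)

lemma coeff_closed: "P \<in> carrier R \<Longrightarrow> P m \<in> carrier S"
  by (rule S.carrier_coeffE[OF S.indexed_pset_in_carrier[of "carrier S" P "{..<n}"]]) (simp_all add: carrier_R)

lemma v_eq: "v i = (\<lambda>m. if m = {#i#} then \<one>\<^bsub>S\<^esub> else \<zero>\<^bsub>S\<^esub>)"
  by (auto simp: S.indexed_var_def S.indexed_pmult_def S.indexed_const_def fun_eq_iff
      dest: multi_member_split)

lemma v_closed: "i < n \<Longrightarrow> v i \<in> carrier R"
  unfolding carrier_R S.indexed_var_def by (intro S.indexed_pset.intros) auto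

lemma v_homogeneous: "i < n \<Longrightarrow> v i \<in> rcomp R (\<gamma> i)"
proof -
  assume "i < n"
  then have "v i \<in> ring.indexed_pset S {..<n} (carrier S)"
    using v_closed carrier_R by simp
  moreover have "(\<Sum>j\<in>#m. \<gamma> j) = \<gamma> i" if "v i m \<noteq> \<zero>\<^bsub>S\<^esub>" for m
    using that by (simp add: v_eq split: if_splits)
  ultimately show ?thesis
    by (simp add: gr_mpoly_ring_def)
qed

lemma zero_R: "\<zero>\<^bsub>R\<^esub> = (\<lambda>m. \<zero>\<^bsub>S\<^esub>)"
  by (simp add: gr_mpoly_ring_def S.indexed_zero_def)

lemma add_R: "P \<oplus>\<^bsub>R\<^esub> Q = (\<lambda>m. P m \<oplus>\<^bsub>S\<^esub> Q m)"
  by (simp add: gr_mpoly_ring_def S.indexed_padd_def)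

lemma v_mult:
  assumes P: "P \<in> carrier R"
  shows "v i \<otimes>\<^bsub>R\<^esub> P = (\<lambda>m. if i \<in># m then P (m - {#i#}) else \<zero>\<^bsub>S\<^esub>)"
proof (rule ext)
  fix m :: "nat multiset"
  have fin: "finite {k. k \<subseteq># m}"
    by (rule finite_submultisets)
  have "(v i \<otimes>\<^bsub>R\<^esub> P) m = (\<Oplus>\<^bsub>S\<^esub>k\<in>{k. k \<subseteq># m}. v i k \<otimes>\<^bsub>S\<^esub> P (m - k))"
    by (simp add: gr_mpoly_ring_def mpoly_mult_def)
  also have "\<dots> = (\<Oplus>\<^bsub>S\<^esub>k\<in>{k. k \<subseteq># m}. if {#i#} = k then P (m - k) else \<zero>\<^bsub>S\<^esub>)"
    using coeff_closed[OF P] by (intro S.finsum_cong') (auto simp: v_eq)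
  also have "\<dots> = (if i \<in># m then P (m - {#i#}) else \<zero>\<^bsub>S\<^esub>)"
  proof (cases "i \<in># m")
    case True
    then show ?thesis
      using S.finsum_singleton[of "{#i#}" "{k. k \<subseteq># m}" "\<lambda>k. P (m - k)"] fin coeff_closed[OF P] by simp
  next
    case False
    then have "(\<Oplus>\<^bsub>S\<^esub>k\<in>{k. k \<subseteq># m}. if {#i#} = k then P (m - k) else \<zero>\<^bsub>S\<^esub>) = \<zero>\<^bsub>S\<^esub>"
      by (intro S.add.finprod_one_eqI) auto
    then show ?thesis using False by simp
  qed
  finally show "(v i \<otimes>\<^bsub>R\<^esub> P) m = (if i \<in># m then P (m - {#i#}) else \<zero>\<^bsub>S\<^esub>)" .
qed

lemma shift_zero: "mpoly_shift i \<zero>\<^bsub>R\<^esub> = \<zero>\<^bsub>R\<^esub>"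
  by (simp add: mpoly_shift_def zero_R)

lemma shift_add: "mpoly_shift i (P \<oplus>\<^bsub>R\<^esub> Q) = mpoly_shift i P \<oplus>\<^bsub>R\<^esub> mpoly_shift i Q"
  by (simp add: mpoly_shift_def add_R)

lemma shift_v: "P \<in> carrier R \<Longrightarrow> mpoly_shift i (v i \<otimes>\<^bsub>R\<^esub> P) = P"
  by (simp add: mpoly_shift_def v_mult)

lemma shift_closed:
  assumes "P \<in> carrier R"
  shows "mpoly_shift i P \<in> carrier R"
  using assms unfolding carrier_R
proof (induction rule: S.indexed_pset.induct)
  case (indexed_const k)
  have "mpoly_shift i (ring.indexed_const S k) = ring.indexed_const S \<zero>\<^bsub>S\<^esub>"
    by (simp add: mpoly_shift_def S.indexed_const_def)
  then show ?case
    by (simp add: S.indexed_pset.indexed_const)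
next
  case (indexed_padd P Q)
  have "mpoly_shift i (ring.indexed_padd S P Q) = ring.indexed_padd S (mpoly_shift i P) (mpoly_shift i Q)"
    by (simp add: mpoly_shift_def S.indexed_padd_def)
  then show ?case
    using indexed_padd by (simp add: S.indexed_pset.indexed_padd)
next
  case (indexed_pmult P j)
  show ?case
  proof (cases "j = i")
    case True
    then have "mpoly_shift i (ring.indexed_pmult S P j) = P"
      by (simp add: mpoly_shift_def S.indexed_pmult_def)
    then show ?thesis
      using indexed_pmult by simp
  next
    case False
    then have "mpoly_shift i (ring.indexed_pmult S P j) = ring.indexed_pmult S (mpoly_shift i P) j"
      by (auto simp: mpoly_shift_def S.indexed_pmult_def fun_eq_iff)
    then show ?thesis
      using indexed_pmult by (simp add: S.indexed_pset.indexed_pmult)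
  qed
qed

lemma shift_v_other:
  assumes "P \<in> carrier R" "j \<noteq> i"
  shows "mpoly_shift i (v j \<otimes>\<^bsub>R\<^esub> P) = v j \<otimes>\<^bsub>R\<^esub> mpoly_shift i P"
proof -
  have *: "(if j \<in># add_mset i m then P (add_mset i m - {#j#}) else \<zero>\<^bsub>S\<^esub>)
      = (if j \<in># m then P (add_mset i (m - {#j#})) else \<zero>\<^bsub>S\<^esub>)" for m
    using assms(2) by auto
  show ?thesis
    unfolding v_mult[OF assms(1)] v_mult[OF shift_closed[OF assms(1)]]
    unfolding mpoly_shift_def by (simp only: *)
qed

end

section \<open>Coordinates in a free module\<close>

locale free_module = module R F
  for R :: "('a, 'g::ab_group_add) gr_ring" (structure)
    and F :: "('a, 'b, 'g) gr_module" (structure) +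
  fixes E :: "'b set"
  assumes basis: "homogeneous_basis R F E"
begin

lemma basis_closed: "e \<in> E \<Longrightarrow> e \<in> carrier F"
  using basis unfolding homogeneous_basis_def by blast

definition coord :: "'b \<Rightarrow> 'b \<Rightarrow> 'a" where
  "coord x = (THE a. a \<in> E \<rightarrow> carrier R \<and> (\<forall>e. e \<notin> E \<longrightarrow> a e = \<zero>) \<and> finite {e. a e \<noteq> \<zero>} \<and>
     x = (\<Oplus>\<^bsub>F\<^esub>e\<in>{e. a e \<noteq> \<zero>}. a e \<odot>\<^bsub>F\<^esub> e))"

definition combination :: "('b \<Rightarrow> 'a) \<Rightarrow> 'b" where
  "combination a = (\<Oplus>\<^bsub>F\<^esub>e\<in>{e. a e \<noteq> \<zero>}. a e \<odot>\<^bsub>F\<^esub> e)"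

definition coords :: "('b \<Rightarrow> 'a) set" where
  "coords = {a. a \<in> E \<rightarrow> carrier R \<and> (\<forall>e. e \<notin> E \<longrightarrow> a e = \<zero>) \<and> finite {e. a e \<noteq> \<zero>}}"

lemma coord_unique:
  assumes "x \<in> carrier F" shows "\<exists>!a. a \<in> coords \<and> x = combination a"
proof -
  have "\<exists>!a. a \<in> E \<rightarrow> carrier R \<and> (\<forall>e. e \<notin> E \<longrightarrow> a e = \<zero>) \<and> finite {e. a e \<noteq> \<zero>} \<and>
     x = (\<Oplus>\<^bsub>F\<^esub>e\<in>{e. a e \<noteq> \<zero>}. a e \<odot>\<^bsub>F\<^esub> e)"
    using basis assms unfolding homogeneous_basis_def by blast
  then show ?thesis
    unfolding coords_def combination_def by (simp add: conj_assoc)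
qed

lemma coord_eq: "coord x = (THE a. a \<in> coords \<and> x = combination a)"
  unfolding coord_def coords_def combination_def by (simp add: conj_assoc)

lemma coord_properties:
  assumes "x \<in> carrier F"
  shows "coord x \<in> coords \<and> x = combination (coord x)"
  using theI'[OF coord_unique[OF assms]] unfolding coord_eq[symmetric] .

lemma coord_coords: "x \<in> carrier F \<Longrightarrow> coord x \<in> coords"
  by (rule coord_properties[THEN conjunct1])

lemma combination_coord: "x \<in> carrier F \<Longrightarrow> combination (coord x) = x"
  by (rule coord_properties[THEN conjunct2, symmetric])

lemma coords_closed: "a \<in> coords \<Longrightarrow> a e \<in> carrier R"
  unfolding coords_def by (cases "e \<in> E") (auto simp: Pi_iff)

lemma coords_term_closed: "a \<in> coords \<Longrightarrow> a e \<odot>\<^bsub>F\<^esub> e \<in> carrier F" if "e \<in> E"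
  using that coords_closed basis_closed by simp

lemma coords_support: "a \<in> coords \<Longrightarrow> a e \<noteq> \<zero> \<Longrightarrow> e \<in> E"
  unfolding coords_def by blast

lemma coords_outside: "a \<in> coords \<Longrightarrow> e \<notin> E \<Longrightarrow> a e = \<zero>"
  unfolding coords_def by blast

lemma coords_finite: "a \<in> coords \<Longrightarrow> finite {e. a e \<noteq> \<zero>}"
  unfolding coords_def by blast

lemma combination_superset:
  assumes a: "a \<in> coords" and A: "finite A" "{e. a e \<noteq> \<zero>} \<subseteq> A" "A \<subseteq> E"
  shows "combination a = (\<Oplus>\<^bsub>F\<^esub>e\<in>A. a e \<odot>\<^bsub>F\<^esub> e)"
  unfolding combination_def
proof (rule M.add.finprod_mono_neutral_cong_left[OF A(1,2)])
  show "a e \<odot>\<^bsub>F\<^esub> e = \<zero>\<^bsub>F\<^esub>" if "e \<in> A - {e. a e \<noteq> \<zero>}" for e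
    using that A(3) basis_closed by auto
  show "(\<lambda>e. a e \<odot>\<^bsub>F\<^esub> e) \<in> A \<rightarrow> carrier F"
    using A(3) coords_term_closed[OF _ a] by blast
qed simp

lemma combination_closed: "a \<in> coords \<Longrightarrow> combination a \<in> carrier F"
  unfolding combination_def using coords_support coords_term_closed
  by (intro M.finsum_closed) blast

lemma coord_combination: "a \<in> coords \<Longrightarrow> coord (combination a) = a"
  unfolding coord_eq using coord_unique[OF combination_closed]
  by (intro the1_equality[where P = "\<lambda>b. b \<in> coords \<and> combination a = combination b"]) auto

lemma coords_add:
  assumes a: "a \<in> coords" and b: "b \<in> coords"
  shows "(\<lambda>e. a e \<oplus> b e) \<in> coords" "combination (\<lambda>e. a e \<oplus> b e) = combination a \<oplus>\<^bsub>F\<^esub> combination b"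
proof -
  let ?A = "{e. a e \<noteq> \<zero>} \<union> {e. b e \<noteq> \<zero>}"
  have A: "finite ?A" "?A \<subseteq> E"
    using coords_finite coords_support a b by auto
  have sup: "{e. a e \<oplus> b e \<noteq> \<zero>} \<subseteq> ?A"
    by auto
  show ab: "(\<lambda>e. a e \<oplus> b e) \<in> coords"
    using coords_closed[OF a] coords_closed[OF b] finite_subset[OF sup A(1)] coords_outside[OF a] coords_outside[OF b]
    unfolding coords_def by auto
  have "combination (\<lambda>e. a e \<oplus> b e) = (\<Oplus>\<^bsub>F\<^esub>e\<in>?A. a e \<odot>\<^bsub>F\<^esub> e \<oplus>\<^bsub>F\<^esub> b e \<odot>\<^bsub>F\<^esub> e)"
    unfolding combination_superset[OF ab A(1) sup A(2)]
    using A coords_closed[OF a] coords_closed[OF b] basis_closed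
    by (intro M.finsum_cong') (auto simp: smult_l_distr)
  also have "\<dots> = (\<Oplus>\<^bsub>F\<^esub>e\<in>?A. a e \<odot>\<^bsub>F\<^esub> e) \<oplus>\<^bsub>F\<^esub> (\<Oplus>\<^bsub>F\<^esub>e\<in>?A. b e \<odot>\<^bsub>F\<^esub> e)"
    using A coords_closed[OF a] coords_closed[OF b] basis_closed
    by (intro M.finsum_addf) auto
  also have "\<dots> = combination a \<oplus>\<^bsub>F\<^esub> combination b"
    using combination_superset[OF a A(1) _ A(2)] combination_superset[OF b A(1) _ A(2)] by simp
  finally show "combination (\<lambda>e. a e \<oplus> b e) = combination a \<oplus>\<^bsub>F\<^esub> combination b" .
qed

lemma coords_smult:
  assumes a: "a \<in> coords" and r: "r \<in> carrier R"
  shows "(\<lambda>e. r \<otimes> a e) \<in> coords" "combination (\<lambda>e. r \<otimes> a e) = r \<odot>\<^bsub>F\<^esub> combination a"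
proof -
  let ?A = "{e. a e \<noteq> \<zero>}"
  have A: "finite ?A" "?A \<subseteq> E"
    using coords_finite coords_support a by auto
  have sup: "{e. r \<otimes> a e \<noteq> \<zero>} \<subseteq> ?A"
    using r by auto
  show ra: "(\<lambda>e. r \<otimes> a e) \<in> coords"
    using coords_closed[OF a] r finite_subset[OF sup A(1)] coords_outside[OF a]
    unfolding coords_def by auto
  have "combination (\<lambda>e. r \<otimes> a e) = (\<Oplus>\<^bsub>F\<^esub>e\<in>?A. r \<odot>\<^bsub>F\<^esub> (a e \<odot>\<^bsub>F\<^esub> e))"
    unfolding combination_superset[OF ra A(1) sup A(2)]
    using A coords_closed[OF a] r basis_closed
    by (intro M.finsum_cong') (auto simp: smult_assoc1)
  also have "\<dots> = r \<odot>\<^bsub>F\<^esub> combination a"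
    unfolding combination_def using A coords_closed[OF a] r basis_closed
    by (intro finsum_smult_ldistr[symmetric]) auto
  finally show "combination (\<lambda>e. r \<otimes> a e) = r \<odot>\<^bsub>F\<^esub> combination a" .
qed

lemma coord_add:
  assumes "x \<in> carrier F" "y \<in> carrier F"
  shows "coord (x \<oplus>\<^bsub>F\<^esub> y) = (\<lambda>e. coord x e \<oplus> coord y e)"
  using coord_combination[OF coords_add(1)[OF coord_coords[OF assms(1)] coord_coords[OF assms(2)]]]
  unfolding coords_add(2)[OF coord_coords[OF assms(1)] coord_coords[OF assms(2)]]
    combination_coord[OF assms(1)] combination_coord[OF assms(2)] .

lemma coord_smult:
  assumes "x \<in> carrier F" "r \<in> carrier R"
  shows "coord (r \<odot>\<^bsub>F\<^esub> x) = (\<lambda>e. r \<otimes> coord x e)"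
  using coord_combination[OF coords_smult(1)[OF coord_coords[OF assms(1)] assms(2)]]
  unfolding coords_smult(2)[OF coord_coords[OF assms(1)] assms(2)] combination_coord[OF assms(1)] .

definition coordinatewise :: "('a \<Rightarrow> 'a) \<Rightarrow> 'b \<Rightarrow> 'b" where
  "coordinatewise t x = combination (\<lambda>e. t (coord x e))"

context
  fixes t :: "'a \<Rightarrow> 'a"
  assumes t_closed: "\<And>a. a \<in> carrier R \<Longrightarrow> t a \<in> carrier R"
    and t_zero: "t \<zero> = \<zero>"
begin

lemma coordinatewise_coords:
  assumes "x \<in> carrier F"
  shows "(\<lambda>e. t (coord x e)) \<in> coords"
proof -
  have "{e. t (coord x e) \<noteq> \<zero>} \<subseteq> {e. coord x e \<noteq> \<zero>}"
    using t_zero by auto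
  then have "finite {e. t (coord x e) \<noteq> \<zero>}"
    using coords_finite[OF coord_coords[OF assms]] finite_subset by blast
  moreover have "t (coord x e) = \<zero>" if "e \<notin> E" for e
    using coords_support[OF coord_coords[OF assms], of e] that t_zero by fastforce
  ultimately show ?thesis
    using t_closed[OF coords_closed[OF coord_coords[OF assms]]] unfolding coords_def by auto
qed

lemma coordinatewise_additive:
  assumes "\<And>a b. a \<in> carrier R \<Longrightarrow> b \<in> carrier R \<Longrightarrow> t (a \<oplus> b) = t a \<oplus> t b"
  shows "additive F F (coordinatewise t)"
  unfolding additive_def coordinatewise_def
proof (intro conjI ballI funcsetI)
  fix x assume x: "x \<in> carrier F"
  show "combination (\<lambda>e. t (coord x e)) \<in> carrier F"
    by (rule combination_closed[OF coordinatewise_coords[OF x]])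
  fix y assume y: "y \<in> carrier F"
  have "(\<lambda>e. t (coord (x \<oplus>\<^bsub>F\<^esub> y) e)) = (\<lambda>e. t (coord x e) \<oplus> t (coord y e))"
    using x y assms coords_closed coord_coords by (simp add: coord_add)
  then show "combination (\<lambda>e. t (coord (x \<oplus>\<^bsub>F\<^esub> y) e))
      = combination (\<lambda>e. t (coord x e)) \<oplus>\<^bsub>F\<^esub> combination (\<lambda>e. t (coord y e))"
    using coords_add(2)[OF coordinatewise_coords[OF x] coordinatewise_coords[OF y]] by simp
qed

lemma coordinatewise_inverse:
  assumes "r \<in> carrier R" "\<And>a. a \<in> carrier R \<Longrightarrow> t (r \<otimes> a) = a" "x \<in> carrier F"
  shows "coordinatewise t (r \<odot>\<^bsub>F\<^esub> x) = x"
  using assms coords_closed[OF coord_coords[OF assms(3)]]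
  by (simp add: coordinatewise_def coord_smult combination_coord)

lemma coordinatewise_commute:
  assumes r: "r \<in> carrier R" "\<And>a. a \<in> carrier R \<Longrightarrow> t (r \<otimes> a) = r \<otimes> t a" "x \<in> carrier F"
  shows "coordinatewise t (r \<odot>\<^bsub>F\<^esub> x) = r \<odot>\<^bsub>F\<^esub> coordinatewise t x"
  using assms coords_closed[OF coord_coords[OF assms(3)]]
    coords_smult(2)[OF coordinatewise_coords[OF assms(3)] r(1)]
  by (simp add: coordinatewise_def coord_smult)

end

end

text \<open>
  Dividing all coordinates by a variable is an additive map that inverts this variable on the left
  and commutes with the others.
\<close>

lemma (in mpoly) koszul_exact_free:
  assumes F: "module R F" "homogeneous_basis R F E"
    and c: "\<And>J. c J \<in> carrier F" and cycle: "\<And>J. kdiff R F v n c J = \<zero>\<^bsub>F\<^esub>"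
    and pos: "\<And>J. J \<inter> {..<n} = {} \<Longrightarrow> c J = \<zero>\<^bsub>F\<^esub>"
  shows "\<exists>b. (\<forall>J. b J \<in> carrier F) \<and> (\<forall>J. kdiff R F v n b J = c J)"
proof -
  interpret F: module R F by fact
  interpret F: free_module R F E
    using F(2) by unfold_locales
  interpret F: koszul R F v n
    using v_closed by unfold_locales
  note shift = shift_closed shift_zero
  show ?thesis
  proof (rule F.koszul_exact_if_division)
    show "additive F F (F.coordinatewise (mpoly_shift i))" if "i < n" for i
      by (rule F.coordinatewise_additive[OF shift shift_add])
    show "F.coordinatewise (mpoly_shift i) (v i \<odot>\<^bsub>F\<^esub> x) = x" if "i < n" "x \<in> carrier F" for i x
      by (rule F.coordinatewise_inverse[OF shift v_closed[OF that(1)] shift_v that(2)])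
    show "F.coordinatewise (mpoly_shift i) (v j \<odot>\<^bsub>F\<^esub> x) = v j \<odot>\<^bsub>F\<^esub> F.coordinatewise (mpoly_shift i) x"
      if "i < n" "j < n" "j \<noteq> i" "x \<in> carrier F" for i j x
      by (rule F.coordinatewise_commute[OF shift v_closed[OF that(2)] shift_v_other[OF _ that(3)] that(4)])
  qed (use c cycle pos in auto)
qed

section \<open>Augmenting the Cech complex\<close>

context cech begin

text \<open>
  The isomorphism from \<open>M\<close> to its localization at the empty product, the only factor of \<open>C 0\<close>.
\<close>

definition cech_embed :: "'b \<Rightarrow> nat set \<Rightarrow> ('b \<times> nat) set" where
  "cech_embed x = (\<lambda>I\<in>cech_index r 0. frac_rel R M (fprod I) `` {(x, 0)})"

lemma cech_index_0: "cech_index r 0 = {{}}"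
  by (auto simp: cech_index_def dest: finite_subset)

lemma localization_one: "graded_localization R M \<one> 0 \<pi>"
  using graded_localization_fprod[of "{}"] by simp

lemma cech_embed_eq: "cech_embed x = (\<lambda>I\<in>{{}}. localization.frac R M \<one> x 0)"
proof -
  interpret graded_localization R M \<one> 0 \<pi> by (rule localization_one)
  show ?thesis
    by (rule ext) (simp add: cech_embed_def cech_index_0 frac_def restrict_def)
qed

lemma C_0: "C 0 = prod_module {{}} (\<lambda>I. gr_localization R M \<one> 0)"
  by (simp add: cech_module_eq cech_index_0 prod_module_def cech_loc_def restrict_def PiE_def Pi_def fun_eq_iff)

lemma cech_embed_linear: "R_linear R M (C 0) cech_embed"
proof -
  interpret graded_localization R M \<one> 0 \<pi> by (rule localization_one)
  show ?thesis
    unfolding R_linear_def C_0 cech_embed_eq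
    by (auto simp: add_localization smult_localization intro!: restrict_ext)
qed

lemma cech_embed_injective:
  assumes "x \<in> carrier M" "cech_embed x = \<zero>\<^bsub>C 0\<^esub>"
  shows "x = \<zero>\<^bsub>M\<^esub>"
proof -
  interpret graded_localization R M \<one> 0 \<pi> by (rule localization_one)
  have "frac x 0 = \<zero>\<^bsub>gr_localization R M \<one> 0\<^esub>"
    using fun_cong[OF assms(2), of "{}"] unfolding cech_embed_eq C_0 by simp
  then have "frac x 0 = frac \<zero>\<^bsub>M\<^esub> 0"
    by (simp only: zero_localization)
  then obtain t where "pw t x = \<zero>\<^bsub>M\<^esub>"
    using assms(1) by (auto simp: frac_eq_iff)
  then show ?thesis
    using assms(1) by (simp add: pw_def)
qed

lemma cech_embed_hcomp: "cech_embed ` hcomp M e = hcomp (C 0) e"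
proof -
  interpret graded_localization R M \<one> 0 \<pi> by (rule localization_one)
  have frac: "frac x k = frac x 0" if "x \<in> carrier M" for x k
    using that by (intro fracI) (simp_all add: pw_def)
  have "hcomp (gr_localization R M \<one> 0) e = {frac x k | x k. x \<in> hcomp M e}"
    by (simp add: hcomp_localization)
  also have "\<dots> = (\<lambda>x. frac x 0) ` hcomp M e"
    using frac[OF hcomp_closed] by blast
  finally have hc: "hcomp (C 0) e = (\<Pi>\<^sub>E I\<in>{{}}. (\<lambda>x. frac x 0) ` hcomp M e)"
    by (simp add: C_0)
  show ?thesis
    unfolding hc cech_embed_eq[abs_def]
  proof (intro equalityI subsetI)
    fix c assume c: "c \<in> (\<Pi>\<^sub>E I\<in>{{}::nat set}. (\<lambda>x. frac x 0) ` hcomp M e)"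
    then have "c {} \<in> (\<lambda>x. frac x 0) ` hcomp M e"
      by (rule PiE_mem) simp
    then obtain x where x: "x \<in> hcomp M e" "c {} = frac x 0"
      by blast
    have "c I = (\<lambda>I\<in>{{}}. frac x 0) I" for I
      using x(2) PiE_arb[OF c, of I] by (cases "I = {}") auto
    then show "c \<in> (\<lambda>x. \<lambda>I\<in>{{}}. frac x 0) ` hcomp M e"
      using x(1) by blast
  next
    fix c assume "c \<in> (\<lambda>x. \<lambda>I\<in>{{}::nat set}. frac x 0) ` hcomp M e"
    then obtain x where x: "x \<in> hcomp M e" and c: "c = (\<lambda>I\<in>{{}}. frac x 0)"
      by blast
    show "c \<in> (\<Pi>\<^sub>E I\<in>{{}}. (\<lambda>x. frac x 0) ` hcomp M e)"
      unfolding c restrict_PiE_iff using x by blast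
  qed
qed

end

section \<open>Graded modules over the polynomial ring\<close>

lemma graded_module_gr_group: "graded_module R M \<Longrightarrow> gr_group M"
  by (auto simp: graded_module_def gr_group_def gr_group_axioms_def module_def)

lemma gr_comp_smult:
  assumes M: "graded_module R M" and a: "a \<in> carrier R" "a \<in> rcomp R \<alpha>" and x: "x \<in> carrier M"
  shows "gr_comp M (e + \<alpha>) (a \<odot>\<^bsub>M\<^esub> x) = a \<odot>\<^bsub>M\<^esub> gr_comp M e x"
proof -
  interpret module R M
    using M by (simp add: graded_module_def)
  show ?thesis
  proof (rule gr_comp_additive_map[symmetric])
    show "additive M M (\<lambda>x. a \<odot>\<^bsub>M\<^esub> x)"
      using a by (auto simp: additive_def smult_r_distr)
    show "(\<lambda>x. a \<odot>\<^bsub>M\<^esub> x) ` hcomp M e \<subseteq> hcomp M (e + \<alpha>)" for e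
      using M a(2) by (auto simp: graded_module_def add.commute)
  qed (use M x graded_module_gr_group in auto)
qed

lemma graded_hom_linear: "graded_hom R M N h \<Longrightarrow> R_linear R M N h"
  by (auto simp: graded_hom_def R_linear_def)

lemma graded_hom_strict:
  assumes M: "graded_module R M" and N: "graded_module R N" and h: "graded_hom R M N h"
    and x: "x \<in> carrier M" "h x \<in> hcomp N e"
  shows "h x \<in> h ` hcomp M e"
proof -
  interpret M: gr_group M
    using M by (rule graded_module_gr_group)
  interpret N: gr_group N
    using N by (rule graded_module_gr_group)
  have "h (gr_comp M e x) = gr_comp N (e + 0) (h x)"
    using h R_linear_additive[OF graded_hom_linear[OF h]] x(1) M.gr_group_axioms N.gr_group_axioms
    by (intro gr_comp_additive_map) (auto simp: graded_hom_def)
  then have "h (gr_comp M e x) = h x"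
    using N.gr_comp_homogeneous[OF x(2)] by simp
  then show ?thesis
    using M.gr_comp_decomposition(1)[OF x(1), of e] by (metis imageI)
qed

context mpoly begin

lemma rcomp_closed: "a \<in> rcomp R \<alpha> \<Longrightarrow> a \<in> carrier R"
  by (simp add: gr_mpoly_ring_def)

lemma gr_koszul_graded_module:
  assumes "graded_module R L"
  shows "gr_koszul R L v n \<gamma> (gr_comp L)"
proof -
  interpret module R L
    using assms by (simp add: graded_module_def)
  interpret koszul R L v n
    by unfold_locales (rule v_closed)
  show ?thesis
  proof unfold_locales
    show "gr_projection L (gr_comp L)"
      by (rule gr_group.gr_projection_gr_comp[OF graded_module_gr_group[OF assms]])
    show "gr_comp L (e + \<gamma> j) (v j \<odot>\<^bsub>L\<^esub> x) = v j \<odot>\<^bsub>L\<^esub> gr_comp L e x" if "j < n" "x \<in> carrier L" for j e x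
      by (rule gr_comp_smult[OF assms v_closed[OF that(1)] v_homogeneous[OF that(1)] that(2)])
  qed
qed

lemma gr_koszul_map_graded_hom:
  assumes "graded_module R L" "graded_module R L'" "graded_hom R L L' h"
  shows "gr_koszul_map R L L' v n \<gamma> (gr_comp L) (gr_comp L') h"
  using assms(3)
  by (intro gr_koszul_map.intro gr_koszul_graded_module gr_koszul_map_axioms.intro assms graded_hom_linear)
    (auto simp: graded_hom_def)

end

section \<open>Koszul vanishing along a free resolution\<close>

locale cech_resolution = mpoly S n \<gamma>
  for S :: "('s, 'x) ring_scheme" and n :: nat and \<gamma> :: "nat \<Rightarrow> 'g::ab_group_add" +
  fixes r :: nat and f :: "nat \<Rightarrow> nat multiset \<Rightarrow> 's" and \<delta> :: "nat \<Rightarrow> 'g"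
    and M :: "(nat multiset \<Rightarrow> 's, 'm, 'g) gr_module"
    and F :: "int \<Rightarrow> (nat multiset \<Rightarrow> 's, 'f, 'g) gr_module"
    and d :: "int \<Rightarrow> 'f \<Rightarrow> 'f" and \<epsilon> :: "'f \<Rightarrow> 'm"
  assumes f_homogeneous: "\<And>i. i < r \<Longrightarrow> f i \<in> rcomp R (\<delta> i)"
    and f_ideal: "\<And>i. i < r \<Longrightarrow> f i \<in> Idl\<^bsub>R\<^esub> (v ` {..<n})"
    and M_graded: "graded_module R M"
    and resolution: "graded_free_resolution R M F d \<epsilon>"
begin

lemma F_graded: "graded_module R (F i)"
  using resolution by (simp add: graded_free_resolution_def)

lemma F_basis: "\<exists>E. homogeneous_basis R (F i) E"
  using resolution by (simp add: graded_free_resolution_def)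

lemma F_negative: "i < 0 \<Longrightarrow> carrier (F i) = {\<zero>\<^bsub>F i\<^esub>}"
  using resolution by (simp add: graded_free_resolution_def)

lemma d_hom: "graded_hom R (F i) (F (i - 1)) (d i)"
  using resolution by (simp add: graded_free_resolution_def)

lemma \<epsilon>_hom: "graded_hom R (F 0) M \<epsilon>"
  using resolution by (simp add: graded_free_resolution_def)

lemma \<epsilon>_surj: "\<epsilon> ` carrier (F 0) = carrier M"
  using resolution by (simp add: graded_free_resolution_def)

lemma \<epsilon>_kernel: "a_kernel (F 0) M \<epsilon> = d 1 ` carrier (F 1)"
  using resolution by (simp add: graded_free_resolution_def)

lemma d_kernel: "i > 0 \<Longrightarrow> a_kernel (F i) (F (i - 1)) (d i) = d (i + 1) ` carrier (F (i + 1))"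
  using resolution by (simp add: graded_free_resolution_def)

lemma F_module: "module R (F i)"
  using F_graded by (simp add: graded_module_def)

lemma d_exact: "i > 0 \<Longrightarrow> x \<in> carrier (F i) \<Longrightarrow>
    d i x = \<zero>\<^bsub>F (i - 1)\<^esub> \<longleftrightarrow> x \<in> d (i + 1) ` carrier (F (i + 1))"
  using d_kernel[of i] by (auto simp: a_kernel_def kernel_def)

lemma \<epsilon>_exact: "x \<in> carrier (F 0) \<Longrightarrow> \<epsilon> x = \<zero>\<^bsub>M\<^esub> \<longleftrightarrow> x \<in> d 1 ` carrier (F 1)"
  using \<epsilon>_kernel by (auto simp: a_kernel_def kernel_def)

lemma boundaries_closed: "d (i + 1) ` carrier (F (i + 1)) \<subseteq> carrier (F i)"
  using d_hom[of "i + 1"] by (auto simp: graded_hom_def)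

lemma zero_boundary: "\<zero>\<^bsub>F i\<^esub> \<in> d (i + 1) ` carrier (F (i + 1))"
proof -
  interpret Fi: module R "F i" by (rule F_module)
  interpret Fj: module R "F (i + 1)" by (rule F_module)
  have "additive (F (i + 1)) (F i) (d (i + 1))"
    using R_linear_additive[OF graded_hom_linear[OF d_hom[of "i + 1"]]] by simp
  from additive_zero[OF Fj.M.abelian_group_axioms Fi.M.abelian_group_axioms this]
  show ?thesis
    using imageI[OF Fj.M.zero_closed, of "d (i + 1)"] by simp
qed

lemma cech_koszul: "cech_koszul R M f \<delta> r (gr_comp M) v n \<gamma>"
proof -
  interpret module R M
    using M_graded by (simp add: graded_module_def)
  show ?thesis
  proof unfold_locales
    show "f i \<in> carrier R" "f i \<in> Idl\<^bsub>R\<^esub> (v ` {..<n})" if "i < r" for i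
      using that f_homogeneous f_ideal rcomp_closed by blast+
    show "gr_projection M (gr_comp M)"
      by (rule gr_group.gr_projection_gr_comp[OF graded_module_gr_group[OF M_graded]])
    show "gr_comp M (e + \<delta> i) (f i \<odot>\<^bsub>M\<^esub> x) = f i \<odot>\<^bsub>M\<^esub> gr_comp M e x" if "i < r" "x \<in> carrier M" for i e x
      by (rule gr_comp_smult[OF M_graded rcomp_closed[OF f_homogeneous[OF that(1)]] f_homogeneous[OF that(1)] that(2)])
    show "v j \<in> carrier R" if "j < n" for j
      using that by (rule v_closed)
    show "gr_comp M (e + \<gamma> j) (v j \<odot>\<^bsub>M\<^esub> x) = v j \<odot>\<^bsub>M\<^esub> gr_comp M e x" if "j < n" "x \<in> carrier M" for j e x
      by (rule gr_comp_smult[OF M_graded v_closed[OF that(1)] v_homogeneous[OF that(1)] that(2)])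
  qed
qed

context
  fixes j :: nat and g :: 'g
  assumes van: "\<And>k J. J \<subseteq> {..<n} \<Longrightarrow> card J = j + k \<Longrightarrow>
      g - (\<Sum>i\<in>J. \<gamma> i) \<notin> gr_supp (cech_cohomology R M f \<delta> r (int k))"
begin

text \<open>
  The composite of the augmentation with \<open>cech_embed\<close> identifies the cokernel of \<open>d 1\<close> with \<open>C 0\<close>.
\<close>

lemma koszul_vanishes_F0: "koszul_vanishes R (F 0) v n \<gamma> g j (d 1 ` carrier (F 1))"
proof -
  interpret cech_koszul R M f \<delta> r "gr_comp M" v n \<gamma>
    by (rule cech_koszul)
  interpret F0: gr_group "F 0"
    by (rule graded_module_gr_group[OF F_graded])
  let ?h = "\<lambda>x. cech_embed (\<epsilon> x)"
  have \<epsilon>: "\<epsilon> x \<in> carrier M" if "x \<in> carrier (F 0)" for x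
    using \<epsilon>_surj that by blast
  have lin: "R_linear R (F 0) (C 0) ?h"
    using graded_hom_linear[OF \<epsilon>_hom] cech_embed_linear unfolding R_linear_def by (auto simp: Pi_iff)
  have "?h ` hcomp (F 0) e \<subseteq> hcomp (C 0) e" for e
    using \<epsilon>_hom cech_embed_hcomp[of e] unfolding graded_hom_def by blast
  then interpret h: gr_koszul_map R "F 0" "C 0" v n \<gamma> "gr_comp (F 0)" "cpi 0" ?h
    using lin by (intro gr_koszul_map.intro gr_koszul_graded_module F_graded gr_koszul_C
        gr_koszul_map_axioms.intro)
  show ?thesis
  proof (rule h.koszul_vanishes_of_quotient[OF koszul_vanishes_cech[OF van]])
    show "hcomp (C 0) e \<subseteq> ?h ` hcomp (F 0) e" for e
    proof
      fix c assume "c \<in> hcomp (C 0) e"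
      then obtain m where m: "m \<in> hcomp M e" "c = cech_embed m"
        using cech_embed_hcomp[of e] by blast
      moreover have "m \<in> carrier M"
        by (rule gr_group.hcomp_closed[OF graded_module_gr_group[OF M_graded] m(1)])
      then obtain x where "x \<in> carrier (F 0)" "m = \<epsilon> x"
        using \<epsilon>_surj by blast
      then have "m \<in> \<epsilon> ` hcomp (F 0) e"
        using graded_hom_strict[OF F_graded M_graded \<epsilon>_hom] m(1) by blast
      ultimately show "c \<in> ?h ` hcomp (F 0) e"
        by blast
    qed
    show "?h x = \<zero>\<^bsub>C 0\<^esub> \<longleftrightarrow> x \<in> d 1 ` carrier (F 1)" if "x \<in> carrier (F 0)" for x
    proof -
      have "cech_embed \<zero>\<^bsub>M\<^esub> = \<zero>\<^bsub>C 0\<^esub>"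
        by (rule additive_zero[OF M.abelian_group_axioms h.L'.M.abelian_group_axioms
              R_linear_additive[OF cech_embed_linear]])
      then have "?h x = \<zero>\<^bsub>C 0\<^esub> \<longleftrightarrow> \<epsilon> x = \<zero>\<^bsub>M\<^esub>"
        using cech_embed_injective[OF \<epsilon>[OF that]] by metis
      then show ?thesis
        using \<epsilon>_exact[OF that] by simp
    qed
    show "d 1 ` carrier (F 1) \<subseteq> carrier (F 0)"
      using boundaries_closed[of 0] by simp
  qed auto
qed

text \<open>
  Going one step up the resolution lowers the homological degree by one. For \<open>i < j\<close> it is still
  positive, where the Koszul complex of a free module is exact.
\<close>

lemma koszul_vanishes_F:
  assumes "i < j"
  shows "koszul_vanishes R (F (int i)) v n \<gamma> g (j - i) (d (int i + 1) ` carrier (F (int i + 1)))"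
  using assms
proof (induction i)
  case 0
  then show ?case
    using koszul_vanishes_F0 by simp
next
  case (Suc i)
  let ?i = "int i + 1"
  have h: "graded_hom R (F ?i) (F (int i)) (d ?i)"
    using d_hom[of ?i] by simp
  interpret h: gr_koszul_map R "F ?i" "F (int i)" v n \<gamma> "gr_comp (F ?i)" "gr_comp (F (int i))" "d ?i"
    by (rule gr_koszul_map_graded_hom[OF F_graded F_graded h])
  have exact: "d ?i x = \<zero>\<^bsub>F (int i)\<^esub> \<longleftrightarrow> x \<in> d (?i + 1) ` carrier (F (?i + 1))"
    if "x \<in> carrier (F ?i)" for x
    using d_exact[of ?i x] that by simp
  have "koszul_vanishes R (F ?i) v n \<gamma> g (j - Suc i) (d (?i + 1) ` carrier (F (?i + 1)))"
  proof (rule h.koszul_vanishes_step)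
    show "koszul_vanishes R (F (int i)) v n \<gamma> g (Suc (j - Suc i)) (d ?i ` carrier (F ?i))"
      using Suc by (simp add: Suc_diff_Suc)
    show "d ?i x \<in> d ?i ` hcomp (F ?i) e" if "x \<in> carrier (F ?i)" "d ?i x \<in> hcomp (F (int i)) e" for e x
      by (rule graded_hom_strict[OF F_graded F_graded h that])
    show "x \<in> d (?i + 1) ` carrier (F (?i + 1))"
      if "x \<in> hcomp (F ?i) (g - (\<Sum>j\<in>J. \<gamma> j))" "d ?i x = \<zero>\<^bsub>F (int i)\<^esub>" for J x
      using exact h.L.hcomp_closed[OF that(1)] that(2) by blast
    show "\<zero>\<^bsub>F ?i\<^esub> \<in> d (?i + 1) ` carrier (F (?i + 1))"
      by (rule zero_boundary)
    show "d ?i x = \<zero>\<^bsub>F (int i)\<^esub>" if "x \<in> d (?i + 1) ` carrier (F (?i + 1))" for x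
      using exact boundaries_closed[of ?i] that by blast
    fix c assume c: "c \<in> kchains (F (int i)) n \<gamma> g (j - Suc i)"
      and cycle: "\<And>J. kdiff R (F (int i)) v n c J = \<zero>\<^bsub>F (int i)\<^esub>"
    obtain E where "homogeneous_basis R (F (int i)) E"
      using F_basis by blast
    then show "\<exists>b. (\<forall>J. b J \<in> carrier (F (int i))) \<and> (\<forall>J. kdiff R (F (int i)) v n b J = c J)"
    proof (rule koszul_exact_free[OF F_module])
      show "c J = \<zero>\<^bsub>F (int i)\<^esub>" if "J \<inter> {..<n} = {}" for J
      proof (rule h.L'.kchains_non_index[OF c])
        show "\<not> (J \<subseteq> {..<n} \<and> card J = j - Suc i)"
          using that Suc.prems by (auto simp: Int_absorb2)
      qed
    qed (use h.L'.kchains_closed[OF c] cycle in auto)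
  qed
  then show ?case
    by (simp add: add.commute)
qed

text \<open>
  The hypotheses on \<open>x\<close> and \<open>y\<close> say that \<open>x\<close> is a cycle modulo the variables, since the differential
  of a \<open>1\<close>-chain is a combination of the variables; the conclusion says that it is a boundary
  modulo the variables. This is the dimension shift to homological degree zero, where the Koszul
  complex of \<open>F (j - 1)\<close> is not exact and \<open>y\<close> takes over the role of exactness.
\<close>

lemma tor_cycle_is_boundary:
  assumes x: "x \<in> hcomp (F (int j)) g"
    and y: "\<And>J. y J \<in> carrier (F (int j - 1))" "d (int j) x = kdiff R (F (int j - 1)) v n y {}"
  shows "\<exists>u w. u \<in> carrier (F (int j + 1)) \<and> (\<forall>J. w J \<in> carrier (F (int j))) \<and>
    x = d (int j + 1) u \<oplus>\<^bsub>F (int j)\<^esub> kdiff R (F (int j)) v n w {}"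
proof -
  interpret Fj: gr_koszul R "F (int j)" v n \<gamma> "gr_comp (F (int j))"
    by (rule gr_koszul_graded_module[OF F_graded])
  define z where "z J = (if J = {} then x else \<zero>\<^bsub>F (int j)\<^esub>)" for J :: "nat set"
  have card0: "J \<subseteq> {..<n} \<and> card J = 0 \<longleftrightarrow> J = {}" for J :: "nat set"
    using finite_subset[of J "{..<n}"] by auto
  have z: "z \<in> kchains (F (int j)) n \<gamma> g 0"
  proof (rule Fj.kchainsI)
    fix J :: "nat set" assume "J \<subseteq> {..<n}" "card J = 0"
    then have "J = {}" using card0 by blast
    then show "z J \<in> hcomp (F (int j)) (g - (\<Sum>i\<in>J. \<gamma> i))"
      using x by (simp add: z_def)
  next
    fix J :: "nat set" assume "\<not> (J \<subseteq> {..<n} \<and> card J = 0)"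
    then show "z J = \<zero>\<^bsub>F (int j)\<^esub>"
      using card0 by (simp add: z_def)
  qed
  have "\<exists>w\<in>kchains (F (int j)) n \<gamma> g (Suc 0). \<forall>J. z J \<ominus>\<^bsub>F (int j)\<^esub> kdiff R (F (int j)) v n w J
      \<in> d (int j + 1) ` carrier (F (int j + 1))"
  proof (cases j)
    case 0
    \<comment> \<open>in homological degree zero every chain is a cycle\<close>
    have "kdiff R (F 0) v n z J \<in> d 1 ` carrier (F 1)" for J
    proof -
      have "(ksign R i J \<otimes>\<^bsub>R\<^esub> v i) \<odot>\<^bsub>F (int j)\<^esub> z (insert i J) = \<zero>\<^bsub>F (int j)\<^esub>" if "i < n" for i
        using that v_closed by (simp add: z_def)
      then have "kdiff R (F (int j)) v n z J = \<zero>\<^bsub>F (int j)\<^esub>"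
        unfolding kdiff_def by (intro Fj.M.add.finprod_one_eqI) auto
      then show ?thesis
        using zero_boundary[of 0] 0 by simp
    qed
    then show ?thesis
      using koszul_vanishes_F0 z 0 unfolding koszul_vanishes_def by auto
  next
    case (Suc i)
    then have ij: "int j - 1 = int i" "int j = int i + 1"
      by auto
    have h: "graded_hom R (F (int j)) (F (int i)) (d (int j))"
      using d_hom[of "int j"] ij(1) by simp
    interpret h: gr_koszul_map R "F (int j)" "F (int i)" v n \<gamma> "gr_comp (F (int j))" "gr_comp (F (int i))" "d (int j)"
      by (rule gr_koszul_map_graded_hom[OF F_graded F_graded h])
    have exact: "d (int j) x = \<zero>\<^bsub>F (int i)\<^esub> \<longleftrightarrow> x \<in> d (int j + 1) ` carrier (F (int j + 1))"
      if "x \<in> carrier (F (int j))" for x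
      using d_exact[of "int j" x] that ij by simp
    \<comment> \<open>cut the chain down to singletons, so that only its value at the empty set survives\<close>
    define b where "b J = (if card J = 1 then y J else \<zero>\<^bsub>F (int i)\<^esub>)" for J :: "nat set"
    have b: "b J \<in> carrier (F (int i))" for J
      using y(1) ij(1) by (simp add: b_def)
    have db: "kdiff R (F (int i)) v n b J = d (int j) (z J)" for J
    proof (cases "J = {}")
      case True
      have "kdiff R (F (int i)) v n b {} = kdiff R (F (int i)) v n y {}"
        unfolding kdiff_def using y(1) ij(1) v_closed
        by (intro h.L'.M.finsum_cong') (auto simp: b_def)
      then show ?thesis
        using True y(2) ij(1) by (simp add: z_def)
    next
      case False
      have "(ksign R k J \<otimes>\<^bsub>R\<^esub> v k) \<odot>\<^bsub>F (int i)\<^esub> b (insert k J) = \<zero>\<^bsub>F (int i)\<^esub>" if "k \<in> {..<n} - J" for k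
      proof -
        have "card (insert k J) \<noteq> 1"
        proof
          assume "card (insert k J) = 1"
          then obtain l where "insert k J = {l}"
            by (rule card_1_singletonE)
          then have "J \<subseteq> {k}" by auto
          then show False
            using that False by auto
        qed
        then show ?thesis
          using that v_closed by (simp add: b_def)
      qed
      then have "kdiff R (F (int i)) v n b J = \<zero>\<^bsub>F (int i)\<^esub>"
        unfolding kdiff_def by (intro h.L'.M.add.finprod_one_eqI) auto
      then show ?thesis
        using False h.h_zero by (simp add: z_def)
    qed
    obtain z' where z': "z' \<in> kchains (F (int i)) n \<gamma> g (Suc 0)"
      "\<And>J. d (int j) (z J) = kdiff R (F (int i)) v n z' J"
      using h.L'.kchains_boundary[OF h.h_kchains[OF z] b db] by auto
    show ?thesis
    proof (rule h.koszul_vanishes_lift[OF _ _ _ _ z z'])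
      show "koszul_vanishes R (F (int i)) v n \<gamma> g (Suc 0) (d (int j) ` carrier (F (int j)))"
        using koszul_vanishes_F[of i] Suc ij(2) by simp
      show "d (int j) x \<in> d (int j) ` hcomp (F (int j)) e"
        if "x \<in> carrier (F (int j))" "d (int j) x \<in> hcomp (F (int i)) e" for e x
        by (rule graded_hom_strict[OF F_graded F_graded h that])
      show "x \<in> d (int j + 1) ` carrier (F (int j + 1))"
        if "x \<in> hcomp (F (int j)) (g - (\<Sum>j\<in>J. \<gamma> j))" "d (int j) x = \<zero>\<^bsub>F (int i)\<^esub>" for J x
        using exact Fj.hcomp_closed[OF that(1)] that(2) by blast
      show "\<zero>\<^bsub>F (int j)\<^esub> \<in> d (int j + 1) ` carrier (F (int j + 1))"
        by (rule zero_boundary)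
    qed
  qed
  then obtain w where w: "w \<in> kchains (F (int j)) n \<gamma> g (Suc 0)"
    and "z {} \<ominus>\<^bsub>F (int j)\<^esub> kdiff R (F (int j)) v n w {} \<in> d (int j + 1) ` carrier (F (int j + 1))"
    by blast
  then obtain u where u: "u \<in> carrier (F (int j + 1))"
    and eq: "x \<ominus>\<^bsub>F (int j)\<^esub> kdiff R (F (int j)) v n w {} = d (int j + 1) u"
    by (auto simp: z_def)
  have "kdiff R (F (int j)) v n w {} \<in> carrier (F (int j))"
    by (rule Fj.kdiff_closed[OF Fj.kchains_closed[OF w]])
  then have "x = d (int j + 1) u \<oplus>\<^bsub>F (int j)\<^esub> kdiff R (F (int j)) v n w {}"
    unfolding eq[symmetric] using Fj.hcomp_closed[OF x]
    by (simp add: a_minus_def Fj.M.a_assoc Fj.M.l_neg)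
  then show ?thesis
    using u Fj.kchains_closed[OF w] by blast
qed

end

end

section \<open>Tensoring with the coefficient module\<close>

lemma free_Abelian_coset: "K #>\<^bsub>free_Abelian_group U\<^esub> p = (\<lambda>k. k + p) ` K"
  by (auto simp: r_coset_def)

lemma (in abelian_group) finsum_in_subgroup:
  assumes H: "subgroup H (add_monoid G)" and "finite A" "\<And>i. i \<in> A \<Longrightarrow> f i \<in> H"
  shows "(\<Oplus>\<^bsub>G\<^esub>i\<in>A. f i) \<in> H"
  using assms(2,3)
proof (induction A rule: finite_induct)
  case empty
  then show ?case
    using subgroup.one_closed[OF H] by simp
next
  case (insert a A)
  have "f i \<in> carrier G" if "i \<in> insert a A" for i
    using insert.prems[OF that] subgroup.mem_carrier[OF H] by simp
  then have "(\<Oplus>\<^bsub>G\<^esub>i\<in>insert a A. f i) = f a \<oplus>\<^bsub>G\<^esub> (\<Oplus>\<^bsub>G\<^esub>i\<in>A. f i)"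
    using insert.hyps by (intro finsum_insert) auto
  then show ?case
    using insert subgroup.m_closed[OF H] by simp
qed

lemma tensor_relators_cases [consumes 1]:
  assumes "p \<in> tensor_relators R F N"
  obtains (left) x x' y where "p = frag_of (x \<oplus>\<^bsub>F\<^esub> x', y) - frag_of (x, y) - frag_of (x', y)"
      "x \<in> carrier F" "x' \<in> carrier F" "y \<in> carrier N"
    | (right) x y y' where "p = frag_of (x, y \<oplus>\<^bsub>N\<^esub> y') - frag_of (x, y) - frag_of (x, y')"
      "x \<in> carrier F" "y \<in> carrier N" "y' \<in> carrier N"
    | (smult) r x y where "p = frag_of (r \<odot>\<^bsub>F\<^esub> x, y) - frag_of (x, r \<odot>\<^bsub>N\<^esub> y)"
      "r \<in> carrier R" "x \<in> carrier F" "y \<in> carrier N"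
proof -
  from assms consider
    "p \<in> {frag_of (x \<oplus>\<^bsub>F\<^esub> x', y) - frag_of (x, y) - frag_of (x', y) | x x' y.
        x \<in> carrier F \<and> x' \<in> carrier F \<and> y \<in> carrier N}"
    | "p \<in> {frag_of (x, y \<oplus>\<^bsub>N\<^esub> y') - frag_of (x, y) - frag_of (x, y') | x y y'.
        x \<in> carrier F \<and> y \<in> carrier N \<and> y' \<in> carrier N}"
    | "p \<in> {frag_of (r \<odot>\<^bsub>F\<^esub> x, y) - frag_of (x, r \<odot>\<^bsub>N\<^esub> y) | r x y.
        r \<in> carrier R \<and> x \<in> carrier F \<and> y \<in> carrier N}"
    unfolding tensor_relators_def Un_iff by argo
  then show thesis
  proof cases
    case 1
    then show thesis
      by (elim CollectE exE conjE) (rule left)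
  next
    case 2
    then show thesis
      by (elim CollectE exE conjE) (rule right)
  next
    case 3
    then show thesis
      by (elim CollectE exE conjE) (rule smult)
  qed
qed

locale tensor_coeff = mpoly S n \<gamma> + F: module "gr_mpoly_ring S n \<gamma>" F
  for S :: "('s, 'x) ring_scheme" and n :: nat and \<gamma> :: "nat \<Rightarrow> 'g::ab_group_add"
    and F :: "(nat multiset \<Rightarrow> 's, 'f, 'g) gr_module"
begin

abbreviation I where "I \<equiv> var_ideal S n \<gamma>"

abbreviation N where "N \<equiv> coeff_module S n \<gamma>"

abbreviation cls where "cls a \<equiv> I +>\<^bsub>R\<^esub> a"

abbreviation K where "K \<equiv> tensor_kernel R F N"

abbreviation A where "A \<equiv> free_Abelian_group (carrier F \<times> carrier N)"

abbreviation gen where "gen x \<equiv> frag_of (x, cls \<one>\<^bsub>R\<^esub>)"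

sublocale F: koszul "gr_mpoly_ring S n \<gamma>" F v n
  by unfold_locales (rule v_closed)

lemma ideal_I: "ideal I R"
  unfolding var_ideal_def using v_closed by (intro F.R.genideal_ideal) auto

lemma v_in_I:
  assumes "i < n" shows "v i \<in> I"
proof -
  have "v ` {..<n} \<subseteq> carrier R"
    using v_closed by auto
  from F.R.genideal_self[OF this] show ?thesis
    unfolding var_ideal_def using assms by blast
qed

lemma I_closed: "a \<in> I \<Longrightarrow> a \<in> carrier R"
  by (rule ideal.Icarr[OF ideal_I])

lemma cls_eq_iff: "a \<in> carrier R \<Longrightarrow> b \<in> carrier R \<Longrightarrow> cls a = cls b \<longleftrightarrow> a \<ominus>\<^bsub>R\<^esub> b \<in> I"
  using F.R.quotient_eq_iff_same_a_r_cos[OF ideal_I] by blast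

lemma regular_coset: "I +>\<^bsub>gr_regular_module R\<^esub> a = cls a"
  by (simp add: a_r_coset_def' gr_regular_module_def)

lemma carrier_N: "carrier N = cls ` carrier R"
  by (simp add: coeff_module_def gr_subquot_def regular_coset)

lemma cls_in_N: "a \<in> carrier R \<Longrightarrow> cls a \<in> carrier N"
  by (simp add: carrier_N)

lemma hcomp_N: "hcomp N e = cls ` rcomp R e"
proof -
  have "carrier R \<inter> rcomp R e = rcomp R e"
    using rcomp_closed by blast
  moreover have "hcomp N e = cls ` (carrier R \<inter> rcomp R e)"
    unfolding coeff_module_def gr_subquot_def regular_coset by (simp add: gr_regular_module_def)
  ultimately show ?thesis by simp
qed

lemma add_N: "a \<in> carrier R \<Longrightarrow> b \<in> carrier R \<Longrightarrow> cls a \<oplus>\<^bsub>N\<^esub> cls b = cls (a \<oplus>\<^bsub>R\<^esub> b)"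
proof -
  assume ab: "a \<in> carrier R" "b \<in> carrier R"
  have "cls a \<oplus>\<^bsub>N\<^esub> cls b = set_add R (cls a) (cls b)"
    by (simp add: coeff_module_def gr_subquot_def set_add_def' gr_regular_module_def)
  also have "\<dots> = cls (a \<oplus>\<^bsub>R\<^esub> b)"
    using abelian_subgroup.a_rcos_sum[OF abelian_subgroupI3[OF ideal.axioms(1)[OF ideal_I] F.R.abelian_group_axioms] ab] .
  finally show ?thesis .
qed

lemma smult_N:
  assumes r: "r \<in> carrier R" and a: "a \<in> carrier R"
  shows "r \<odot>\<^bsub>N\<^esub> cls a = cls (r \<otimes>\<^bsub>R\<^esub> a)"
proof -
  interpret I: ideal I R by (rule ideal_I)
  have "cls (r \<otimes>\<^bsub>R\<^esub> b) = cls (r \<otimes>\<^bsub>R\<^esub> a)" if b: "b \<in> cls a" for b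
  proof -
    obtain i where i: "i \<in> I" "b = i \<oplus>\<^bsub>R\<^esub> a"
      using b unfolding a_r_coset_def' by blast
    then have "r \<otimes>\<^bsub>R\<^esub> b \<ominus>\<^bsub>R\<^esub> r \<otimes>\<^bsub>R\<^esub> a = r \<otimes>\<^bsub>R\<^esub> i"
      using r a I_closed[OF i(1)] by (simp add: F.R.r_distr a_minus_def F.R.a_assoc F.R.r_neg)
    then have "r \<otimes>\<^bsub>R\<^esub> b \<ominus>\<^bsub>R\<^esub> r \<otimes>\<^bsub>R\<^esub> a \<in> I"
      using I.I_l_closed[OF i(1) r] by simp
    then show ?thesis
      using r a i I_closed[OF i(1)] by (subst cls_eq_iff) auto
  qed
  moreover have "a \<in> cls a"
    using I.zero_closed a unfolding a_r_coset_def' by force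
  moreover have "r \<odot>\<^bsub>N\<^esub> cls a = (\<Union>b\<in>cls a. cls (r \<otimes>\<^bsub>R\<^esub> b))"
    unfolding coeff_module_def gr_subquot_def regular_coset by (simp add: gr_regular_module_def)
  ultimately show ?thesis by blast
qed

lemma cls_I: "a \<in> I \<Longrightarrow> cls a = I"
  by (rule F.R.a_coset_join2[OF I_closed additive_subgroup.a_subgroup[OF ideal.axioms(1)[OF ideal_I]]])

lemma relators_closed: "tensor_relators R F N \<subseteq> carrier A"
proof -
  have "y \<oplus>\<^bsub>N\<^esub> y' \<in> carrier N" if "y \<in> carrier N" "y' \<in> carrier N" for y y'
    using that add_N unfolding carrier_N by auto
  moreover have "r \<odot>\<^bsub>N\<^esub> y \<in> carrier N" if "r \<in> carrier R" "y \<in> carrier N" for r y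
    using that smult_N unfolding carrier_N by auto
  moreover have "Poly_Mapping.keys (p - q) \<subseteq> U"
    if "Poly_Mapping.keys p \<subseteq> U" "Poly_Mapping.keys q \<subseteq> U" for p q :: "'f \<times> (nat multiset \<Rightarrow> 's) set \<Rightarrow>\<^sub>0 int" and U
    using order.trans[OF keys_diff Un_least[OF that]] .
  ultimately show ?thesis
    unfolding tensor_relators_def
    by (intro Un_least subsetI; clarify; simp only: carrier_free_Abelian_group_iff; simp)
qed

lemma kernel_subgroup: "subgroup K A"
  unfolding tensor_kernel_def
  by (rule group.generate_is_subgroup[OF group_free_Abelian_group relators_closed])

lemma kernel_closed: "p \<in> K \<Longrightarrow> Poly_Mapping.keys p \<subseteq> carrier F \<times> carrier N"
  using subgroup.mem_carrier[OF kernel_subgroup] by simp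

lemma kernel_zero: "0 \<in> K"
  using subgroup.one_closed[OF kernel_subgroup] by simp

lemma kernel_add: "p \<in> K \<Longrightarrow> q \<in> K \<Longrightarrow> p + q \<in> K"
  using subgroup.m_closed[OF kernel_subgroup] by simp

lemma kernel_minus: "p \<in> K \<Longrightarrow> - p \<in> K"
  using subgroup.m_inv_closed[OF kernel_subgroup, of p] inv_free_Abelian_group[OF kernel_closed, of p] by simp

lemma kernel_diff: "p \<in> K \<Longrightarrow> q \<in> K \<Longrightarrow> p - q \<in> K"
  using kernel_add[OF _ kernel_minus, of p q] by simp

lemma kernel_relator: "p \<in> tensor_relators R F N \<Longrightarrow> p \<in> K"
  unfolding tensor_kernel_def by (rule generate.incl)

lemma kernel_add_left:
  "x \<in> carrier F \<Longrightarrow> x' \<in> carrier F \<Longrightarrow> y \<in> carrier N \<Longrightarrow>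
    frag_of (x \<oplus>\<^bsub>F\<^esub> x', y) - frag_of (x, y) - frag_of (x', y) \<in> K"
  by (rule kernel_relator) (unfold tensor_relators_def, blast)

lemma kernel_add_right:
  "x \<in> carrier F \<Longrightarrow> y \<in> carrier N \<Longrightarrow> y' \<in> carrier N \<Longrightarrow>
    frag_of (x, y \<oplus>\<^bsub>N\<^esub> y') - frag_of (x, y) - frag_of (x, y') \<in> K"
  by (rule kernel_relator) (unfold tensor_relators_def, blast)

lemma kernel_smult:
  "r \<in> carrier R \<Longrightarrow> x \<in> carrier F \<Longrightarrow> y \<in> carrier N \<Longrightarrow>
    frag_of (r \<odot>\<^bsub>F\<^esub> x, y) - frag_of (x, r \<odot>\<^bsub>N\<^esub> y) \<in> K"
  by (rule kernel_relator) (unfold tensor_relators_def, blast)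

lemma kernel_zero_left: "y \<in> carrier N \<Longrightarrow> frag_of (\<zero>\<^bsub>F\<^esub>, y) \<in> K"
  using kernel_minus[OF kernel_add_left[of "\<zero>\<^bsub>F\<^esub>" "\<zero>\<^bsub>F\<^esub>" y]] by simp

text \<open>
  The zero element of the coefficient module is the ideal \<open>I\<close> itself.
\<close>

lemma kernel_zero_right: "x \<in> carrier F \<Longrightarrow> frag_of (x, I) \<in> K"
proof -
  assume x: "x \<in> carrier F"
  have zero: "\<zero>\<^bsub>R\<^esub> \<in> I"
    by (rule additive_subgroup.zero_closed[OF ideal.axioms(1)[OF ideal_I]])
  have "I \<in> carrier N" "I \<oplus>\<^bsub>N\<^esub> I = I"
    using cls_in_N[of "\<zero>\<^bsub>R\<^esub>"] add_N[of "\<zero>\<^bsub>R\<^esub>" "\<zero>\<^bsub>R\<^esub>"] cls_I[OF zero] by simp_all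
  then show ?thesis
    using kernel_minus[OF kernel_add_right[OF x, of I I]] by simp
qed

lemma one_N: "cls \<one>\<^bsub>R\<^esub> \<in> carrier N"
  by (simp add: cls_in_N)

lemma gen_add: "x \<in> carrier F \<Longrightarrow> x' \<in> carrier F \<Longrightarrow> gen (x \<oplus>\<^bsub>F\<^esub> x') - gen x - gen x' \<in> K"
  by (rule kernel_add_left[OF _ _ one_N])

lemma gen_minus:
  assumes x: "x \<in> carrier F" shows "gen (\<ominus>\<^bsub>F\<^esub> x) + gen x \<in> K"
proof -
  have "gen \<zero>\<^bsub>F\<^esub> - gen (\<ominus>\<^bsub>F\<^esub> x) - gen x \<in> K"
    using gen_add[of "\<ominus>\<^bsub>F\<^esub> x" x] x by (simp add: F.M.l_neg)
  then have "gen \<zero>\<^bsub>F\<^esub> - (gen \<zero>\<^bsub>F\<^esub> - gen (\<ominus>\<^bsub>F\<^esub> x) - gen x) \<in> K"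
    by (rule kernel_diff[OF kernel_zero_left[OF one_N]])
  then show ?thesis
    by (simp add: algebra_simps)
qed

lemma gen_smult:
  assumes "a \<in> carrier R" "x \<in> carrier F"
  shows "gen (a \<odot>\<^bsub>F\<^esub> x) - frag_of (x, cls a) \<in> K"
  using kernel_smult[OF assms one_N] assms by (simp add: smult_N)

lemma gen_ideal:
  assumes "a \<in> I" "x \<in> carrier F" shows "gen (a \<odot>\<^bsub>F\<^esub> x) \<in> K"
  using kernel_add[OF gen_smult[OF I_closed[OF assms(1)] assms(2)] kernel_zero_right[OF assms(2)]] cls_I[OF assms(1)]
  by simp

lemma gen_kernel_subgroup: "subgroup {x \<in> carrier F. gen x \<in> K} (add_monoid F)"
proof (rule F.M.add.subgroupI)
  show "{x \<in> carrier F. gen x \<in> K} \<noteq> {}"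
    using kernel_zero_left[OF one_N] by auto
  fix x assume x: "x \<in> {x \<in> carrier F. gen x \<in> K}"
  then have "gen (\<ominus>\<^bsub>F\<^esub> x) + gen x - gen x \<in> K"
    by (intro kernel_diff gen_minus) auto
  then show "\<ominus>\<^bsub>F\<^esub> x \<in> {x \<in> carrier F. gen x \<in> K}"
    using x by simp
  fix y assume y: "y \<in> {x \<in> carrier F. gen x \<in> K}"
  have "(gen (x \<oplus>\<^bsub>F\<^esub> y) - gen x - gen y) + (gen x + gen y) \<in> K"
    using x y by (intro kernel_add gen_add) auto
  then show "x \<oplus>\<^bsub>F\<^esub> y \<in> {x \<in> carrier F. gen x \<in> K}"
    using x y by simp
qed auto

lemma gen_kdiff:
  assumes "\<And>J. w J \<in> carrier F"
  shows "gen (kdiff R F v n w {}) \<in> K"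
proof -
  have "(\<Oplus>\<^bsub>F\<^esub>j\<in>{..<n} - {}. (ksign R j {} \<otimes>\<^bsub>R\<^esub> v j) \<odot>\<^bsub>F\<^esub> w (insert j {})) \<in> {x \<in> carrier F. gen x \<in> K}"
  proof (rule F.M.finsum_in_subgroup[OF gen_kernel_subgroup])
    fix j assume "j \<in> {..<n} - {}"
    then have "ksign R j {} \<otimes>\<^bsub>R\<^esub> v j \<in> I"
      using ideal.I_l_closed[OF ideal_I v_in_I F.R.ksign_closed] by auto
    then show "(ksign R j {} \<otimes>\<^bsub>R\<^esub> v j) \<odot>\<^bsub>F\<^esub> w (insert j {}) \<in> {x \<in> carrier F. gen x \<in> K}"
      using gen_ideal assms I_closed by auto
  qed auto
  then show ?thesis
    by (simp add: kdiff_def)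
qed

text \<open>
  The submodule generated by the products of a variable and an element of \<open>F\<close>, as the image of the
  \<open>1\<close>-chains under the Koszul differential.
\<close>

definition IF :: "'f set" where
  "IF = {kdiff R F v n w {} | w. \<forall>J. w J \<in> carrier F}"

lemma IF_I: "(\<And>J. w J \<in> carrier F) \<Longrightarrow> kdiff R F v n w {} = x \<Longrightarrow> x \<in> IF"
  unfolding IF_def by blast

lemma IF_cases:
  assumes "x \<in> IF"
  obtains w where "\<And>J. w J \<in> carrier F" "x = kdiff R F v n w {}"
  using assms unfolding IF_def by blast

lemma IF_closed: "x \<in> IF \<Longrightarrow> x \<in> carrier F"
  by (erule IF_cases) (simp add: F.kdiff_closed)

lemma IF_add:
  assumes "x \<in> IF" "y \<in> IF"
  shows "x \<oplus>\<^bsub>F\<^esub> y \<in> IF"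
proof -
  obtain w where w: "\<And>J. w J \<in> carrier F" "x = kdiff R F v n w {}"
    using assms(1) unfolding IF_def by blast
  obtain w' where w': "\<And>J. w' J \<in> carrier F" "y = kdiff R F v n w' {}"
    using assms(2) unfolding IF_def by blast
  show ?thesis
    unfolding w(2) w'(2) using w(1) w'(1) F.kdiff_additive[of w w' "{}"]
    by (intro IF_I[of "\<lambda>J. w J \<oplus>\<^bsub>F\<^esub> w' J"]) simp_all
qed

lemma IF_zero: "\<zero>\<^bsub>F\<^esub> \<in> IF"
  by (rule IF_I[of "\<lambda>J. \<zero>\<^bsub>F\<^esub>"]) (simp_all add: F.kdiff_zero)

lemma IF_smult:
  assumes "r \<in> carrier R" "x \<in> IF"
  shows "r \<odot>\<^bsub>F\<^esub> x \<in> IF"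
proof -
  obtain w where w: "\<And>J. w J \<in> carrier F" "x = kdiff R F v n w {}"
    using assms(2) unfolding IF_def by blast
  show ?thesis
    unfolding w(2) using w(1) assms(1) F.kdiff_smult[of w r "{}"]
    by (intro IF_I[of "\<lambda>J. r \<odot>\<^bsub>F\<^esub> w J"]) simp_all
qed

lemma IF_minus: "x \<in> IF \<Longrightarrow> \<ominus>\<^bsub>F\<^esub> x \<in> IF"
  using IF_smult[of "\<ominus>\<^bsub>R\<^esub> \<one>\<^bsub>R\<^esub>" x] IF_closed[of x] by (simp add: F.smult_l_minus)

lemma v_smult_IF:
  assumes "i < n" "x \<in> carrier F"
  shows "v i \<odot>\<^bsub>F\<^esub> x \<in> IF"
proof (rule IF_I)
  show "kdiff R F v n (kwedge R F i (\<lambda>J. x)) {} = v i \<odot>\<^bsub>F\<^esub> x"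
    using F.kdiff_kwedge_notin[of "\<lambda>J. x" i "{}"] assms by simp
qed (use assms in \<open>simp add: F.kwedge_closed\<close>)

lemma I_smult_IF:
  assumes a: "a \<in> I" and x: "x \<in> carrier F"
  shows "a \<odot>\<^bsub>F\<^esub> x \<in> IF"
proof -
  define W where "W = {a \<in> carrier R. \<forall>x\<in>carrier F. a \<odot>\<^bsub>F\<^esub> x \<in> IF}"
  have W: "a \<in> W \<longleftrightarrow> a \<in> carrier R \<and> (\<forall>x\<in>carrier F. a \<odot>\<^bsub>F\<^esub> x \<in> IF)" for a
    by (simp add: W_def)
  have mult: "r \<otimes>\<^bsub>R\<^esub> a \<in> W" if "a \<in> W" "r \<in> carrier R" for a r
    using that IF_smult unfolding W by (simp add: F.smult_assoc1)
  have "ideal W R"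
  proof (rule idealI[OF F.R.ring_axioms])
    show "subgroup W (add_monoid R)"
    proof (rule F.R.add.subgroupI)
      show "W \<subseteq> carrier R"
        by (auto simp: W)
      have "\<zero>\<^bsub>R\<^esub> \<in> W"
        by (simp add: W IF_zero)
      then show "W \<noteq> {}"
        by auto
      fix a assume a: "a \<in> W"
      then show "\<ominus>\<^bsub>R\<^esub> a \<in> W"
        unfolding W by (simp add: F.smult_l_minus IF_minus)
      fix b assume "b \<in> W"
      then show "a \<oplus>\<^bsub>R\<^esub> b \<in> W"
        using a unfolding W by (simp add: F.smult_l_distr IF_add)
    qed
    fix a r assume a: "a \<in> W" and r: "r \<in> carrier R"
    show "r \<otimes>\<^bsub>R\<^esub> a \<in> W"
      by (rule mult[OF a r])
    then show "a \<otimes>\<^bsub>R\<^esub> r \<in> W"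
      using a r by (simp add: W F.R.m_comm)
  qed
  moreover have "v ` {..<n} \<subseteq> W"
    using v_closed v_smult_IF by (auto simp: W)
  ultimately have "I \<subseteq> W"
    unfolding var_ideal_def by (rule F.R.genideal_minimal)
  then show ?thesis
    using a x W by blast
qed

lemma cls_smult_IF:
  assumes "a \<in> carrier R" "b \<in> carrier R" "cls a = cls b" "x \<in> carrier F"
  shows "a \<odot>\<^bsub>F\<^esub> x \<ominus>\<^bsub>F\<^esub> b \<odot>\<^bsub>F\<^esub> x \<in> IF"
proof -
  have "(a \<ominus>\<^bsub>R\<^esub> b) \<odot>\<^bsub>F\<^esub> x \<in> IF"
    using assms cls_eq_iff by (intro I_smult_IF) auto
  then show ?thesis
    using assms by (simp add: a_minus_def F.smult_l_distr F.smult_l_minus)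
qed

definition rep :: "(nat multiset \<Rightarrow> 's) set \<Rightarrow> nat multiset \<Rightarrow> 's" where
  "rep y = (SOME a. a \<in> carrier R \<and> cls a = y)"

lemma rep:
  assumes "y \<in> carrier N" shows "rep y \<in> carrier R" "cls (rep y) = y"
proof -
  have "\<exists>a. a \<in> carrier R \<and> cls a = y"
    using assms unfolding carrier_N by blast
  from someI_ex[OF this] show "rep y \<in> carrier R" "cls (rep y) = y"
    unfolding rep_def by blast+
qed

text \<open>
  The assignment \<open>x \<otimes> (a + I) \<mapsto> a x\<close> is well defined modulo \<open>IF\<close>. With chosen representatives \<open>a\<close>
  it becomes a homomorphism on the free abelian group that sends all relators into \<open>IF\<close>, and
  \<open>x \<otimes> 1\<close> to \<open>x\<close> up to an element of \<open>IF\<close>.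
\<close>

lemma gen_kernel_IF:
  assumes x: "x \<in> carrier F" and K: "gen x \<in> K"
  shows "x \<in> IF"
proof -
  have "(\<lambda>(x, y). rep y \<odot>\<^bsub>F\<^esub> x) ` (carrier F \<times> carrier N) \<subseteq> carrier (add_monoid F)"
    using rep by auto
  from comm_group.free_Abelian_group_universal[OF F.M.a_comm_group this] obtain \<Phi>
    where hom: "\<Phi> \<in> hom A (add_monoid F)"
      and \<Phi>: "\<And>p. p \<in> carrier F \<times> carrier N \<Longrightarrow> \<Phi> (frag_of p) = (case p of (x, y) \<Rightarrow> rep y \<odot>\<^bsub>F\<^esub> x)"
    by blast
  interpret \<Phi>: group_hom A "add_monoid F" \<Phi>
    using hom by (simp add: group_hom_def group_hom_axioms_def F.M.a_group)
  have diff: "\<Phi> (p - q) = \<Phi> p \<ominus>\<^bsub>F\<^esub> \<Phi> q" if "p \<in> carrier A" "q \<in> carrier A" for p q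
    using \<Phi>.hom_mult[of p "inv\<^bsub>A\<^esub> q"] \<Phi>.hom_inv[of q] that by (simp add: a_minus_def a_inv_def)
  have gen: "\<Phi> (frag_of (x, y)) = rep y \<odot>\<^bsub>F\<^esub> x" if "x \<in> carrier F" "y \<in> carrier N" for x y
    using \<Phi>[of "(x, y)"] that by simp
  have N_add: "y \<oplus>\<^bsub>N\<^esub> y' \<in> carrier N" if "y \<in> carrier N" "y' \<in> carrier N" for y y'
    using that add_N unfolding carrier_N by auto
  have N_smult: "r \<odot>\<^bsub>N\<^esub> y \<in> carrier N" if "r \<in> carrier R" "y \<in> carrier N" for r y
    using that smult_N unfolding carrier_N by auto
  have fragA: "frag_of (x, y) \<in> carrier A" if "x \<in> carrier F" "y \<in> carrier N" for x y
    using that by simp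
  have diffA: "p - q \<in> carrier A" if "p \<in> carrier A" "q \<in> carrier A" for p q
    using that keys_diff[of p q] unfolding carrier_free_Abelian_group_iff by blast
  have rel: "\<Phi> p \<in> IF" if "p \<in> tensor_relators R F N" for p
  proof -
    show ?thesis
      using that
    proof (cases rule: tensor_relators_cases)
      case (left x x' y)
      then have "\<Phi> p = rep y \<odot>\<^bsub>F\<^esub> (x \<oplus>\<^bsub>F\<^esub> x') \<ominus>\<^bsub>F\<^esub> rep y \<odot>\<^bsub>F\<^esub> x \<ominus>\<^bsub>F\<^esub> rep y \<odot>\<^bsub>F\<^esub> x'"
        by (simp only: diff diffA fragA gen F.M.a_closed)
      also have "\<dots> = \<zero>\<^bsub>F\<^esub>"
        using left rep(1)[OF left(4)] by (simp add: F.smult_r_distr a_minus_def F.M.a_assoc F.M.a_lcomm F.M.r_neg)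
      finally show ?thesis
        by (simp add: IF_zero)
    next
      case (right x y y')
      note r = rep[OF right(3)] rep[OF right(4)] rep[OF N_add[OF right(3,4)]]
      have "\<Phi> p = rep (y \<oplus>\<^bsub>N\<^esub> y') \<odot>\<^bsub>F\<^esub> x \<ominus>\<^bsub>F\<^esub> rep y \<odot>\<^bsub>F\<^esub> x \<ominus>\<^bsub>F\<^esub> rep y' \<odot>\<^bsub>F\<^esub> x"
        using right by (simp only: diff diffA fragA gen N_add)
      also have "\<dots> = rep (y \<oplus>\<^bsub>N\<^esub> y') \<odot>\<^bsub>F\<^esub> x \<ominus>\<^bsub>F\<^esub> (rep y \<oplus>\<^bsub>R\<^esub> rep y') \<odot>\<^bsub>F\<^esub> x"
        using right(2) r by (simp add: a_minus_def F.smult_l_distr F.M.minus_add F.M.a_assoc)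
      also have "\<dots> \<in> IF"
        using r right(2) add_N[OF r(1) r(3)] by (intro cls_smult_IF) auto
      finally show ?thesis .
    next
      case (smult r x y)
      note r = rep[OF smult(4)] rep[OF N_smult[OF smult(2,4)]]
      have "\<Phi> p = rep y \<odot>\<^bsub>F\<^esub> (r \<odot>\<^bsub>F\<^esub> x) \<ominus>\<^bsub>F\<^esub> rep (r \<odot>\<^bsub>N\<^esub> y) \<odot>\<^bsub>F\<^esub> x"
        using smult by (simp only: diff diffA fragA gen N_smult F.smult_closed)
      also have "\<dots> = (r \<otimes>\<^bsub>R\<^esub> rep y) \<odot>\<^bsub>F\<^esub> x \<ominus>\<^bsub>F\<^esub> rep (r \<odot>\<^bsub>N\<^esub> y) \<odot>\<^bsub>F\<^esub> x"
        using smult r by (simp add: F.smult_assoc1[symmetric] F.R.m_comm)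
      also have "\<dots> \<in> IF"
        using r smult smult_N[OF smult(2) r(1)] by (intro cls_smult_IF) auto
      finally show ?thesis .
    qed
  qed
  have "\<Phi> p \<in> IF" if "p \<in> K" for p
    using that unfolding tensor_kernel_def
  proof (induction rule: generate.induct)
    case one
    have "\<Phi> \<one>\<^bsub>A\<^esub> = \<zero>\<^bsub>F\<^esub>"
      using \<Phi>.hom_one by simp
    then show ?case
      using IF_zero by simp
  next
    case (inv h)
    then have "\<Phi> (inv\<^bsub>A\<^esub> h) = \<ominus>\<^bsub>F\<^esub> \<Phi> h"
      using \<Phi>.hom_inv[of h] relators_closed by (auto simp: a_inv_def)
    then show ?case
      using IF_minus[OF rel[OF inv]] by simp
  next
    case (eng h1 h2)
    then have "h1 \<in> carrier A" "h2 \<in> carrier A"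
      using subgroup.mem_carrier[OF kernel_subgroup] unfolding tensor_kernel_def by blast+
    then have "\<Phi> (h1 \<otimes>\<^bsub>A\<^esub> h2) = \<Phi> h1 \<oplus>\<^bsub>F\<^esub> \<Phi> h2"
      using \<Phi>.hom_mult[of h1 h2] by simp
    then show ?case
      using IF_add eng.IH by simp
  qed (rule rel)
  then have "rep (cls \<one>\<^bsub>R\<^esub>) \<odot>\<^bsub>F\<^esub> x \<in> IF"
    using gen[OF x one_N] K by metis
  moreover have "\<one>\<^bsub>R\<^esub> \<odot>\<^bsub>F\<^esub> x \<ominus>\<^bsub>F\<^esub> rep (cls \<one>\<^bsub>R\<^esub>) \<odot>\<^bsub>F\<^esub> x \<in> IF"
    using x rep[OF one_N] by (intro cls_smult_IF) auto
  ultimately have "(\<one>\<^bsub>R\<^esub> \<odot>\<^bsub>F\<^esub> x \<ominus>\<^bsub>F\<^esub> rep (cls \<one>\<^bsub>R\<^esub>) \<odot>\<^bsub>F\<^esub> x) \<oplus>\<^bsub>F\<^esub> rep (cls \<one>\<^bsub>R\<^esub>) \<odot>\<^bsub>F\<^esub> x \<in> IF"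
    by (rule IF_add[rotated])
  then show ?thesis
    using x rep(1)[OF one_N] by (simp add: a_minus_def F.M.a_assoc F.M.l_neg)
qed

end

section \<open>The degrees in which Tor vanishes\<close>

context tensor_coeff begin

lemma coset_eqI:
  assumes "p - q \<in> K"
  shows "K #>\<^bsub>A\<^esub> p = K #>\<^bsub>A\<^esub> q"
proof -
  have "K #>\<^bsub>A\<^esub> p \<subseteq> K #>\<^bsub>A\<^esub> q" if "p - q \<in> K" for p q
  proof
    fix t assume "t \<in> K #>\<^bsub>A\<^esub> p"
    then obtain k where k: "k \<in> K" "t = k + p"
      unfolding free_Abelian_coset by blast
    have "t = (k + (p - q)) + q"
      by (simp add: k(2))
    then show "t \<in> K #>\<^bsub>A\<^esub> q"
      unfolding free_Abelian_coset using kernel_add[OF k(1) that] by blast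
  qed
  moreover have "q - p \<in> K"
    using kernel_minus[OF assms] by simp
  ultimately show ?thesis
    using assms by blast
qed

lemma coset_self: "p \<in> K #>\<^bsub>A\<^esub> p"
  unfolding free_Abelian_coset using kernel_zero by force

lemma coset_zero: "p \<in> K \<Longrightarrow> K #>\<^bsub>A\<^esub> p = K"
  using coset_eqI[of p 0] by (simp add: free_Abelian_coset)

lemma coset_mult: "(K #>\<^bsub>A\<^esub> p) <#>\<^bsub>A\<^esub> (K #>\<^bsub>A\<^esub> q) = K #>\<^bsub>A\<^esub> (p + q)"
proof
  show "(K #>\<^bsub>A\<^esub> p) <#>\<^bsub>A\<^esub> (K #>\<^bsub>A\<^esub> q) \<subseteq> K #>\<^bsub>A\<^esub> (p + q)"
  proof
    fix t assume "t \<in> (K #>\<^bsub>A\<^esub> p) <#>\<^bsub>A\<^esub> (K #>\<^bsub>A\<^esub> q)"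
    then obtain k l where kl: "k \<in> K" "l \<in> K" "t = (k + p) + (l + q)"
      unfolding set_mult_def free_Abelian_coset by auto
    then have "t = (k + l) + (p + q)"
      by (simp add: algebra_simps)
    then show "t \<in> K #>\<^bsub>A\<^esub> (p + q)"
      unfolding free_Abelian_coset using kernel_add[OF kl(1,2)] by blast
  qed
  show "K #>\<^bsub>A\<^esub> (p + q) \<subseteq> (K #>\<^bsub>A\<^esub> p) <#>\<^bsub>A\<^esub> (K #>\<^bsub>A\<^esub> q)"
  proof
    fix t assume "t \<in> K #>\<^bsub>A\<^esub> (p + q)"
    then obtain k where k: "k \<in> K" "t = k + (p + q)"
      unfolding free_Abelian_coset by blast
    then have "t = (k + p) \<otimes>\<^bsub>A\<^esub> (0 + q)"
      by (simp add: algebra_simps)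
    moreover have "k + p \<in> K #>\<^bsub>A\<^esub> p" "0 + q \<in> K #>\<^bsub>A\<^esub> q"
      unfolding free_Abelian_coset using k(1) kernel_zero by blast+
    ultimately show "t \<in> (K #>\<^bsub>A\<^esub> p) <#>\<^bsub>A\<^esub> (K #>\<^bsub>A\<^esub> q)"
      unfolding set_mult_def by blast
  qed
qed

lemma tensor_simps:
  "carrier (gr_tensor R F N) = (\<lambda>p. K #>\<^bsub>A\<^esub> p) ` carrier A"
  "\<zero>\<^bsub>gr_tensor R F N\<^esub> = K"
  "U \<oplus>\<^bsub>gr_tensor R F N\<^esub> V = U <#>\<^bsub>A\<^esub> V"
  "hcomp (gr_tensor R F N) e = (\<lambda>p. K #>\<^bsub>A\<^esub> p) `
    generate A {frag_of (x, y) | x y \<alpha> \<beta>. x \<in> hcomp F \<alpha> \<and> y \<in> hcomp N \<beta> \<and> \<alpha> + \<beta> = e}"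
  by (auto simp: gr_tensor_def Let_def RCOSETS_def)

text \<open>
  Since \<open>x \<otimes> (a + I) = a x \<otimes> 1\<close>, sums of homogeneous generators of one degree collapse to a single
  \<open>x \<otimes> 1\<close>.
\<close>

lemma tensor_homogeneous:
  assumes F: "graded_module R F" and C: "C \<in> hcomp (gr_tensor R F N) e"
  shows "\<exists>x\<in>hcomp F e. C = K #>\<^bsub>A\<^esub> gen x"
proof -
  interpret F': gr_group F
    using F by (rule graded_module_gr_group)
  let ?T = "{frag_of (x, y) | x y \<alpha> \<beta>. x \<in> hcomp F \<alpha> \<and> y \<in> hcomp N \<beta> \<and> \<alpha> + \<beta> = e}"
  have minus: "\<ominus>\<^bsub>F\<^esub> x \<in> hcomp F e" if "x \<in> hcomp F e" for x
    using subgroup.m_inv_closed[OF F'.hcomp_subgroup] that by (simp add: a_inv_def)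
  have gens: "p \<in> carrier A \<and> (\<exists>x\<in>hcomp F e. p - gen x \<in> K)" if "p \<in> ?T" for p
  proof -
    obtain x y \<alpha> \<beta> where p: "p = frag_of (x, y)" "x \<in> hcomp F \<alpha>" "y \<in> hcomp N \<beta>" "\<alpha> + \<beta> = e"
      using \<open>p \<in> ?T\<close> by blast
    then obtain a where a: "a \<in> rcomp R \<beta>" "y = cls a"
      unfolding hcomp_N by blast
    have x: "x \<in> carrier F" and aR: "a \<in> carrier R"
      using p(2) F'.hcomp_closed a(1) rcomp_closed by blast+
    have "a \<odot>\<^bsub>F\<^esub> x \<in> hcomp F (\<beta> + \<alpha>)"
      using F a(1) p(2) unfolding graded_module_def by blast
    then have "a \<odot>\<^bsub>F\<^esub> x \<in> hcomp F e"
      using p(4) by (simp add: add.commute)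
    moreover have "p - gen (a \<odot>\<^bsub>F\<^esub> x) \<in> K"
      using kernel_minus[OF gen_smult[OF aR x]] by (simp add: p(1) a(2))
    moreover have "p \<in> carrier A"
      using x cls_in_N[OF aR] by (simp add: p(1) a(2))
    ultimately show ?thesis
      by blast
  qed
  have "\<exists>x\<in>hcomp F e. p - gen x \<in> K" if "p \<in> generate A ?T" for p
    using that
  proof (induction rule: generate.induct)
    case one
    have "0 - gen \<zero>\<^bsub>F\<^esub> \<in> K"
      by (rule kernel_diff[OF kernel_zero kernel_zero_left[OF one_N]])
    then show ?case
      using F'.hcomp_zero by auto
  next
    case (incl h)
    then show ?case
      using gens by blast
  next
    case (inv h)
    then obtain x where x: "x \<in> hcomp F e" "h - gen x \<in> K" and h: "h \<in> carrier A"
      using gens by blast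
    have "- (h - gen x) - (gen (\<ominus>\<^bsub>F\<^esub> x) + gen x) \<in> K"
      by (rule kernel_diff[OF kernel_minus[OF x(2)] gen_minus[OF F'.hcomp_closed[OF x(1)]]])
    moreover have "inv\<^bsub>A\<^esub> h = - h"
      using h by simp
    ultimately show ?case
      using minus[OF x(1)] by (intro bexI[of _ "\<ominus>\<^bsub>F\<^esub> x"]) (simp_all add: algebra_simps)
  next
    case (eng h1 h2)
    then obtain x1 x2 where x: "x1 \<in> hcomp F e" "h1 - gen x1 \<in> K" "x2 \<in> hcomp F e" "h2 - gen x2 \<in> K"
      by blast
    have "(h1 - gen x1) + (h2 - gen x2) - (gen (x1 \<oplus>\<^bsub>F\<^esub> x2) - gen x1 - gen x2) \<in> K"
      by (rule kernel_diff[OF kernel_add[OF x(2,4)] gen_add[OF F'.hcomp_closed[OF x(1)] F'.hcomp_closed[OF x(3)]]])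
    then show ?case
      using F'.hcomp_add[OF x(1,3)] by (intro bexI[of _ "x1 \<oplus>\<^bsub>F\<^esub> x2"]) (simp_all add: algebra_simps)
  qed
  then show ?thesis
    using C coset_eqI unfolding tensor_simps by blast
qed

end

locale tensor_coeff_map = L: tensor_coeff S n \<gamma> L + L': tensor_coeff S n \<gamma> L'
  for S :: "('s, 'x) ring_scheme" and n :: nat and \<gamma> :: "nat \<Rightarrow> 'g::ab_group_add"
    and L :: "(nat multiset \<Rightarrow> 's, 'f, 'g) gr_module" and L' :: "(nat multiset \<Rightarrow> 's, 'f, 'g) gr_module" +
  fixes h :: "'f \<Rightarrow> 'f"
  assumes h_linear: "R_linear (gr_mpoly_ring S n \<gamma>) L L' h"
begin

abbreviation ext :: "('f \<times> (nat multiset \<Rightarrow> 's) set \<Rightarrow>\<^sub>0 int) \<Rightarrow> 'f \<times> (nat multiset \<Rightarrow> 's) set \<Rightarrow>\<^sub>0 int" where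
  "ext \<equiv> frag_extend (\<lambda>(x, y). frag_of (h x, y))"

lemma h_closed: "x \<in> carrier L \<Longrightarrow> h x \<in> carrier L'"
  by (rule additive_closed[OF R_linear_additive[OF h_linear]])

lemma ext_relator:
  assumes "p \<in> tensor_relators L.R L L.N"
  shows "ext p \<in> L'.K"
  using assms
proof (cases rule: tensor_relators_cases)
  case (left x x' y)
  then have "ext p = frag_of (h x \<oplus>\<^bsub>L'\<^esub> h x', y) - frag_of (h x, y) - frag_of (h x', y)"
    by (simp add: frag_extend_diff additive_add[OF R_linear_additive[OF h_linear]])
  then show ?thesis
    using L'.kernel_add_left[OF h_closed[OF left(2)] h_closed[OF left(3)] left(4)] by simp
next
  case (right x y y')
  then have "ext p = frag_of (h x, y \<oplus>\<^bsub>L.N\<^esub> y') - frag_of (h x, y) - frag_of (h x, y')"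
    by (simp add: frag_extend_diff)
  then show ?thesis
    using L'.kernel_add_right[OF h_closed[OF right(2)] right(3,4)] by simp
next
  case (smult r x y)
  then have "ext p = frag_of (r \<odot>\<^bsub>L'\<^esub> h x, y) - frag_of (h x, r \<odot>\<^bsub>L.N\<^esub> y)"
    by (simp add: frag_extend_diff R_linear_smult[OF h_linear])
  then show ?thesis
    using L'.kernel_smult[OF smult(2) h_closed[OF smult(3)] smult(4)] by simp
qed

lemma ext_kernel:
  assumes "p \<in> L.K" shows "ext p \<in> L'.K"
  using assms unfolding tensor_kernel_def[of L.R L L.N]
proof (induction rule: generate.induct)
  case one
  then show ?case
    using L'.kernel_zero by simp
next
  case (incl h)
  then show ?case
    by (rule ext_relator)
next
  case (inv p)
  then have "Poly_Mapping.keys p \<subseteq> carrier L \<times> carrier L.N"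
    using subsetD[OF L.relators_closed inv] by simp
  then have "ext (inv\<^bsub>L.A\<^esub> p) = - ext p"
    by (simp add: frag_extend_minus)
  then show ?case
    using L'.kernel_minus[OF ext_relator[OF inv]] by simp
next
  case (eng p q)
  then show ?case
    using L'.kernel_add by (simp add: frag_extend_add)
qed

lemma tensor_map_coset:
  "tensor_map L.R L' L.N h (L.K #>\<^bsub>L.A\<^esub> p) = L'.K #>\<^bsub>L'.A\<^esub> ext p"
proof -
  have "L'.K #>\<^bsub>L'.A\<^esub> ext t = L'.K #>\<^bsub>L'.A\<^esub> ext p" if t: "t \<in> L.K #>\<^bsub>L.A\<^esub> p" for t
  proof (rule L'.coset_eqI)
    obtain k where "k \<in> L.K" "t = k + p"
      using t unfolding free_Abelian_coset by blast
    then show "ext t - ext p \<in> L'.K"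
      using ext_kernel by (simp add: frag_extend_add)
  qed
  then show ?thesis
    unfolding tensor_map_def using L.coset_self[of p] by blast
qed

lemma ext_gen: "ext (L.gen x) = L'.gen (h x)"
  by simp

lemma image_tensor_map:
  "tensor_map L.R L' L.N h ` carrier (gr_tensor L.R L L.N) = (\<lambda>p. L'.K #>\<^bsub>L'.A\<^esub> ext p) ` carrier L.A"
  unfolding L.tensor_simps image_image tensor_map_coset ..

text \<open>
  The image of the tensor map is a subgroup, so that adding one of its elements does not change it.
\<close>

lemma image_coset:
  assumes q: "q \<in> carrier L.A"
  shows "(tensor_map L.R L' L.N h ` carrier (gr_tensor L.R L L.N)) +>\<^bsub>gr_tensor L.R L' L.N\<^esub> (L'.K #>\<^bsub>L'.A\<^esub> ext q)
    = tensor_map L.R L' L.N h ` carrier (gr_tensor L.R L L.N)"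
proof -
  have "(tensor_map L.R L' L.N h ` carrier (gr_tensor L.R L L.N)) +>\<^bsub>gr_tensor L.R L' L.N\<^esub> (L'.K #>\<^bsub>L'.A\<^esub> ext q)
      = (\<lambda>p. (L'.K #>\<^bsub>L'.A\<^esub> ext p) <#>\<^bsub>L'.A\<^esub> (L'.K #>\<^bsub>L'.A\<^esub> ext q)) ` carrier L.A"
    unfolding a_r_coset_def' image_tensor_map L'.tensor_simps UNION_singleton_eq_range image_image ..
  also have "\<dots> = (\<lambda>p. L'.K #>\<^bsub>L'.A\<^esub> ext (p + q)) ` carrier L.A"
    unfolding L'.coset_mult frag_extend_add ..
  also have "\<dots> = (\<lambda>p. L'.K #>\<^bsub>L'.A\<^esub> ext p) ` ((\<lambda>p. p + q) ` carrier L.A)"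
    by (simp only: image_image)
  also have "(\<lambda>p. p + q) ` carrier L.A = carrier L.A"
  proof (intro equalityI subsetI)
    fix p assume "p \<in> (\<lambda>p. p + q) ` carrier L.A"
    then obtain p' where "p = p' + q" "p' \<in> carrier L.A"
      by blast
    then show "p \<in> carrier L.A"
      using q keys_add[of p' q] unfolding carrier_free_Abelian_group_iff by blast
  next
    fix p assume p: "p \<in> carrier L.A"
    have "p - q \<in> carrier L.A"
      using p q keys_diff[of p q] unfolding carrier_free_Abelian_group_iff by blast
    then show "p \<in> (\<lambda>p. p + q) ` carrier L.A"
      by (intro image_eqI[of _ _ "p - q"]) simp_all
  qed
  finally show ?thesis
    unfolding image_tensor_map .
qed

end

context cech_resolution begin

lemma tensor_coeff_F: "tensor_coeff S n \<gamma> (F i)"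
  by (intro tensor_coeff.intro mpoly_axioms F_module)

lemma tensor_coeff_map_d: "tensor_coeff_map S n \<gamma> (F i) (F (i - 1)) (d i)"
  by (intro tensor_coeff_map.intro tensor_coeff_map_axioms.intro tensor_coeff_F graded_hom_linear d_hom)

text \<open>
  A homogeneous element of \<open>F j \<otimes> S\<close> has the form \<open>x \<otimes> 1\<close>. If it is a cycle then \<open>d x\<close> lies in the
  submodule generated by the variables, by \<open>gen_kernel_IF\<close>. Then \<open>x\<close> equals some \<open>d u\<close> up to an
  element of that submodule, by \<open>tor_cycle_is_boundary\<close>, and \<open>x \<otimes> 1 = d u \<otimes> 1\<close> is a boundary.
\<close>

lemma Tor_vanishes:
  fixes j :: int and g :: 'g
  assumes van: "\<And>k J. J \<subseteq> {..<n} \<Longrightarrow> int (card J) = j + int k \<Longrightarrow>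
      g - (\<Sum>i\<in>J. \<gamma> i) \<notin> gr_supp (cech_cohomology R M f \<delta> r (int k))"
  shows "g \<notin> gr_supp (gr_Tor R F d (coeff_module S n \<gamma>) j)"
proof -
  let ?N = "coeff_module S n \<gamma>"
  interpret out: tensor_coeff_map S n \<gamma> "F j" "F (j - 1)" "d j"
    by (rule tensor_coeff_map_d)
  have "tensor_coeff_map S n \<gamma> (F (j + 1)) (F j) (d (j + 1))"
    using tensor_coeff_map_d[of "j + 1"] by simp
  then interpret into: tensor_coeff_map S n \<gamma> "F (j + 1)" "F j" "d (j + 1)" .
  let ?B = "tensor_map R (F j) ?N (d (j + 1)) ` carrier (gr_tensor R (F (j + 1)) ?N)"
  have bound: "\<exists>u\<in>carrier (F (j + 1)). out.L.gen x - out.L.gen (d (j + 1) u) \<in> out.L.K"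
    if x: "x \<in> hcomp (F j) g" and y: "d j x \<in> out.L'.IF" for x
  proof (cases "j < 0")
    case True
    have "x \<in> carrier (F j)"
      by (rule gr_group.hcomp_closed[OF graded_module_gr_group[OF F_graded] x])
    then have "x = \<zero>\<^bsub>F j\<^esub>"
      using F_negative[OF True] by simp
    moreover have "d (j + 1) \<zero>\<^bsub>F (j + 1)\<^esub> = \<zero>\<^bsub>F j\<^esub>"
      by (rule additive_zero[OF into.L.F.M.abelian_group_axioms out.L.F.M.abelian_group_axioms
            R_linear_additive[OF into.h_linear]])
    ultimately show ?thesis
      using out.L.kernel_zero into.L.F.M.zero_closed by (intro bexI[of _ "\<zero>\<^bsub>F (j + 1)\<^esub>"]) simp_all
  next
    case False
    then obtain m where m: "j = int m"
      by (metis nonneg_int_cases not_less)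
    obtain y where y: "\<And>J. y J \<in> carrier (F (j - 1))" "d j x = kdiff R (F (j - 1)) v n y {}"
      using y unfolding out.L'.IF_def by blast
    have van': "g - (\<Sum>i\<in>J. \<gamma> i) \<notin> gr_supp (cech_cohomology R M f \<delta> r (int k))"
      if "J \<subseteq> {..<n}" "card J = m + k" for k J
      using van[OF that(1)] that(2) m by simp
    have "\<exists>u w. u \<in> carrier (F (int m + 1)) \<and> (\<forall>J. w J \<in> carrier (F (int m))) \<and>
        x = d (int m + 1) u \<oplus>\<^bsub>F (int m)\<^esub> kdiff R (F (int m)) v n w {}"
      by (rule tor_cycle_is_boundary[where g = g and y = y, OF van']) (use x y m in simp_all)
    then obtain u w where u: "u \<in> carrier (F (j + 1))" and w: "\<And>J. w J \<in> carrier (F j)"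
        and eq: "x = d (j + 1) u \<oplus>\<^bsub>F j\<^esub> kdiff R (F j) v n w {}"
      unfolding m by blast
    have cl: "d (j + 1) u \<in> carrier (F j)" "kdiff R (F j) v n w {} \<in> carrier (F j)"
      using into.h_closed[OF u] out.L.F.kdiff_closed[of w] w by blast+
    have "(out.L.gen x - out.L.gen (d (j + 1) u) - out.L.gen (kdiff R (F j) v n w {}))
        + out.L.gen (kdiff R (F j) v n w {}) \<in> out.L.K"
      using out.L.gen_add[OF cl] out.L.gen_kdiff[OF w] unfolding eq[symmetric]
      by (rule out.L.kernel_add)
    then show ?thesis
      using u by auto
  qed
  have cosets: "?B +>\<^bsub>gr_tensor R (F j) ?N\<^esub> z = ?B"
    if ker: "z \<in> a_kernel (gr_tensor R (F j) ?N) (gr_tensor R (F (j - 1)) ?N) (tensor_map R (F (j - 1)) ?N (d j))"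
      and z: "z \<in> hcomp (gr_tensor R (F j) ?N) g" for z
  proof -
    obtain x where x: "x \<in> hcomp (F j) g" and zx: "z = out.L.K #>\<^bsub>out.L.A\<^esub> out.L.gen x"
      using out.L.tensor_homogeneous[OF F_graded z] by blast
    have xF: "x \<in> carrier (F j)"
      by (rule gr_group.hcomp_closed[OF graded_module_gr_group[OF F_graded] x])
    have "tensor_map R (F (j - 1)) ?N (d j) z = out.L'.K"
      using ker by (simp add: a_kernel_def kernel_def out.L'.tensor_simps)
    then have "out.L'.gen (d j x) \<in> out.L'.K"
      using out.L'.coset_self[of "out.L'.gen (d j x)"] unfolding zx out.tensor_map_coset out.ext_gen by simp
    then have "d j x \<in> out.L'.IF"
      by (rule out.L'.gen_kernel_IF[OF out.h_closed[OF xF]])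
    from bound[OF x this] obtain u where u: "u \<in> carrier (F (j + 1))"
      and "out.L.gen x - out.L.gen (d (j + 1) u) \<in> out.L.K"
      by blast
    then have z_ext: "z = out.L.K #>\<^bsub>out.L.A\<^esub> into.ext (into.L.gen u)"
      unfolding zx into.ext_gen by (intro out.L.coset_eqI)
    have "into.L.gen u \<in> carrier into.L.A"
      using u into.L.one_N by simp
    then show ?thesis
      unfolding z_ext by (rule into.image_coset)
  qed
  have zero: "out.L.K #>\<^bsub>out.L.A\<^esub> 0
      \<in> a_kernel (gr_tensor R (F j) ?N) (gr_tensor R (F (j - 1)) ?N) (tensor_map R (F (j - 1)) ?N (d j))
        \<inter> hcomp (gr_tensor R (F j) ?N) g"
  proof -
    have "tensor_map R (F (j - 1)) ?N (d j) (out.L.K #>\<^bsub>out.L.A\<^esub> 0) = out.L'.K"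
      unfolding out.tensor_map_coset using out.L'.coset_zero[OF out.L'.kernel_zero] by simp
    moreover have "out.L.K #>\<^bsub>out.L.A\<^esub> 0 \<in> hcomp (gr_tensor R (F j) ?N) g"
      unfolding out.L.tensor_simps using generate.one[of out.L.A] by (intro imageI) simp
    ultimately show ?thesis
      by (auto simp: a_kernel_def kernel_def out.L.tensor_simps(1) out.L'.tensor_simps(2))
  qed
  have "hcomp (gr_Tor R F d ?N j) g = (\<lambda>z. ?B +>\<^bsub>gr_tensor R (F j) ?N\<^esub> z) `
      (a_kernel (gr_tensor R (F j) ?N) (gr_tensor R (F (j - 1)) ?N) (tensor_map R (F (j - 1)) ?N (d j))
        \<inter> hcomp (gr_tensor R (F j) ?N) g)"
    by (simp add: gr_Tor_def gr_homology_def gr_subquot_def)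
  also have "\<dots> = {?B}"
    using cosets zero by blast
  finally have "hcomp (gr_Tor R F d ?N j) g = {?B}" .
  moreover have "\<zero>\<^bsub>gr_Tor R F d ?N j\<^esub> = ?B"
    by (simp add: gr_Tor_def gr_homology_def gr_subquot_def)
  ultimately show ?thesis
    by (simp add: gr_supp_def)
qed

end

theorem corollary3p8:
  fixes S :: "('s, 'x) ring_scheme"
    and n :: nat
    and \<gamma> :: "nat \<Rightarrow> 'g::ab_group_add"
    and R :: "(nat multiset \<Rightarrow> 's, 'g) gr_ring"
    and B :: "(nat multiset \<Rightarrow> 's) set"
    and r :: nat
    and f :: "nat \<Rightarrow> nat multiset \<Rightarrow> 's"
    and \<delta> :: "nat \<Rightarrow> 'g"
    and M :: "(nat multiset \<Rightarrow> 's, 'm, 'g) gr_module"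
    and F :: "int \<Rightarrow> (nat multiset \<Rightarrow> 's, 'f, 'g) gr_module"
    and d :: "int \<Rightarrow> 'f \<Rightarrow> 'f"
    and \<epsilon> :: "'f \<Rightarrow> 'm"
    and j :: int
  assumes "\<exists>A::'g set. finite A \<and> group_closure A = UNIV"
    and "cring S"
    and "R = gr_mpoly_ring S n \<gamma>"
    and "\<forall>i<r. f i \<in> rcomp R (\<delta> i)"
    and "B = Idl\<^bsub>R\<^esub> (f ` {..<r})"
    and "B \<subseteq> var_ideal S n \<gamma>"
    and "graded_module R M"
    and "graded_free_resolution R M F d \<epsilon>"
  shows "gr_supp (gr_Tor R F d (coeff_module S n \<gamma>) j)
    \<subseteq> (\<Union>k::nat. gr_supp (cech_cohomology R M f \<delta> r (int k)) + var_degree_sums n \<gamma> (j + int k))"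
proof
  fix g assume g: "g \<in> gr_supp (gr_Tor R F d (coeff_module S n \<gamma>) j)"
  interpret mpoly S n \<gamma>
    using assms(2) by (rule mpoly.intro)
  interpret M: module R M
    using assms(7) by (simp add: graded_module_def)
  have hom: "f i \<in> rcomp R (\<delta> i)" if "i < r" for i
    using assms(4) that by blast
  then have "f ` {..<r} \<subseteq> carrier R"
    using rcomp_closed unfolding assms(3) by blast
  then have "f ` {..<r} \<subseteq> B"
    unfolding assms(5) by (rule M.R.genideal_self)
  then have ideal: "f i \<in> var_ideal S n \<gamma>" if "i < r" for i
    using assms(6) that by blast
  interpret cech_resolution S n \<gamma> r f \<delta> M F d \<epsilon>
  proof (intro cech_resolution.intro mpoly_axioms cech_resolution_axioms.intro)
    show "f i \<in> rcomp (gr_mpoly_ring S n \<gamma>) (\<delta> i)" if "i < r" for i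
      using hom[OF that] unfolding assms(3) .
    show "f i \<in> Idl\<^bsub>gr_mpoly_ring S n \<gamma>\<^esub> (ring.indexed_var S ` {..<n})" if "i < r" for i
      using ideal[OF that] unfolding var_ideal_def .
    show "graded_module (gr_mpoly_ring S n \<gamma>) M"
      using assms(7) unfolding assms(3) .
    show "graded_free_resolution (gr_mpoly_ring S n \<gamma>) M F d \<epsilon>"
      using assms(8) unfolding assms(3) .
  qed
  show "g \<in> (\<Union>k::nat. gr_supp (cech_cohomology R M f \<delta> r (int k)) + var_degree_sums n \<gamma> (j + int k))"
  proof (rule ccontr)
    assume not: "g \<notin> (\<Union>k::nat. gr_supp (cech_cohomology R M f \<delta> r (int k)) + var_degree_sums n \<gamma> (j + int k))"
    have "g \<notin> gr_supp (gr_Tor R F d (coeff_module S n \<gamma>) j)"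
      unfolding assms(3)
    proof (rule Tor_vanishes)
      fix k :: nat and J assume J: "J \<subseteq> {..<n}" "int (card J) = j + int k"
      then have "(\<Sum>i\<in>J. \<gamma> i) \<in> var_degree_sums n \<gamma> (j + int k)"
        unfolding var_degree_sums_def by blast
      then have "(g - (\<Sum>i\<in>J. \<gamma> i)) + (\<Sum>i\<in>J. \<gamma> i) \<in> U + var_degree_sums n \<gamma> (j + int k)"
        if "g - (\<Sum>i\<in>J. \<gamma> i) \<in> U" for U
        using that by (intro set_plus_intro)
      then show "g - (\<Sum>i\<in>J. \<gamma> i) \<notin> gr_supp (cech_cohomology (gr_mpoly_ring S n \<gamma>) M f \<delta> r (int k))"
        using not unfolding assms(3) by auto
    qed
    then show False
      using g by blast
  qed
qed

end
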